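(* Let $1\le p<\infty$ and let $\Omega\subset\mathbb{R}^d$ be a bounded domain with Lipschitz boundary. Let $\rho\in L^{1}_{loc}(\mathbb{R}^d)$ be nonnegative, radial, with $|\boldsymbol{\xi}|^{-p}\rho(\boldsymbol{\xi})$ nonincreasing in $|\boldsymbol{\xi}|$, and with $\displaystyle\lim_{\delta\to0}\frac{\delta^{p}}{\int_{B_\delta}\rho(\boldsymbol{\xi})\,d\boldsymbol{\xi}}=0$. For each $n$ let $\rho_n\ge0$ be radial with $|\boldsymbol{\xi}|^{-p}\rho_n(\boldsymbol{\xi})$ nonincreasing in $|\boldsymbol{\xi}|$, and suppose $\rho_n\rightharpoonup\rho$ weakly in $L^{1}_{loc}(\mathbb{R}^d)$. If $\{\mathbf{u}_n\}$ is a bounded sequence in $L^{p}(\Omega;\mathbb{R}^d)$ such that $$\sup_{n\ge1}\int_\Omega\int_\Omega\rho_n(\mathbf{y}-\mathbf{x})\,|\mathscr{D}(\mathbf{u}_n)(\mathbf{x},\mathbf{y})|^{p}\,d\mathbf{y}\,d\mathbf{x}<\infty,$$ then $\{\mathbf{u}_n\}$ is precompact in $L^{p}(\Omega;\mathbb{R}^d)$. Moreover, any limit point is in $\mathcal{S}_{\rho,p}(\Omega)$.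
   Context: $\mathscr{D}(\mathbf{u})(\mathbf{x},\mathbf{y})=\frac{\mathbf{u}(\mathbf{y})-\mathbf{u}(\mathbf{x})}{|\mathbf{y}-\mathbf{x}|}\cdot\frac{\mathbf{y}-\mathbf{x}}{|\mathbf{y}-\mathbf{x}|}$. $B_\delta$ is the ball of radius $\delta$ about the origin. $\mathcal{S}_{\rho,p}(\Omega)=\{\mathbf{u}\in L^p(\Omega;\mathbb{R}^d):\int_\Omega\int_\Omega\rho(\mathbf{y}-\mathbf{x})|\mathscr{D}(\mathbf{u})(\mathbf{x},\mathbf{y})|^p\,d\mathbf{y}\,d\mathbf{x}<\infty\}$. *)

theory Defs
  imports "HOL-Analysis.Analysis"
begin

text \<open>Bounded Lipschitz domain: nonempty, open, connected, bounded, and near every boundary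
point the set is, after a rotation, the region strictly above the graph of a Lipschitz
function.  The rotation is encoded by a unit vector e (the "vertical" direction); the
graph function g is defined on the hyperplane orthogonal to e.\<close>
definition lipschitz_domain :: "'a::euclidean_space set \<Rightarrow> bool" where
  "lipschitz_domain \<Omega> \<longleftrightarrow> open \<Omega> \<and> connected \<Omega> \<and> \<Omega> \<noteq> {} \<and> bounded \<Omega> \<and>
     (\<forall>x0\<in>frontier \<Omega>. \<exists>r>0. \<exists>(e::'a) (g::'a \<Rightarrow> real) L.
        norm e = 1 \<and> L-lipschitz_on {z. z \<bullet> e = 0} g \<and>
        \<Omega> \<inter> ball x0 r = {x \<in> ball x0 r. x \<bullet> e > g (x - (x \<bullet> e) *\<^sub>R e)})"

definition Lp_space :: "real \<Rightarrow> 'a::euclidean_space set \<Rightarrow> ('a \<Rightarrow> 'b::euclidean_space) set" where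
  "Lp_space p \<Omega> = {u. u \<in> borel_measurable (lebesgue_on \<Omega>) \<and>
      (\<integral>\<^sup>+ x. ennreal (norm (u x) powr p) \<partial>lebesgue_on \<Omega>) < \<infinity>}"

definition Lp_dist_pow :: "real \<Rightarrow> 'a::euclidean_space set \<Rightarrow> ('a \<Rightarrow> 'b::euclidean_space) \<Rightarrow> ('a \<Rightarrow> 'b) \<Rightarrow> ennreal" where
  "Lp_dist_pow p \<Omega> u v = (\<integral>\<^sup>+ x. ennreal (norm (u x - v x) powr p) \<partial>lebesgue_on \<Omega>)"

definition Lp_precompact :: "real \<Rightarrow> 'a::euclidean_space set \<Rightarrow> ('a \<Rightarrow> 'b::euclidean_space) set \<Rightarrow> bool" where
  "Lp_precompact p \<Omega> U \<longleftrightarrow>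
     (\<forall>w. (\<forall>k. w k \<in> U) \<longrightarrow>
        (\<exists>(s::nat \<Rightarrow> nat) v. strict_mono s \<and> v \<in> Lp_space p \<Omega> \<and>
               (\<lambda>k. Lp_dist_pow p \<Omega> (w (s k)) v) \<longlonglongrightarrow> 0))"

definition nl_D :: "('a::euclidean_space \<Rightarrow> 'a) \<Rightarrow> 'a \<Rightarrow> 'a \<Rightarrow> real" where
  "nl_D u x y = ((u y - u x) /\<^sub>R norm (y - x)) \<bullet> ((y - x) /\<^sub>R norm (y - x))"

definition nl_energy :: "('a::euclidean_space \<Rightarrow> real) \<Rightarrow> real \<Rightarrow> 'a set \<Rightarrow> ('a \<Rightarrow> 'a) \<Rightarrow> ennreal" where
  "nl_energy \<rho> p \<Omega> u =
     (\<integral>\<^sup>+ x. (\<integral>\<^sup>+ y. ennreal (\<rho> (y - x) * \<bar>nl_D u x y\<bar> powr p) \<partial>lebesgue_on \<Omega>) \<partial>lebesgue_on \<Omega>)"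

definition S_space :: "('a::euclidean_space \<Rightarrow> real) \<Rightarrow> real \<Rightarrow> 'a set \<Rightarrow> ('a \<Rightarrow> 'a) set" where
  "S_space \<rho> p \<Omega> = {u \<in> Lp_space p \<Omega>. nl_energy \<rho> p \<Omega> u < \<infinity>}"

definition L1_loc :: "('a::euclidean_space \<Rightarrow> real) \<Rightarrow> bool" where
  "L1_loc f \<longleftrightarrow> f \<in> borel_measurable lebesgue \<and>
     (\<forall>K. compact K \<longrightarrow> set_integrable lebesgue K f)"

definition weak_L1_loc_conv :: "(nat \<Rightarrow> 'a::euclidean_space \<Rightarrow> real) \<Rightarrow> ('a \<Rightarrow> real) \<Rightarrow> bool" where
  "weak_L1_loc_conv fs f \<longleftrightarrow> (\<forall>n. L1_loc (fs n)) \<and> L1_loc f \<and>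
     (\<forall>K g. compact K \<longrightarrow> g \<in> borel_measurable lebesgue \<longrightarrow> (\<exists>B. \<forall>x. \<bar>g x\<bar> \<le> B) \<longrightarrow>
        (\<lambda>n. set_lebesgue_integral lebesgue K (\<lambda>x. fs n x * g x))
          \<longlonglongrightarrow> set_lebesgue_integral lebesgue K (\<lambda>x. f x * g x))"

definition radial :: "('a::real_normed_vector \<Rightarrow> real) \<Rightarrow> bool" where
  "radial f \<longleftrightarrow> (\<forall>x y. norm x = norm y \<longrightarrow> f x = f y)"

definition ratio_nonincr :: "real \<Rightarrow> ('a::real_normed_vector \<Rightarrow> real) \<Rightarrow> bool" where
  "ratio_nonincr p f \<longleftrightarrow>
     (\<forall>x y. 0 < norm x \<longrightarrow> norm x \<le> norm y \<longrightarrow> f y / norm y powr p \<le> f x / norm x powr p)"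

end

theory Submission
  imports Defs "HOL-Complex_Analysis.Great_Picard" "HOL-Library.Diagonal_Subsequence"
begin

text \<open>
  In a Lipschitz domain every point near a given point of the closure has a common family of
  directions \<open>z\<close> (a ball \<open>C\<close> off the origin) along which short segments stay inside the domain, so
  interior and boundary points can be treated alike, without cutoffs or extension.
  For \<open>T(t) = \<integral>\<^bsub>z \<in> C\<^esub> \<integral>\<^bsub>x\<^esub> |z \<bullet> (u(x + tz) - u(x))|\<^sup>p\<close> telescoping along segments gives
  \<open>T\<^sub>A(mt) \<le> 2\<^sup>p m\<^sup>p T(t)\<close>, where \<open>T\<^sub>A\<close> restricts \<open>x\<close> to a small piece \<open>A\<close> of the domain.
  Comparing the energy with \<open>\<integral> \<rho>\<close> over the dyadic shells of \<open>B\<^sub>\<delta>\<close>, on which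
  \<open>\<rho>(h) / |h|\<^sup>p\<close> is monotone, yields \<open>T\<^sub>A(\<delta>) \<integral>\<^bsub>B\<^sub>\<delta>\<^esub> \<rho> \<le> c \<delta>\<^sup>p E\<close>, which is uniformly small for the sequence.
  Since the matrix \<open>M = \<integral>\<^bsub>C\<^esub> \<psi>(z) z z\<^sup>t\<close> is invertible, smallness of \<open>T\<^sub>A(\<delta>)\<close> means that \<open>M u\<close> is close in
  \<open>L\<^sup>p(A)\<close> to the average of \<open>\<psi>(z) (z \<bullet> u(x + \<delta>z)) z\<close>, a convolution with a Lipschitz
  kernel, to which the Arzela-Ascoli theorem applies. A diagonal argument finishes the compactness proof.
  For the limit points one truncates the kernels near the origin, where weak convergence of
  the kernels can be tested against the bounded function built from the limit.
\<close>

section \<open>Preliminaries\<close>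

text \<open>The energy sees only the component of u(x+h) - u(x) along h, so compactness criteria
  based on full translates do not apply directly. This forces the rank-one average: a direction z
  contributes only z \<bullet> u, and a whole ball of directions is used so that these components
  together determine u. In terms of h = y - x the energy carries the weight \<rho>(h)/|h|^(2p).
  Writing h = tz takes a factor t^p out of the increment and leaves, up to a power of |z|, the
  monotone quotient \<rho>(h)/|h|^p. The factor m^p from telescoping cancels against the dyadic
  radii, so the constant c depends only on p and the dimension. Hence a kernel enters the
  compactness bound only through its mass on one ball, and this mass is what weak convergence
  controls. Restricting x to A is the price of telescoping, since a long chain of steps from another
  point could leave the domain. The scale \<delta> depends on the tolerance, and the averages are
  compact only at a fixed scale; therefore one subsequence is extracted for each tolerance.\<close>

lemma powr_add_le:
  fixes a b p :: real
  assumes "0 \<le> a" "0 \<le> b" "0 \<le> p"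
  shows "(a + b) powr p \<le> 2 powr p * (a powr p + b powr p)"
proof -
  have "(a + b) powr p \<le> (2 * max a b) powr p"
    using assms by (intro powr_mono2) auto
  also have "\<dots> = 2 powr p * max a b powr p"
    using assms by (simp add: powr_mult)
  also have "\<dots> \<le> 2 powr p * (a powr p + b powr p)"
    by (intro mult_left_mono) (auto simp: max_def)
  finally show ?thesis .
qed

text \<open>Jensen's inequality on a finite measure space, with 2^p times the sharp constant
  c^(p-1). It serves both the counting measure of a telescoping sum and Lebesgue measure on a ball
  of directions.\<close>

lemma powr_nn_integral_le:
  fixes f :: "'b \<Rightarrow> real"
  assumes p: "1 \<le> p" and f: "f \<in> borel_measurable M" and nn: "\<And>x. 0 \<le> f x"
    and c: "emeasure M (space M) = ennreal c" "0 < c"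
    and S: "(\<integral>\<^sup>+x. f x \<partial>M) = ennreal S" "0 \<le> S"
  shows "ennreal (S powr p) \<le> ennreal (2 * (2 * c) powr (p - 1)) * (\<integral>\<^sup>+x. ennreal (f x powr p) \<partial>M)"
proof (cases "(\<integral>\<^sup>+x. ennreal (f x powr p) \<partial>M) = \<infinity> \<or> S = 0")
  case True
  then show ?thesis
    using c p by (auto simp: ennreal_mult_top)
next
  case False
  then obtain T where T: "(\<integral>\<^sup>+x. ennreal (f x powr p) \<partial>M) = ennreal T" "0 \<le> T"
    by (cases "\<integral>\<^sup>+x. ennreal (f x powr p) \<partial>M") auto
  \<comment> \<open>Half the mean value of f: the term l^p c is then half of l^(p-1) S and can be
    absorbed on the left.\<close>
  define l where "l = S / (2 * c)"
  have l: "0 < l" using False S c by (auto simp: l_def)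
  have S_eq: "S = 2 * c * l" using c by (simp add: l_def)
  \<comment> \<open>Integrating this pointwise bound and optimising over \<open>l\<close> replaces Hoelder's inequality.\<close>
  have pt: "l powr (p - 1) * f x \<le> l powr p + f x powr p" for x
  proof (cases "f x \<le> l")
    case True
    then have "l powr (p - 1) * f x \<le> l powr (p - 1) * l" by (intro mult_left_mono) auto
    also have "\<dots> = l powr p" using l by (simp add: powr_diff)
    finally show ?thesis by (simp add: add_increasing2)
  next
    case False
    then have "l powr (p - 1) * f x \<le> f x powr (p - 1) * f x"
      using l p nn[of x] by (intro mult_right_mono powr_mono2) auto
    also have "\<dots> = f x powr p" using l False by (simp add: powr_diff)
    finally show ?thesis by (simp add: add_increasing)
  qed
  have "ennreal (l powr (p - 1) * S) = (\<integral>\<^sup>+x. ennreal (l powr (p - 1)) * f x \<partial>M)"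
    using f S by (simp add: nn_integral_cmult ennreal_mult)
  also have "\<dots> \<le> (\<integral>\<^sup>+x. ennreal (l powr p) + ennreal (f x powr p) \<partial>M)"
    using pt nn by (intro nn_integral_mono) (simp add: ennreal_mult[symmetric] ennreal_plus[symmetric] del: ennreal_plus)
  also have "\<dots> = ennreal (l powr p) * ennreal c + ennreal T"
    using f T c by (simp add: nn_integral_add)
  also have "\<dots> = ennreal (l powr p * c + T)"
    using T c by (simp add: ennreal_mult)
  finally have "l powr (p - 1) * S \<le> l powr p * c + T"
    using T c by (simp add: ennreal_le_iff del: ennreal_plus)
  moreover have "l powr (p - 1) * S = 2 * (l powr p * c)"
    using l by (simp add: S_eq powr_diff)
  ultimately have "l powr p * c \<le> T" by linarith
  then have "2 * (2 * c) powr (p - 1) * (l powr p * c) \<le> 2 * (2 * c) powr (p - 1) * T"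
    by (intro mult_left_mono) auto
  moreover have "2 * (2 * c) powr (p - 1) * (l powr p * c) = S powr p"
    using l c by (simp add: S_eq powr_mult powr_diff)
  ultimately show ?thesis
    using T by (simp add: ennreal_mult[symmetric])
qed

lemma powr_sum_le:
  fixes a :: "nat \<Rightarrow> real"
  assumes p: "1 \<le> p" and nn: "\<And>i. 0 \<le> a i" and m: "0 < m"
  shows "(\<Sum>i<m. a i) powr p \<le> 2 powr p * real m powr (p - 1) * (\<Sum>i<m. a i powr p)"
proof -
  have "ennreal ((\<Sum>i<m. a i) powr p)
     \<le> ennreal (2 * (2 * real m) powr (p - 1)) * (\<integral>\<^sup>+x. ennreal (a x powr p) \<partial>count_space {..<m})"
    using assms by (intro powr_nn_integral_le)
      (auto simp: nn_integral_count_space_finite sum_nonneg ennreal_of_nat_eq_real_of_nat)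
  then have "(\<Sum>i<m. a i) powr p \<le> 2 * (2 * real m) powr (p - 1) * (\<Sum>i<m. a i powr p)"
    by (simp add: nn_integral_count_space_finite ennreal_mult[symmetric] sum_nonneg)
  then show ?thesis
    using m by (simp add: powr_mult powr_diff)
qed

lemma nn_integral_lborel_affine:
  fixes f :: "'a::euclidean_space \<Rightarrow> ennreal"
  assumes [measurable]: "f \<in> borel_measurable borel" and c: "c \<noteq> 0"
  shows "(\<integral>\<^sup>+x. f x \<partial>lborel) = ennreal (\<bar>c\<bar> ^ DIM('a)) * (\<integral>\<^sup>+x. f (t + c *\<^sub>R x) \<partial>lborel)"
  by (subst lborel_affine[OF c, of t])
     (simp add: nn_integral_density nn_integral_distr nn_integral_cmult ennreal_power)

text \<open>A Borel version makes (x, h) \<mapsto> u(x + h) jointly measurable for the product Borel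
  structure, on which the Tonelli arguments rely. It is built coordinatewise, with one exceptional
  null set for each of the finitely many coordinates.\<close>

lemma lebesgue_on_borel_representative:
  fixes u :: "'a::euclidean_space \<Rightarrow> 'b::euclidean_space"
  assumes u: "u \<in> borel_measurable (lebesgue_on \<Omega>)" and \<Omega>: "\<Omega> \<in> sets borel"
  obtains U where "U \<in> borel_measurable borel" "AE x in lborel. x \<in> \<Omega> \<longrightarrow> U x = u x"
proof -
  have u': "(\<lambda>x. indicator \<Omega> x *\<^sub>R u x) \<in> borel_measurable lebesgue"
    using u \<Omega> borel_measurable_restrict_space_iff[of \<Omega> lebesgue u] by auto
  have "\<exists>g. g \<in> borel_measurable borel \<and> (AE x in lborel. (indicator \<Omega> x *\<^sub>R u x) \<bullet> b = g x)" for b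
    using completion_ex_borel_measurable_real[OF borel_measurable_inner[OF u' borel_measurable_const]]
    by (auto simp: Bex_def)
  then obtain g where g: "\<And>b. g b \<in> borel_measurable borel"
    and ae: "\<And>b. AE x in lborel. (indicator \<Omega> x *\<^sub>R u x) \<bullet> b = g b x"
    by metis
  have meas: "(\<lambda>x. \<Sum>b\<in>Basis. g b x *\<^sub>R b) \<in> borel_measurable borel"
    by (intro borel_measurable_sum borel_measurable_scaleR[OF g] borel_measurable_const)
  have "AE x in lborel. \<forall>b\<in>Basis. (indicator \<Omega> x *\<^sub>R u x) \<bullet> b = g b x"
    by (rule AE_finite_allI[OF finite_Basis]) (rule ae)
  then have "AE x in lborel. x \<in> \<Omega> \<longrightarrow> (\<Sum>b\<in>Basis. g b x *\<^sub>R b) = u x"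
  proof eventually_elim
    case (elim x)
    have "(\<Sum>b\<in>Basis. g b x *\<^sub>R b) = (\<Sum>b\<in>Basis. ((indicator \<Omega> x *\<^sub>R u x) \<bullet> b) *\<^sub>R b)"
      using elim by (intro sum.cong) auto
    then show ?case
      by (simp add: euclidean_representation)
  qed
  with meas show ?thesis by (rule that)
qed

text \<open>Along a ray, -\<rho>(te)/t^p is nondecreasing in t > 0 and hence Borel; radial symmetry
  carries this to all x \<noteq> 0, and the origin is set apart. Local integrability alone would
  give only Lebesgue measurability.\<close>

lemma radial_ratio_nonincr_measurable:
  fixes \<rho> :: "'a::euclidean_space \<Rightarrow> real"
  assumes rad: "radial \<rho>" and ratio: "ratio_nonincr p \<rho>"
  shows "\<rho> \<in> borel_measurable borel"
proof -
  obtain e :: 'a where e: "norm e = 1"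
    using nonempty_Basis norm_Basis by blast
  define k where "k t = - (\<rho> (t *\<^sub>R e) / t powr p)" for t
  have "mono_on {0<..} k"
  proof (rule mono_onI)
    fix s t :: real assume "s \<in> {0<..}" "t \<in> {0<..}" "s \<le> t"
    then show "k s \<le> k t"
      using ratio[unfolded ratio_nonincr_def, rule_format, of "s *\<^sub>R e" "t *\<^sub>R e"] e by (auto simp: k_def)
  qed
  then have k: "k \<in> borel_measurable (restrict_space borel {0<..})"
    by (rule borel_measurable_mono_on_fnc)
  define k' where "k' t = indicator {0<..} t *\<^sub>R k t" for t :: real
  have [measurable]: "k' \<in> borel_measurable borel"
    using k borel_measurable_restrict_space_iff[of "{0<..}" borel k] unfolding k'_def[abs_def] by simp
  have eq: "\<rho> x = (if x = 0 then \<rho> 0 else - k' (norm x) * norm x powr p)" for x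
  proof (cases "x = 0")
    case False
    have "\<rho> x = \<rho> (norm x *\<^sub>R e)" 
      by (rule rad[unfolded radial_def, rule_format]) (simp add: e)
    moreover have "\<rho> (norm x *\<^sub>R e) = - k' (norm x) * norm x powr p"
      using False by (simp add: k_def k'_def)
    ultimately show ?thesis using False by simp
  qed simp
  have "(\<lambda>x::'a. if x = 0 then \<rho> 0 else - k' (norm x) * norm x powr p) \<in> borel_measurable borel"
    by measurable
  then show ?thesis
    by (subst measurable_cong[OF eq])
qed

section \<open>Directional differences and the energy\<close>

text \<open>Direction z and displacement h are separate arguments: the energy has z = h, while
  telescoping changes h at fixed z.\<close>

definition dir_diff :: "real \<Rightarrow> 'a set \<Rightarrow> 'a set \<Rightarrow> ('a::euclidean_space \<Rightarrow> 'a) \<Rightarrow> 'a \<Rightarrow> 'a \<Rightarrow> ennreal" where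
  "dir_diff p A \<Omega> U z h =
     (\<integral>\<^sup>+x. indicator A x * indicator \<Omega> (x + h) * ennreal (\<bar>z \<bullet> (U (x + h) - U x)\<bar> powr p) \<partial>lborel)"

lemma borel_measurable_dir_diff [measurable]:
  fixes U :: "'a::euclidean_space \<Rightarrow> 'a"
  assumes [measurable]: "A \<in> sets borel" "\<Omega> \<in> sets borel" "U \<in> borel_measurable borel"
    "f \<in> borel_measurable M" "g \<in> borel_measurable M"
  shows "(\<lambda>w. dir_diff p A \<Omega> U (f w) (g w)) \<in> borel_measurable M"
proof -
  have "(\<lambda>v. dir_diff p A \<Omega> U (fst v) (snd v)) \<in> borel_measurable (borel \<Otimes>\<^sub>M borel)"
    unfolding dir_diff_def by measurable
  then have "(\<lambda>w. dir_diff p A \<Omega> U (fst (f w, g w)) (snd (f w, g w))) \<in> borel_measurable M"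
    by (rule measurable_compose[rotated]) simp
  then show ?thesis by simp
qed

lemma dir_diff_scale:
  fixes U :: "'a::euclidean_space \<Rightarrow> 'a"
  assumes [measurable]: "A \<in> sets borel" "\<Omega> \<in> sets borel" "U \<in> borel_measurable borel" and c: "0 \<le> c"
  shows "dir_diff p A \<Omega> U (c *\<^sub>R z) h = ennreal (c powr p) * dir_diff p A \<Omega> U z h"
proof -
  have "ennreal (\<bar>(c *\<^sub>R z) \<bullet> w\<bar> powr p) = ennreal (c powr p) * ennreal (\<bar>z \<bullet> w\<bar> powr p)" for w
    using c by (simp add: abs_mult powr_mult ennreal_mult)
  then show ?thesis
    unfolding dir_diff_def by (subst nn_integral_cmult[symmetric]) (auto simp: mult_ac)
qed

text \<open>With h = y - x the quotient \<open>nl_D u x y\<close> equals h \<bullet> (u(x + h) -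
  u(x)) / |h|^2, which is where the exponent 2p comes from; Tonelli then exchanges x and h.\<close>

lemma nl_energy_eq_dir_diff:
  fixes u :: "'a::euclidean_space \<Rightarrow> 'a"
  assumes [measurable]: "\<Omega> \<in> sets borel" "\<rho> \<in> borel_measurable borel" "U \<in> borel_measurable borel"
    and nonneg: "\<And>x. 0 \<le> \<rho> x" and ae: "AE x in lborel. x \<in> \<Omega> \<longrightarrow> U x = u x"
  shows "nl_energy \<rho> p \<Omega> u =
    (\<integral>\<^sup>+h. ennreal (\<rho> h / norm h powr (2 * p)) * dir_diff p \<Omega> \<Omega> U h h \<partial>lborel)"
proof -
  define G where "G x h = ennreal (\<rho> h / norm h powr (2 * p)) *
    (indicator \<Omega> x * indicator \<Omega> (x + h) * ennreal (\<bar>h \<bullet> (U (x + h) - U x)\<bar> powr p))" for x h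
  have G[measurable]: "(\<lambda>(x, h). G x h) \<in> borel_measurable (lborel \<Otimes>\<^sub>M lborel)"
    unfolding G_def by measurable
  have D: "\<rho> (y - x) * \<bar>nl_D U x y\<bar> powr p = \<rho> (y - x) / norm (y - x) powr (2 * p) * \<bar>(y - x) \<bullet> (U y - U x)\<bar> powr p"
    for x y
  proof -
    have "nl_D U x y = ((y - x) \<bullet> (U y - U x)) / (norm (y - x) * norm (y - x))"
      by (simp add: nl_D_def divide_inverse inner_commute)
    moreover have "(norm (y - x) * norm (y - x)) powr p = norm (y - x) powr (2 * p)"
      by (simp add: powr_mult powr_add[symmetric])
    ultimately show ?thesis
      by (simp add: abs_mult powr_divide)
  qed
  have "nl_energy \<rho> p \<Omega> u = (\<integral>\<^sup>+x. (\<integral>\<^sup>+y. ennreal (\<rho> (y - x) * \<bar>nl_D u x y\<bar> powr p) * indicator \<Omega> y \<partial>lborel) * indicator \<Omega> x \<partial>lborel)"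
    unfolding nl_energy_def by (simp add: nn_integral_restrict_space nn_integral_completion)
  also have "\<dots> = (\<integral>\<^sup>+x. (\<integral>\<^sup>+h. G x h \<partial>lborel) \<partial>lborel)"
  proof (rule nn_integral_cong_AE, use ae in eventually_elim)
    case (elim x)
    show ?case
    proof (cases "x \<in> \<Omega>")
      case True
      have "(\<integral>\<^sup>+y. ennreal (\<rho> (y - x) * \<bar>nl_D u x y\<bar> powr p) * indicator \<Omega> y \<partial>lborel)
        = (\<integral>\<^sup>+y. ennreal (\<rho> (y - x) / norm (y - x) powr (2 * p) * \<bar>(y - x) \<bullet> (U y - U x)\<bar> powr p) * indicator \<Omega> y \<partial>lborel)"
      proof (rule nn_integral_cong_AE, use ae in eventually_elim)
        case (elim y)
        have "nl_D u x y = nl_D U x y" if "y \<in> \<Omega>"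
          using True elim \<open>x \<in> \<Omega> \<longrightarrow> U x = u x\<close> that by (simp add: nl_D_def)
        then show ?case
          using D[of y x] by (auto split: split_indicator)
      qed
      also have "\<dots> = (\<integral>\<^sup>+h. ennreal (\<rho> h / norm h powr (2 * p) * \<bar>h \<bullet> (U (x + h) - U x)\<bar> powr p) * indicator \<Omega> (x + h) \<partial>lborel)"
        by (subst nn_integral_lborel_affine[where c = 1 and t = x]) simp_all
      also have "\<dots> = (\<integral>\<^sup>+h. G x h \<partial>lborel)"
        using True nonneg by (intro nn_integral_cong) (simp add: G_def ennreal_mult[symmetric] split: split_indicator)
      finally show ?thesis using True by simp
    qed (simp add: G_def)
  qed
  also have "\<dots> = (\<integral>\<^sup>+h. (\<integral>\<^sup>+x. G x h \<partial>lborel) \<partial>lborel)"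
    by (rule lborel_pair.Fubini'[OF G, symmetric])
  also have "\<dots> = (\<integral>\<^sup>+h. ennreal (\<rho> h / norm h powr (2 * p)) * dir_diff p \<Omega> \<Omega> U h h \<partial>lborel)"
    unfolding G_def dir_diff_def by (subst nn_integral_cmult) simp_all
  finally show ?thesis .
qed

section \<open>Telescoping and comparison across dyadic scales\<close>

text \<open>Each of the m increments, after translation by l h, is bounded by the full integral over
  \<Omega>; m of them together with the convexity factor m^(p-1) give m^p. The left side is
  restricted to A because the intermediate points of the chain have to lie in \<Omega> as
  well.\<close>

lemma dir_diff_multiple:
  fixes U :: "'a::euclidean_space \<Rightarrow> 'a"
  assumes p: "1 \<le> p" and [measurable]: "A \<in> sets borel" "\<Omega> \<in> sets borel" "U \<in> borel_measurable borel"
    and m: "0 < m" and seg: "\<And>x l. x \<in> A \<Longrightarrow> l \<le> m \<Longrightarrow> x + real l *\<^sub>R h \<in> \<Omega>"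
  shows "dir_diff p A \<Omega> U z (real m *\<^sub>R h) \<le> ennreal (2 powr p * real m powr p) * dir_diff p \<Omega> \<Omega> U z h"
proof -
  define c where "c = 2 powr p * real m powr (p - 1)"
  define f where "f x = indicator \<Omega> x * indicator \<Omega> (x + h) * ennreal (\<bar>z \<bullet> (U (x + h) - U x)\<bar> powr p)" for x
  have [measurable]: "f \<in> borel_measurable borel"
    unfolding f_def by measurable
  have "indicator A x * indicator \<Omega> (x + real m *\<^sub>R h) * ennreal (\<bar>z \<bullet> (U (x + real m *\<^sub>R h) - U x)\<bar> powr p)
      \<le> ennreal c * (\<Sum>l<m. f (x + real l *\<^sub>R h))" for x
  proof (cases "x \<in> A")
    case True
    define a where "a l = \<bar>z \<bullet> (U (x + real (Suc l) *\<^sub>R h) - U (x + real l *\<^sub>R h))\<bar>" for l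
    have "U (x + real m *\<^sub>R h) - U x = (\<Sum>l<m. U (x + real (Suc l) *\<^sub>R h) - U (x + real l *\<^sub>R h))"
      by (subst sum_lessThan_telescope[of "\<lambda>l. U (x + real l *\<^sub>R h)"]) simp
    then have "\<bar>z \<bullet> (U (x + real m *\<^sub>R h) - U x)\<bar> \<le> (\<Sum>l<m. a l)"
      unfolding a_def by (simp only: inner_sum_right) (rule sum_abs)
    then have "\<bar>z \<bullet> (U (x + real m *\<^sub>R h) - U x)\<bar> powr p \<le> (\<Sum>l<m. a l) powr p"
      using p by (intro powr_mono2) auto
    also have "\<dots> \<le> c * (\<Sum>l<m. a l powr p)"
      unfolding c_def by (rule powr_sum_le[OF p _ m]) (simp add: a_def)
    finally have "ennreal (\<bar>z \<bullet> (U (x + real m *\<^sub>R h) - U x)\<bar> powr p) \<le> ennreal c * (\<Sum>l<m. ennreal (a l powr p))"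
      by (simp add: c_def ennreal_mult[symmetric] sum_nonneg ennreal_leI)
    also have "(\<Sum>l<m. ennreal (a l powr p)) = (\<Sum>l<m. f (x + real l *\<^sub>R h))"
    proof (rule sum.cong)
      fix l assume "l \<in> {..<m}"
      moreover have step: "x + real l *\<^sub>R h + h = x + real (Suc l) *\<^sub>R h"
        by (simp add: algebra_simps)
      ultimately show "ennreal (a l powr p) = f (x + real l *\<^sub>R h)"
        using seg[OF True, of l] seg[OF True, of "Suc l"] unfolding a_def f_def step by simp
    qed simp
    finally show ?thesis
      using True seg[OF True, of m] by simp
  qed simp
  then have "dir_diff p A \<Omega> U z (real m *\<^sub>R h) \<le> (\<integral>\<^sup>+x. ennreal c * (\<Sum>l<m. f (x + real l *\<^sub>R h)) \<partial>lborel)"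
    unfolding dir_diff_def by (rule nn_integral_mono)
  also have "\<dots> = ennreal c * (\<Sum>l<m. \<integral>\<^sup>+x. f (x + real l *\<^sub>R h) \<partial>lborel)"
    by (simp add: nn_integral_cmult nn_integral_sum)
  also have "\<dots> = ennreal c * (\<Sum>l<m. dir_diff p \<Omega> \<Omega> U z h)"
    using nn_integral_lborel_affine[of f 1 "real _ *\<^sub>R h"]
    by (intro arg_cong[where f = "\<lambda>y. ennreal c * y"] sum.cong) (simp_all add: dir_diff_def f_def[abs_def] add.commute)
  also have "\<dots> = ennreal (c * real m) * dir_diff p \<Omega> \<Omega> U z h"
    by (simp add: ennreal_mult c_def ennreal_of_nat_eq_real_of_nat mult.assoc)
  also have "c * real m = 2 powr p * real m powr p"
    using m by (simp add: c_def powr_diff)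
  finally show ?thesis .
qed

text \<open>Substituting h = t_(j+1) z turns the j-th integral into one over a part of the shell of
  outer radius t_(j+1), where \<rho>(h)/|h|^p is at least its value at that radius. The power t^d is
  the Jacobian. The shells are disjoint, so the sum is at most the whole energy.\<close>

lemma dyadic_energy_lower_bound:
  fixes U :: "'a::euclidean_space \<Rightarrow> 'a"
  assumes p: "1 \<le> p" and [measurable]: "\<Omega> \<in> sets borel" "U \<in> borel_measurable borel" "C \<in> sets borel"
      "\<rho> \<in> borel_measurable borel"
    and nonneg: "\<And>x. 0 \<le> \<rho> x" and ratio: "ratio_nonincr p \<rho>"
    and C: "\<And>z. z \<in> C \<Longrightarrow> 1 / 2 \<le> norm z \<and> norm z < 1"
    and \<delta>: "0 < \<delta>" and e: "norm e = 1" and t: "\<And>j. t j = \<delta> / 2 ^ j"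
  shows "(\<Sum>j. ennreal (t (Suc j) ^ DIM('a) * (\<rho> (t (Suc j) *\<^sub>R e) / t (Suc j) powr p)) *
            (\<integral>\<^sup>+z. indicator C z * dir_diff p \<Omega> \<Omega> U z (t (Suc j) *\<^sub>R z) \<partial>lborel))
    \<le> (\<integral>\<^sup>+h. ennreal (\<rho> h / norm h powr (2 * p)) * dir_diff p \<Omega> \<Omega> U h h \<partial>lborel)"
proof -
  define F where "F h = ennreal (\<rho> h / norm h powr (2 * p)) * dir_diff p \<Omega> \<Omega> U h h" for h
  \<comment> \<open>As 1/2 \<le> |z| < 1 on C, this set lies in t (Suc j) / 2 \<le> |h| < t (Suc j);
    halving the radius from one index to the next makes these shells disjoint.\<close>
  define D where "D j = {h. h /\<^sub>R t (Suc j) \<in> C}" for j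
  have [measurable]: "F \<in> borel_measurable borel"
    unfolding F_def by measurable
  have tpos: "0 < t j" for j using \<delta> by (simp add: t)
  have [measurable]: "D j \<in> sets borel" for j
  proof -
    have "(\<lambda>h::'a. h /\<^sub>R t (Suc j)) -` C \<inter> space borel \<in> sets borel"
      by (rule measurable_sets[where A = borel]) simp_all
    then show ?thesis by (simp add: D_def vimage_def)
  qed
  have disj: "disjoint_family D"
  proof -
    have "False" if "i < j" "h \<in> D i" "h \<in> D j" for i j h
    proof -
      have "t (Suc i) / 2 \<le> norm h"
        using C[of "h /\<^sub>R t (Suc i)"] that tpos[of "Suc i"] by (simp add: D_def field_simps)
      moreover have "norm h < t (Suc j)"
        using C[of "h /\<^sub>R t (Suc j)"] that tpos[of "Suc j"] by (simp add: D_def field_simps)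
      moreover have "t (Suc j) \<le> t (Suc i) / 2"
      proof -
        have "(2::real) ^ Suc (Suc i) \<le> 2 ^ Suc j"
          using that by (intro power_increasing) auto
        then have "\<delta> / 2 ^ Suc j \<le> \<delta> / 2 ^ Suc (Suc i)"
          using \<delta> by (intro divide_left_mono) auto
        then show ?thesis by (simp add: t)
      qed
      ultimately show False by linarith
    qed
    then show ?thesis
      unfolding disjoint_family_on_def by (metis disjoint_iff nat_neq_iff)
  qed
  have "ennreal (t (Suc j) ^ DIM('a) * (\<rho> (t (Suc j) *\<^sub>R e) / t (Suc j) powr p)) *
            (\<integral>\<^sup>+z. indicator C z * dir_diff p \<Omega> \<Omega> U z (t (Suc j) *\<^sub>R z) \<partial>lborel)
     \<le> (\<integral>\<^sup>+h. indicator (D j) h * F h \<partial>lborel)" for j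
  proof -
    define s where "s = t (Suc j)"
    have s: "0 < s" using tpos by (simp add: s_def)
    define k where "k = \<rho> (s *\<^sub>R e) / s powr p"
    have k: "0 \<le> k" using nonneg by (simp add: k_def)
    have le: "ennreal k * (indicator C z * dir_diff p \<Omega> \<Omega> U z (s *\<^sub>R z)) \<le> indicator (D j) (0 + s *\<^sub>R z) * F (0 + s *\<^sub>R z)" for z
    proof (cases "z \<in> C")
      case True
      then have z: "0 < norm z" "norm z \<le> 1" using C[of z] by linarith+
      have "k \<le> \<rho> (s *\<^sub>R z) / norm (s *\<^sub>R z) powr p"
        using ratio[unfolded ratio_nonincr_def, rule_format, of "s *\<^sub>R z" "s *\<^sub>R e"] z s e
        by (simp add: k_def)
      \<comment> \<open>The inserted factor is at least 1 as |z| \<le> 1. It turns |h|^(-p) into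
        |h|^(-2p) s^p, and s^p is what \<open>dir_diff_scale\<close> needs to pass from direction z
        to direction s z.\<close>
      also have "\<dots> \<le> \<rho> (s *\<^sub>R z) / norm (s *\<^sub>R z) powr p * (1 / norm z powr p)"
      proof -
        have "1 \<le> 1 / norm z powr p"
          using z p by (simp add: powr_le1)
        then show ?thesis
          using mult_left_mono[of 1 "1 / norm z powr p" "\<rho> (s *\<^sub>R z) / norm (s *\<^sub>R z) powr p"] nonneg by simp
      qed
      also have "\<dots> = \<rho> (s *\<^sub>R z) / norm (s *\<^sub>R z) powr (2 * p) * s powr p"
      proof -
        have "norm (s *\<^sub>R z) powr (2 * p) = norm (s *\<^sub>R z) powr p * (s powr p * norm z powr p)"
          using s z powr_add[of "norm (s *\<^sub>R z)" p p] by (simp add: powr_mult)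
        then show ?thesis using s z by simp
      qed
      finally have "ennreal k \<le> ennreal (\<rho> (s *\<^sub>R z) / norm (s *\<^sub>R z) powr (2 * p)) * ennreal (s powr p)"
        using nonneg by (simp add: ennreal_mult[symmetric] ennreal_leI)
      then have "ennreal k * dir_diff p \<Omega> \<Omega> U z (s *\<^sub>R z) \<le>
         ennreal (\<rho> (s *\<^sub>R z) / norm (s *\<^sub>R z) powr (2 * p)) * ennreal (s powr p) * dir_diff p \<Omega> \<Omega> U z (s *\<^sub>R z)"
        by (intro mult_right_mono) auto
      also have "\<dots> = F (s *\<^sub>R z)"
        using s by (simp add: F_def dir_diff_scale mult.assoc)
      finally show ?thesis
        using True s by (simp add: D_def s_def[symmetric])
    qed simp
    have "ennreal (s ^ DIM('a) * k) * (\<integral>\<^sup>+z. indicator C z * dir_diff p \<Omega> \<Omega> U z (s *\<^sub>R z) \<partial>lborel)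
      = ennreal (s ^ DIM('a)) * (\<integral>\<^sup>+z. ennreal k * (indicator C z * dir_diff p \<Omega> \<Omega> U z (s *\<^sub>R z)) \<partial>lborel)"
      using k s by (simp add: nn_integral_cmult ennreal_mult mult.assoc)
    also have "\<dots> \<le> ennreal (s ^ DIM('a)) * (\<integral>\<^sup>+z. indicator (D j) (0 + s *\<^sub>R z) * F (0 + s *\<^sub>R z) \<partial>lborel)"
      using le by (intro mult_left_mono nn_integral_mono) auto
    also have "\<dots> = (\<integral>\<^sup>+h. indicator (D j) h * F h \<partial>lborel)"
      using s by (subst nn_integral_lborel_affine[where c = s and t = 0]) auto
    finally show ?thesis
      by (simp add: s_def k_def)
  qed
  then have "(\<Sum>j. ennreal (t (Suc j) ^ DIM('a) * (\<rho> (t (Suc j) *\<^sub>R e) / t (Suc j) powr p)) *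
            (\<integral>\<^sup>+z. indicator C z * dir_diff p \<Omega> \<Omega> U z (t (Suc j) *\<^sub>R z) \<partial>lborel))
     \<le> (\<Sum>j. \<integral>\<^sup>+h. indicator (D j) h * F h \<partial>lborel)"
    by (intro suminf_le) auto
  also have "\<dots> = (\<integral>\<^sup>+h. (\<Sum>j. indicator (D j) h * F h) \<partial>lborel)"
    by (rule nn_integral_suminf[symmetric]) measurable
  also have "\<dots> \<le> (\<integral>\<^sup>+h. F h \<partial>lborel)"
    by (intro nn_integral_mono)
       (simp add: ennreal_suminf_multc suminf_indicator[OF disj] split: split_indicator)
  finally show ?thesis
    by (simp add: F_def)
qed

text \<open>On the shell t_(i+1) \<le> |h| < t_i monotonicity bounds the quotient by its value at
  the inner radius, whereas the lower bound for the energy works on the next shell inwards, with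
  t_(i+1) as outer radius. This shift by one index makes both sums sample \<rho> at the same radii.
  Enlarging shells to balls costs only a constant and keeps the volumes explicit.\<close>

lemma dyadic_kernel_upper_bound:
  fixes \<rho> :: "'a::euclidean_space \<Rightarrow> real"
  assumes p: "1 \<le> p" and [measurable]: "\<rho> \<in> borel_measurable borel"
    and nonneg: "\<And>x. 0 \<le> \<rho> x" and ratio: "ratio_nonincr p \<rho>"
    and \<delta>: "0 < \<delta>" and e: "norm e = 1" and t: "\<And>j. t j = \<delta> / 2 ^ j"
  shows "(\<integral>\<^sup>+h. indicator (ball 0 \<delta>) h * ennreal (\<rho> h) \<partial>lborel)
    \<le> (\<Sum>j. ennreal (unit_ball_vol (DIM('a)) * t j ^ DIM('a) * (t j powr p * (\<rho> (t (Suc j) *\<^sub>R e) / t (Suc j) powr p))))"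
proof -
  have tpos: "0 < t j" for j using \<delta> by (simp add: t)
  define c where "c j = t j powr p * (\<rho> (t (Suc j) *\<^sub>R e) / t (Suc j) powr p)" for j
  have c: "0 \<le> c j" for j using nonneg by (simp add: c_def)
  have "indicator (ball 0 \<delta>) h * ennreal (\<rho> h) \<le> (\<Sum>j. indicator (ball 0 (t j)) h * ennreal (c j))"
    if "h \<noteq> 0" for h
  proof (cases "norm h < \<delta>")
    case True
    have "(\<lambda>j. \<delta> * (1 / 2) ^ j) \<longlonglongrightarrow> \<delta> * 0"
      by (intro tendsto_mult tendsto_const LIMSEQ_power_zero) auto
    then have "\<forall>\<^sub>F j in sequentially. \<delta> * (1 / 2) ^ j < norm h"
      using that by (intro order_tendstoD(2)) auto
    then obtain j0 where "t j0 \<le> norm h"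
      by (auto simp: eventually_sequentially t power_divide intro: less_imp_le)
    define j where "j = (LEAST j. t j \<le> norm h)"
    have j: "t j \<le> norm h" unfolding j_def by (rule LeastI) fact
    have "j \<noteq> 0"
    proof
      assume "j = 0"
      with j True show False by (simp add: t)
    qed
    then obtain i where i: "j = Suc i" by (cases j) auto
    have hi: "norm h < t i"
      using not_less_Least[of i "\<lambda>j. t j \<le> norm h"] i by (simp add: j_def)
    have "\<rho> h / norm h powr p \<le> \<rho> (t j *\<^sub>R e) / t j powr p"
      using ratio[unfolded ratio_nonincr_def, rule_format, of "t j *\<^sub>R e" h] tpos[of j] j e by simp
    then have "\<rho> h \<le> norm h powr p * (\<rho> (t j *\<^sub>R e) / t j powr p)"
      using that by (simp add: field_simps)
    also have "\<dots> \<le> c i"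
      unfolding c_def i using hi p nonneg by (intro mult_right_mono powr_mono2) auto
    finally have "indicator (ball 0 \<delta>) h * ennreal (\<rho> h) \<le> indicator (ball 0 (t i)) h * ennreal (c i)"
      using True hi by (simp add: ennreal_leI)
    also have "\<dots> \<le> (\<Sum>j. indicator (ball 0 (t j)) h * ennreal (c j))"
    proof -
      have "g i \<le> (\<Sum>j. g j)" for g :: "nat \<Rightarrow> ennreal"
        using sum_le_suminf[of g "{i}"] by simp
      then show ?thesis .
    qed
    finally show ?thesis .
  qed simp
  then have "(\<integral>\<^sup>+h. indicator (ball 0 \<delta>) h * ennreal (\<rho> h) \<partial>lborel)
     \<le> (\<integral>\<^sup>+h. (\<Sum>j. indicator (ball 0 (t j)) h * ennreal (c j)) \<partial>(lborel :: 'a measure))"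
    by (intro nn_integral_mono_AE) (use AE_lborel_singleton[of "0::'a"] in eventually_elim, auto)
  also have "\<dots> = (\<Sum>j. \<integral>\<^sup>+h. indicator (ball 0 (t j)) h * ennreal (c j) \<partial>(lborel :: 'a measure))"
    by (rule nn_integral_suminf) (auto intro!: borel_measurable_times_ennreal borel_measurable_indicator)
  also have "\<dots> = (\<Sum>j. ennreal (unit_ball_vol (DIM('a)) * t j ^ DIM('a) * c j))"
  proof (intro suminf_cong)
    fix j
    have "(\<integral>\<^sup>+h. indicator (ball 0 (t j)) h * ennreal (c j) \<partial>(lborel :: 'a measure))
      = emeasure lborel (ball (0::'a) (t j)) * ennreal (c j)"
      by (subst nn_integral_multc) (auto intro!: borel_measurable_indicator)
    then show "(\<integral>\<^sup>+h. indicator (ball 0 (t j)) h * ennreal (c j) \<partial>(lborel :: 'a measure))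
      = ennreal (unit_ball_vol (DIM('a)) * t j ^ DIM('a) * c j)"
      using tpos[of j] c[of j] by (simp add: emeasure_ball less_imp_le ennreal_mult)
  qed
  finally show ?thesis
    by (simp add: c_def)
qed

text \<open>For every j, 2^(j+1) steps t_(j+1) z make up \<delta> z, so telescoping bounds the
  integral at scale \<delta> by the one at scale t_(j+1), and the two dyadic sums can be compared
  term by term. The number of steps cancels the radius, since 2 t_j 2^(j+1) = 4 \<delta>, whence 4^p
  \<delta>^p; the factor 2^d comes from t_j = 2 t_(j+1). Nothing in the constant depends on \<rho>,
  so it serves all kernels of the sequence.\<close>

lemma kernel_mass_times_dir_diff_le:
  fixes U :: "'a::euclidean_space \<Rightarrow> 'a"
  assumes p: "1 \<le> p" and [measurable]: "A \<in> sets borel" "\<Omega> \<in> sets borel" "U \<in> borel_measurable borel" "C \<in> sets borel"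
      "\<rho> \<in> borel_measurable borel"
    and nonneg: "\<And>x. 0 \<le> \<rho> x" and ratio: "ratio_nonincr p \<rho>"
    and C: "\<And>z. z \<in> C \<Longrightarrow> 1 / 2 \<le> norm z \<and> norm z < 1"
    and seg: "\<And>x z t. x \<in> A \<Longrightarrow> z \<in> C \<Longrightarrow> 0 \<le> t \<Longrightarrow> t \<le> \<delta> \<Longrightarrow> x + t *\<^sub>R z \<in> \<Omega>"
    and \<delta>: "0 < \<delta>"
  shows "(\<integral>\<^sup>+h. indicator (ball 0 \<delta>) h * ennreal (\<rho> h) \<partial>lborel) *
      (\<integral>\<^sup>+z. indicator C z * dir_diff p A \<Omega> U z (\<delta> *\<^sub>R z) \<partial>lborel)
    \<le> ennreal (unit_ball_vol (DIM('a)) * 2 ^ DIM('a) * 4 powr p * \<delta> powr p) *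
      (\<integral>\<^sup>+h. ennreal (\<rho> h / norm h powr (2 * p)) * dir_diff p \<Omega> \<Omega> U h h \<partial>lborel)"
proof -
  obtain e :: 'a where e: "norm e = 1"
    using nonempty_Basis norm_Basis by blast
  define t :: "nat \<Rightarrow> real" where "t j = \<delta> / 2 ^ j" for j
  have tpos: "0 < t j" for j using \<delta> by (simp add: t_def)
  define T where "T s = (\<integral>\<^sup>+z. indicator C z * dir_diff p \<Omega> \<Omega> U z (s *\<^sub>R z) \<partial>lborel)" for s
  define TA where "TA = (\<integral>\<^sup>+z. indicator C z * dir_diff p A \<Omega> U z (\<delta> *\<^sub>R z) \<partial>lborel)"
  define k where "k j = \<rho> (t (Suc j) *\<^sub>R e) / t (Suc j) powr p" for j
  have k: "0 \<le> k j" for j using nonneg by (simp add: k_def)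
  define w where "w = unit_ball_vol (DIM('a))"
  have w: "0 \<le> w" by (simp add: w_def unit_ball_vol_nonneg)
  have TA: "TA \<le> ennreal (2 powr p * (2 ^ Suc j) powr p) * T (t (Suc j))" for j
  proof -
    have "dir_diff p A \<Omega> U z (\<delta> *\<^sub>R z) \<le> ennreal (2 powr p * (2 ^ Suc j) powr p) * dir_diff p \<Omega> \<Omega> U z (t (Suc j) *\<^sub>R z)"
      if z: "z \<in> C" for z
    proof -
      have eq: "real (2 ^ Suc j) *\<^sub>R (t (Suc j) *\<^sub>R z) = \<delta> *\<^sub>R z"
        by (simp add: t_def)
      have "x + real l *\<^sub>R (t (Suc j) *\<^sub>R z) \<in> \<Omega>" if "x \<in> A" "l \<le> 2 ^ Suc j" for x l
      proof -
        have "real l \<le> real (2 ^ Suc j)" using that by (simp only: of_nat_le_iff)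
        then have "real l * t (Suc j) \<le> real (2 ^ Suc j) * t (Suc j)"
          using tpos[of "Suc j"] by (intro mult_right_mono) auto
        also have "\<dots> = \<delta>" by (simp add: t_def)
        finally show ?thesis
          using seg[OF that(1) z, of "real l * t (Suc j)"] tpos[of "Suc j"] by simp
      qed
      from dir_diff_multiple[of p A \<Omega> U "2 ^ Suc j" "t (Suc j) *\<^sub>R z" z, OF p _ _ _ _ this]
      show ?thesis unfolding eq by simp
    qed
    then have "TA \<le> (\<integral>\<^sup>+z. ennreal (2 powr p * (2 ^ Suc j) powr p) * (indicator C z * dir_diff p \<Omega> \<Omega> U z (t (Suc j) *\<^sub>R z)) \<partial>lborel)"
      unfolding TA_def by (intro nn_integral_mono) (auto split: split_indicator)
    then show ?thesis
      by (simp add: nn_integral_cmult T_def)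
  qed
  have "(\<integral>\<^sup>+h. indicator (ball 0 \<delta>) h * ennreal (\<rho> h) \<partial>lborel) * TA
    \<le> (\<Sum>j. ennreal (w * t j ^ DIM('a) * (t j powr p * k j))) * TA"
    unfolding w_def k_def
    by (intro mult_right_mono dyadic_kernel_upper_bound p nonneg ratio \<delta> e t_def) auto
  also have "\<dots> = (\<Sum>j. ennreal (w * t j ^ DIM('a) * (t j powr p * k j)) * TA)"
    by simp
  also have "\<dots> \<le> (\<Sum>j. ennreal (w * 2 ^ DIM('a) * 4 powr p * \<delta> powr p) * (ennreal (t (Suc j) ^ DIM('a) * k j) * T (t (Suc j))))"
  proof (intro suminf_le allI)
    fix j
    have "ennreal (w * t j ^ DIM('a) * (t j powr p * k j)) * TA
      \<le> ennreal (w * t j ^ DIM('a) * (t j powr p * k j)) * (ennreal (2 powr p * (2 ^ Suc j) powr p) * T (t (Suc j)))"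
      by (intro mult_left_mono TA) auto
    also have "\<dots> = ennreal (w * t j ^ DIM('a) * (t j powr p * k j) * (2 powr p * (2 ^ Suc j) powr p)) * T (t (Suc j))"
      using w k[of j] tpos[of j] by (simp add: ennreal_mult mult.assoc)
    also have "w * t j ^ DIM('a) * (t j powr p * k j) * (2 powr p * (2 ^ Suc j) powr p)
      = w * 2 ^ DIM('a) * 4 powr p * \<delta> powr p * (t (Suc j) ^ DIM('a) * k j)"
    proof -
      have "t j ^ DIM('a) = 2 ^ DIM('a) * t (Suc j) ^ DIM('a)"
        by (simp add: t_def power_divide power_mult_distrib)
      moreover have "t j powr p * (2 powr p * (2 ^ Suc j) powr p) = 4 powr p * \<delta> powr p"
      proof -
        have "t j powr p * (2 powr p * (2 ^ Suc j) powr p) = (t j * (2 * 2 ^ Suc j)) powr p"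
          by (simp only: powr_mult)
        also have "t j * (2 * 2 ^ Suc j) = 4 * \<delta>"
          by (simp add: t_def)
        finally show ?thesis
          by (simp only: powr_mult)
      qed
      ultimately have "w * t j ^ DIM('a) * k j * (t j powr p * (2 powr p * (2 ^ Suc j) powr p))
        = w * (2 ^ DIM('a) * t (Suc j) ^ DIM('a)) * k j * (4 powr p * \<delta> powr p)"
        by (simp only:)
      then show ?thesis
        by (simp only: mult_ac)
    qed
    finally show "ennreal (w * t j ^ DIM('a) * (t j powr p * k j)) * TA
      \<le> ennreal (w * 2 ^ DIM('a) * 4 powr p * \<delta> powr p) * (ennreal (t (Suc j) ^ DIM('a) * k j) * T (t (Suc j)))"
      using w k[of j] tpos[of "Suc j"] by (simp add: ennreal_mult mult.assoc)
  qed auto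
  also have "\<dots> = ennreal (w * 2 ^ DIM('a) * 4 powr p * \<delta> powr p) * (\<Sum>j. ennreal (t (Suc j) ^ DIM('a) * k j) * T (t (Suc j)))"
    by simp
  also have "\<dots> \<le> ennreal (w * 2 ^ DIM('a) * 4 powr p * \<delta> powr p) *
      (\<integral>\<^sup>+h. ennreal (\<rho> h / norm h powr (2 * p)) * dir_diff p \<Omega> \<Omega> U h h \<partial>lborel)"
    unfolding T_def k_def
    by (intro mult_left_mono dyadic_energy_lower_bound[where \<delta> = \<delta>] p nonneg ratio C \<delta> e t_def) auto
  finally show ?thesis
    by (simp add: TA_def w_def)
qed

section \<open>Segments in Lipschitz domains\<close>

text \<open>Near a boundary point the directions are tilted only a little from the vertical e: along
  t z the height grows by at least t (3/4 - \<theta>), while the graph rises by at most 2 L \<theta>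
  t, so the point stays above the graph. At an interior point any e does. Length 3/4 with \<theta>
  \<le> 1/8 keeps the directions in the shell 1/2 \<le> |z| < 1 of the dyadic sums, and halving r
  keeps the segments in the ball where the graph describes \<Omega>.\<close>

lemma lipschitz_domain_segments:
  fixes \<Omega> :: "'a::euclidean_space set"
  assumes \<Omega>: "lipschitz_domain \<Omega>" and x0: "x0 \<in> closure \<Omega>"
  obtains r s \<theta> e where "0 < r" "0 < s" "0 < \<theta>" "\<theta> \<le> 1 / 8" "norm (e::'a) = 1"
    "\<And>x z t. x \<in> \<Omega> \<Longrightarrow> x \<in> ball x0 r \<Longrightarrow> z \<in> ball ((3 / 4) *\<^sub>R e) \<theta> \<Longrightarrow> 0 \<le> t \<Longrightarrow> t \<le> s \<Longrightarrow> x + t *\<^sub>R z \<in> \<Omega>"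
proof -
  have norm_le: "norm z \<le> 1" if "z \<in> ball ((3 / 4) *\<^sub>R e) \<theta>" "\<theta> \<le> 1 / 8" "norm e = 1" for z e :: 'a and \<theta>
    using that norm_triangle_ineq[of "z - (3 / 4) *\<^sub>R e" "(3 / 4) *\<^sub>R e"] by (simp add: dist_norm norm_minus_commute)
  have move: "x + t *\<^sub>R z \<in> ball x0 r" if "x \<in> ball x0 (r / 2)" "norm z \<le> 1" "0 \<le> t" "t \<le> r / 2" for x z t r
  proof -
    have "norm (t *\<^sub>R z) \<le> r / 2"
      using that mult_mono[of t "r / 2" "norm z" 1] by simp
    then show ?thesis
      using that norm_triangle_ineq4[of "x0 - x" "t *\<^sub>R z"] by (simp add: dist_norm algebra_simps)
  qed
  show ?thesis
  proof (cases "x0 \<in> \<Omega>")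
    case True
    then obtain r where r: "0 < r" "ball x0 r \<subseteq> \<Omega>"
      using \<Omega> unfolding lipschitz_domain_def open_contains_ball by blast
    obtain e :: 'a where e: "norm e = 1"
      using nonempty_Basis norm_Basis by blast
    show ?thesis
    proof (rule that[of "r / 2" "r / 2" "1 / 8" e])
      fix x z t assume x: "x \<in> ball x0 (r / 2)" and z: "z \<in> ball ((3 / 4) *\<^sub>R e) (1 / 8)" and t: "0 \<le> t" "t \<le> r / 2"
      show "x + t *\<^sub>R z \<in> \<Omega>"
        by (rule subsetD[OF r(2)], rule move[OF x norm_le[OF z order_refl e] t])
    qed (use r e in auto)
  next
    case False
    then have "x0 \<in> frontier \<Omega>"
      using x0 \<Omega> by (simp add: frontier_def lipschitz_domain_def interior_open)
    then obtain r e g L where r: "0 < r" and e: "norm e = 1" and g: "L-lipschitz_on {z. z \<bullet> e = 0} g"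
      and eq: "\<Omega> \<inter> ball x0 r = {x \<in> ball x0 r. x \<bullet> e > g (x - (x \<bullet> e) *\<^sub>R e)}"
      using \<Omega> unfolding lipschitz_domain_def by blast
    have L: "0 \<le> L" using g by (rule lipschitz_on_nonneg)
    have ee: "e \<bullet> e = 1" using e by (simp add: norm_eq_1)
    \<comment> \<open>Gives 2 L \<theta> \<le> 1/4, which is below the vertical gain 3/4 - \<theta>
      \<ge> 5/8; the 2 comes from \<open>norm (P z) \<le> 2 * norm w\<close>.\<close>
    define \<theta> where "\<theta> = 1 / (8 * (1 + L))"
    have \<theta>: "0 < \<theta>" "\<theta> \<le> 1 / 8" "2 * L * \<theta> \<le> 1 / 4"
      using L by (auto simp: \<theta>_def field_simps)
    show ?thesis
    proof (rule that[of "r / 2" "r / 2" \<theta> e])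
      fix x z t assume x: "x \<in> \<Omega>" "x \<in> ball x0 (r / 2)" and z: "z \<in> ball ((3 / 4) *\<^sub>R e) \<theta>" and t: "0 \<le> t" "t \<le> r / 2"
      have x_in: "x \<in> ball x0 r" using x(2) r by auto
      have in_ball: "x + t *\<^sub>R z \<in> ball x0 r"
        by (rule move[OF x(2) norm_le[OF z \<theta>(2) e] t])
      define P where "P y = y - (y \<bullet> e) *\<^sub>R e" for y
      define w where "w = z - (3 / 4) *\<^sub>R e"
      have w: "norm w < \<theta>" using z by (simp add: w_def dist_norm norm_minus_commute)
      have we: "\<bar>w \<bullet> e\<bar> \<le> norm w"
        using Cauchy_Schwarz_ineq2[of w e] e by simp
      have Pe: "P y \<bullet> e = 0" for y using ee by (simp add: P_def inner_diff_left)
      have "P z = w - (w \<bullet> e) *\<^sub>R e"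
        using ee by (simp add: P_def w_def inner_diff_left algebra_simps)
      then have "norm (P z) \<le> 2 * norm w"
        using we e norm_triangle_ineq4[of w "(w \<bullet> e) *\<^sub>R e"] by simp
      then have Pz: "norm (P z) \<le> 2 * \<theta>" using w by simp
      have ze: "z \<bullet> e \<ge> 3 / 4 - \<theta>"
        using we w ee by (simp add: w_def inner_diff_left abs_if split: if_splits)
      have "P (x + t *\<^sub>R z) - P x = t *\<^sub>R P z"
        by (simp add: P_def inner_add_left algebra_simps)
      then have "dist (g (P (x + t *\<^sub>R z))) (g (P x)) \<le> L * norm (t *\<^sub>R P z)"
        using lipschitz_onD[OF g, of "P (x + t *\<^sub>R z)" "P x"] Pe by (simp add: dist_norm)
      also have "\<dots> = t * (L * norm (P z))" using t by simp
      also have "\<dots> \<le> t * (L * (2 * \<theta>))"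
        using Pz t L by (intro mult_left_mono) auto
      also have "\<dots> \<le> t * (z \<bullet> e)"
        using \<theta> ze t by (intro mult_left_mono) (auto simp: mult_ac)
      finally have "g (P (x + t *\<^sub>R z)) \<le> g (P x) + t * (z \<bullet> e)"
        by (simp add: dist_real_def abs_if split: if_splits)
      moreover have "g (P x) < x \<bullet> e"
        using eq x(1) x_in unfolding P_def by blast
      ultimately have "g (P (x + t *\<^sub>R z)) < (x + t *\<^sub>R z) \<bullet> e"
        by (simp add: inner_add_left)
      then show "x + t *\<^sub>R z \<in> \<Omega>"
        using eq in_ball unfolding P_def by blast
    qed (use r \<theta> e in auto)
  qed
qed

section \<open>Averaging with a Lipschitz kernel\<close>

text \<open>The tent max 0 (\<theta> - |z - c|) is the weight \<psi>, so this is \<psi>(z) z z^t v.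
  Only z \<bullet> v enters, the one component of v on which the energy has a hold. A tent is
  convenient because it is supported in the ball and 1-Lipschitz.\<close>

definition bump_kernel :: "'a::euclidean_space \<Rightarrow> real \<Rightarrow> 'a \<Rightarrow> 'a \<Rightarrow> 'a" where
  "bump_kernel c \<theta> z v = (max 0 (\<theta> - norm (z - c)) * (z \<bullet> v)) *\<^sub>R z"

definition bump_average :: "'a::euclidean_space \<Rightarrow> real \<Rightarrow> real \<Rightarrow> ('a \<Rightarrow> 'a) \<Rightarrow> 'a \<Rightarrow> 'a" where
  "bump_average c \<theta> \<delta> U x = (\<integral>z. bump_kernel c \<theta> z (U (x + \<delta> *\<^sub>R z)) \<partial>lborel)"

text \<open>The matrix M applied to v. It is also the value of \<open>bump_average\<close> on the
  constant field v, hence the term with which the average is compared.\<close>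

definition bump_moment :: "'a::euclidean_space \<Rightarrow> real \<Rightarrow> 'a \<Rightarrow> 'a" where
  "bump_moment c \<theta> v = (\<integral>z. bump_kernel c \<theta> z v \<partial>lborel)"

lemma bump_kernel_measurable [measurable]:
  assumes [measurable]: "f \<in> borel_measurable M" "g \<in> borel_measurable M"
  shows "(\<lambda>x. bump_kernel c \<theta> (f x) (g x)) \<in> borel_measurable M"
  unfolding bump_kernel_def by measurable

lemma bump_kernel_diff: "bump_kernel c \<theta> z (v - w) = bump_kernel c \<theta> z v - bump_kernel c \<theta> z w"
  by (simp add: bump_kernel_def inner_diff_right right_diff_distrib scaleR_diff_left)

lemma bump_kernel_outside: "z \<notin> ball c \<theta> \<Longrightarrow> bump_kernel c \<theta> z v = 0"
  by (simp add: bump_kernel_def dist_norm norm_minus_commute max_def)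

text \<open>Keeping |z \<bullet> v| instead of |v| is the point: for v = U(x + \<delta>z) - U(x) it
  is the quantity whose p-th power \<open>dir_diff\<close> integrates.\<close>

lemma bump_kernel_norm_le_inner:
  assumes \<theta>: "0 \<le> \<theta>" "\<theta> \<le> 1" and sub: "ball c \<theta> \<subseteq> cball 0 1"
  shows "norm (bump_kernel c \<theta> z v) \<le> indicator (ball c \<theta>) z * \<bar>z \<bullet> v\<bar>"
proof (cases "z \<in> ball c \<theta>")
  case True
  then have z: "norm z \<le> 1" using sub by auto
  have m: "max 0 (\<theta> - norm (z - c)) \<le> 1" "0 \<le> max 0 (\<theta> - norm (z - c))"
    using \<theta> norm_ge_zero[of "z - c"] by (auto simp: max_def simp del: norm_ge_zero)
  have "norm (bump_kernel c \<theta> z v) = max 0 (\<theta> - norm (z - c)) * (\<bar>z \<bullet> v\<bar> * norm z)"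
    using m by (simp add: bump_kernel_def abs_mult)
  also have "\<dots> \<le> 1 * (\<bar>z \<bullet> v\<bar> * 1)"
    using m z by (intro mult_mono) auto
  finally show ?thesis using True by simp
qed (simp add: bump_kernel_outside)

lemma bump_kernel_norm_le:
  assumes \<theta>: "0 \<le> \<theta>" "\<theta> \<le> 1" and sub: "ball c \<theta> \<subseteq> cball 0 1"
  shows "norm (bump_kernel c \<theta> z v) \<le> indicator (ball c \<theta>) z * norm v"
proof (cases "z \<in> ball c \<theta>")
  case True
  then have "norm z \<le> 1" using sub by auto
  then have "\<bar>z \<bullet> v\<bar> \<le> norm v"
    using Cauchy_Schwarz_ineq2[of z v] mult_right_mono[of "norm z" 1 "norm v"] by simp
  then show ?thesis
    using bump_kernel_norm_le_inner[OF assms, of z v] True by simp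
qed (simp add: bump_kernel_outside)

lemma bump_kernel_norm_le_norm:
  assumes \<theta>: "0 \<le> \<theta>" "\<theta> \<le> 1" and sub: "ball c \<theta> \<subseteq> cball 0 1"
  shows "norm (bump_kernel c \<theta> z v) \<le> norm v"
  using bump_kernel_norm_le[OF assms, of z v] by (cases "z \<in> ball c \<theta>") auto

lemma norm_integral_le:
  fixes f :: "'b \<Rightarrow> 'c::{banach, second_countable_topology}"
  assumes "integrable M f" "integrable M g" "\<And>x. norm (f x) \<le> g x"
  shows "norm (\<integral>x. f x \<partial>M) \<le> (\<integral>x. g x \<partial>M)"
  using assms by (intro order_trans[OF integral_norm_bound] integral_mono integrable_norm) auto

text \<open>With both points in the ball, the tent, z \<bullet> v and z are varied one at a time,
  and each variation costs |z - z'| |v|, whence the 3. If only one point is in the ball, the other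
  may be far from the unit ball; the tent vanishes there, and its own Lipschitz bound
  suffices.\<close>

lemma bump_kernel_lipschitz:
  assumes \<theta>: "0 \<le> \<theta>" "\<theta> \<le> 1" and sub: "ball c \<theta> \<subseteq> cball 0 1"
  shows "norm (bump_kernel c \<theta> z v - bump_kernel c \<theta> z' v) \<le> 3 * norm (z - z') * norm v"
proof -
  define b where "b z = max 0 (\<theta> - norm (z - c))" for z
  have b0: "0 \<le> b z" "b z \<le> 1" for z
    using \<theta> norm_ge_zero[of "z - c"] by (auto simp: b_def max_def simp del: norm_ge_zero)
  have bl: "\<bar>b z - b z'\<bar> \<le> norm (z - z')" for z z'
    using norm_triangle_ineq3[of "z - c" "z' - c"] by (auto simp: b_def max_def)
  have k: "bump_kernel c \<theta> z v = (b z * (z \<bullet> v)) *\<^sub>R z" for z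
    by (simp add: bump_kernel_def b_def)
  have main: "norm (bump_kernel c \<theta> z v - bump_kernel c \<theta> z' v) \<le> 3 * norm (z - z') * norm v"
    if z: "z \<in> ball c \<theta>" for z z'
  proof (cases "z' \<in> ball c \<theta>")
    case True
    have n: "norm z \<le> 1" "norm z' \<le> 1" using z True sub by auto
    have i: "\<bar>y \<bullet> v\<bar> \<le> norm y * norm v" for y by (rule Cauchy_Schwarz_ineq2)
    have "bump_kernel c \<theta> z v - bump_kernel c \<theta> z' v =
      ((b z - b z') * (z \<bullet> v)) *\<^sub>R z + (b z' * ((z - z') \<bullet> v)) *\<^sub>R z + (b z' * (z' \<bullet> v)) *\<^sub>R (z - z')"
      by (simp add: k algebra_simps inner_diff_left)
    also have "norm \<dots> \<le> norm (((b z - b z') * (z \<bullet> v)) *\<^sub>R z) + norm ((b z' * ((z - z') \<bullet> v)) *\<^sub>R z)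
        + norm ((b z' * (z' \<bullet> v)) *\<^sub>R (z - z'))"
      by (intro order_trans[OF norm_triangle_ineq] add_right_mono norm_triangle_ineq)
    also have "\<dots> \<le> norm (z - z') * norm v + norm (z - z') * norm v + norm (z - z') * norm v"
    proof (intro add_mono)
      have "\<bar>z \<bullet> v\<bar> \<le> norm v" "\<bar>z' \<bullet> v\<bar> \<le> norm v"
        using i[of z] i[of z'] n mult_right_mono[of "norm z" 1 "norm v"] mult_right_mono[of "norm z'" 1 "norm v"] by simp_all
      note j = this
      have "\<bar>b z - b z'\<bar> * \<bar>z \<bullet> v\<bar> * norm z \<le> norm (z - z') * norm v * 1"
        using bl j n by (intro mult_mono) auto
      then show "norm (((b z - b z') * (z \<bullet> v)) *\<^sub>R z) \<le> norm (z - z') * norm v"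
        by (simp add: abs_mult)
      have "b z' * \<bar>(z - z') \<bullet> v\<bar> * norm z \<le> 1 * (norm (z - z') * norm v) * 1"
        using b0 i n by (intro mult_mono) auto
      then show "norm ((b z' * ((z - z') \<bullet> v)) *\<^sub>R z) \<le> norm (z - z') * norm v"
        using b0 by (simp add: abs_mult)
      have "b z' * \<bar>z' \<bullet> v\<bar> * norm (z - z') \<le> 1 * norm v * norm (z - z')"
        using b0 j n by (intro mult_mono) auto
      then show "norm ((b z' * (z' \<bullet> v)) *\<^sub>R (z - z')) \<le> norm (z - z') * norm v"
        using b0 by (simp add: abs_mult mult.commute)
    qed
    finally show ?thesis by (simp add: mult_ac)
  next
    case False
    then have b': "b z' = 0" by (simp add: b_def dist_norm norm_minus_commute max_def)
    have n: "norm z \<le> 1" using z sub by auto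
    have "\<bar>z \<bullet> v\<bar> \<le> norm v"
      using Cauchy_Schwarz_ineq2[of z v] n mult_right_mono[of "norm z" 1 "norm v"] by simp
    then have "b z * \<bar>z \<bullet> v\<bar> * norm z \<le> norm (z - z') * norm v * 1"
      using bl[of z z'] b' b0[of z] n by (intro mult_mono) auto
    then have "norm (bump_kernel c \<theta> z v - bump_kernel c \<theta> z' v) \<le> norm (z - z') * norm v"
      using b' b0[of z] by (simp add: k abs_mult)
    also have "\<dots> \<le> 3 * norm (z - z') * norm v" by simp
    finally show ?thesis .
  qed
  show ?thesis
  proof (cases "z \<in> ball c \<theta>")
    case False
    show ?thesis
    proof (cases "z' \<in> ball c \<theta>")
      case True
      then show ?thesis using main[of z' z] by (simp add: norm_minus_commute)
    qed (use False in \<open>simp add: bump_kernel_outside\<close>)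
  qed (rule main)
qed

lemma integrable_affine_lborel:
  fixes U :: "'a::euclidean_space \<Rightarrow> 'b::euclidean_space"
  assumes U: "integrable lborel U" and \<delta>: "\<delta> \<noteq> 0"
  shows "integrable lborel (\<lambda>z. U (x + \<delta> *\<^sub>R z))"
proof -
  have [measurable]: "U \<in> borel_measurable borel" using U by auto
  have "(\<integral>\<^sup>+z. ennreal (norm (U z)) \<partial>lborel) < \<infinity>"
    using U by (simp add: integrable_iff_bounded)
  then have "ennreal (\<bar>\<delta>\<bar> ^ DIM('a)) * (\<integral>\<^sup>+z. ennreal (norm (U (x + \<delta> *\<^sub>R z))) \<partial>lborel) < \<infinity>"
    by (subst (asm) nn_integral_lborel_affine[OF _ \<delta>, of _ x]) auto
  then have "(\<integral>\<^sup>+z. ennreal (norm (U (x + \<delta> *\<^sub>R z))) \<partial>lborel) < \<infinity>"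
    using \<delta> by (auto simp: ennreal_mult_less_top)
  then show ?thesis
    by (simp add: integrable_iff_bounded)
qed

lemma integrable_bump_kernel:
  fixes U :: "'a::euclidean_space \<Rightarrow> 'a"
  assumes \<theta>: "0 \<le> \<theta>" "\<theta> \<le> 1" and sub: "ball c \<theta> \<subseteq> cball 0 1" and U: "integrable lborel U" and \<delta>: "\<delta> \<noteq> 0"
  shows "integrable lborel (\<lambda>z. bump_kernel c \<theta> z (U (x + \<delta> *\<^sub>R z)))"
proof (rule Bochner_Integration.integrable_bound[OF integrable_affine_lborel[OF U \<delta>, of x]])
  have [measurable]: "U \<in> borel_measurable borel" using U by auto
  show "(\<lambda>z. bump_kernel c \<theta> z (U (x + \<delta> *\<^sub>R z))) \<in> borel_measurable lborel" by simp
  show "AE z in lborel. norm (bump_kernel c \<theta> z (U (x + \<delta> *\<^sub>R z))) \<le> norm (U (x + \<delta> *\<^sub>R z))"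
    by (intro AE_I2 bump_kernel_norm_le_norm \<theta> sub)
qed

lemma integrable_bump_kernel_const:
  fixes v :: "'a::euclidean_space"
  assumes \<theta>: "0 \<le> \<theta>" "\<theta> \<le> 1" and sub: "ball c \<theta> \<subseteq> cball 0 1"
  shows "integrable lborel (\<lambda>z. bump_kernel c \<theta> z v)"
proof (rule Bochner_Integration.integrable_bound)
  show "integrable lborel (\<lambda>z::'a. indicator (ball c \<theta>) z *\<^sub>R v)"
    using emeasure_lborel_ball_finite[of c \<theta>] by (intro integrable_indicator) auto
qed (use bump_kernel_norm_le[OF \<theta> sub] in \<open>auto simp: measurable_lborel1\<close>)

text \<open>M v \<bullet> v is the integral of \<psi>(z) (z \<bullet> v)^2. If M v = 0, continuity
  makes z \<bullet> v vanish on the whole ball, and comparing c with a point c + a v, a > 0, gives v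
  = 0. An injective linear map in finite dimension is bounded below.\<close>

lemma bump_moment_bounded_below:
  fixes c :: "'a::euclidean_space"
  assumes \<theta>: "0 < \<theta>" "\<theta> \<le> 1" and sub: "ball c \<theta> \<subseteq> cball 0 1"
  obtains B where "0 < B" "\<And>v. B * norm v \<le> norm (bump_moment c \<theta> v)"
proof -
  note int = integrable_bump_kernel_const[OF less_imp_le[OF \<theta>(1)] \<theta>(2) sub]
  have "linear (bump_moment c \<theta>)"
  proof (rule linearI)
    fix v w
    have "bump_kernel c \<theta> z (v + w) = bump_kernel c \<theta> z v + bump_kernel c \<theta> z w" for z
      by (simp add: bump_kernel_def inner_add_right distrib_left scaleR_add_left)
    then show "bump_moment c \<theta> (v + w) = bump_moment c \<theta> v + bump_moment c \<theta> w"
      unfolding bump_moment_def using int by simp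
  next
    fix a v
    have "bump_kernel c \<theta> z (a *\<^sub>R v) = a *\<^sub>R bump_kernel c \<theta> z v" for z
      by (simp add: bump_kernel_def)
    then show "bump_moment c \<theta> (a *\<^sub>R v) = a *\<^sub>R bump_moment c \<theta> v"
      unfolding bump_moment_def using int by simp
  qed
  moreover have "v = 0" if v: "bump_moment c \<theta> v = 0" for v
  proof (rule ccontr)
    assume "v \<noteq> 0"
    define f where "f z = max 0 (\<theta> - norm (z - c)) * (z \<bullet> v)\<^sup>2" for z
    have f: "f z = bump_kernel c \<theta> z v \<bullet> v" for z
      by (simp add: f_def bump_kernel_def power2_eq_square)
    have cont: "continuous_on UNIV f"
      unfolding f_def by (intro continuous_intros)
    have "(\<integral>z. f z \<partial>lborel) = bump_moment c \<theta> v \<bullet> v"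
      unfolding f bump_moment_def by (rule integral_inner_left[OF int])
    then have "(\<integral>z. f z \<partial>lborel) = 0" using v by simp
    moreover have "integrable lborel f"
      unfolding f[abs_def] using int by (rule integrable_inner_left)
    moreover have "0 \<le> f z" for z by (simp add: f_def)
    ultimately have "AE z in lborel. f z = 0"
      by (subst (asm) integral_nonneg_eq_0_iff_AE) auto
    then have "{z. f z \<noteq> 0} \<in> null_sets lborel"
      using borel_measurable_continuous_onI[OF cont] by (subst (asm) AE_iff_null) auto
    then have "negligible {z. f z \<noteq> 0}"
      by (simp add: negligible_iff_null_sets null_sets_completionI)
    moreover have "open {z. f z \<noteq> 0}"
      using cont by (intro open_Collect_neq continuous_on_const)
    ultimately have zero: "f z = 0" for z
      using open_not_negligible by blast
    have "z \<bullet> v = 0" if "norm (z - c) < \<theta>" for z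
      using zero[of z] that by (simp add: f_def)
    note 0 = this
    have "norm (((\<theta> / 2) / norm v) *\<^sub>R v) < \<theta>" using \<theta> \<open>v \<noteq> 0\<close> by simp
    then have "(c + ((\<theta> / 2) / norm v) *\<^sub>R v) \<bullet> v = 0" by (intro 0) simp
    moreover have "c \<bullet> v = 0" using \<theta> by (intro 0) simp
    ultimately show False
      using \<theta> \<open>v \<noteq> 0\<close> by (simp add: inner_add_left)
  qed
  ultimately have "inj (bump_moment c \<theta>)"
    by (simp add: linear_injective_0)
  with \<open>linear (bump_moment c \<theta>)\<close> show ?thesis
    using linear_inj_bounded_below_pos that by (metis mult.commute)
qed

text \<open>M U(x) minus the average at x is the integral of the kernel applied to U(x) - U(x +
  \<delta>z), so pointwise it is at most the integral of |z \<bullet> (U(x + \<delta>z) - U(x))|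
  over the ball. Jensen and Tonelli finish; for x in A the indicator of \<Omega> in
  \<open>dir_diff\<close> equals 1 by \<open>seg\<close>.\<close>

lemma bump_average_approx:
  fixes U :: "'a::euclidean_space \<Rightarrow> 'a"
  assumes p: "1 \<le> p" and \<theta>: "0 < \<theta>" "\<theta> \<le> 1" and sub: "ball c \<theta> \<subseteq> cball 0 1"
    and [measurable]: "A \<in> sets borel" "\<Omega> \<in> sets borel"
    and U: "integrable lborel U" and \<delta>: "0 < \<delta>"
    and seg: "\<And>x z. x \<in> A \<Longrightarrow> z \<in> ball c \<theta> \<Longrightarrow> x + \<delta> *\<^sub>R z \<in> \<Omega>"
  shows "(\<integral>\<^sup>+x. indicator A x * ennreal (norm (bump_moment c \<theta> (U x) - bump_average c \<theta> \<delta> U x) powr p) \<partial>lborel)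
    \<le> ennreal (2 * (2 * measure lborel (ball c \<theta>)) powr (p - 1)) *
       (\<integral>\<^sup>+z. indicator (ball c \<theta>) z * dir_diff p A \<Omega> U z (\<delta> *\<^sub>R z) \<partial>lborel)"
proof -
  define C where "C = ball c \<theta>"
  define m where "m = measure lborel C"
  define K where "K = ennreal (2 * (2 * m) powr (p - 1))"
  have [measurable]: "U \<in> borel_measurable borel" using U by auto
  have [measurable]: "C \<in> sets borel" by (simp add: C_def)
  have m: "emeasure lborel C = ennreal m"
    unfolding m_def C_def using emeasure_lborel_ball_finite[of c \<theta>] by (simp add: emeasure_eq_ennreal_measure)
  have mpos: "0 < m"
    using content_ball_pos[OF \<theta>(1), of c] by (simp add: m_def C_def)
  have \<theta>0: "0 \<le> \<theta>" using \<theta> by simp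
  have \<delta>0: "\<delta> \<noteq> 0" using \<delta> by simp
  define g where "g x z = \<bar>z \<bullet> (U (x + \<delta> *\<^sub>R z) - U x)\<bar>" for x z
  have [measurable]: "(\<lambda>(x, z). g x z) \<in> borel_measurable (borel \<Otimes>\<^sub>M borel)"
    unfolding g_def by measurable
  have pt: "ennreal (norm (bump_moment c \<theta> (U x) - bump_average c \<theta> \<delta> U x) powr p)
      \<le> K * (\<integral>\<^sup>+z. indicator C z * ennreal (g x z powr p) \<partial>lborel)" for x
  proof -
    have gi: "integrable lborel (\<lambda>z. indicator C z *\<^sub>R g x z)"
    proof (rule Bochner_Integration.integrable_bound)
      show "integrable lborel (\<lambda>z. norm (U (x + \<delta> *\<^sub>R z)) + indicator C z *\<^sub>R norm (U x))"
        using integrable_affine_lborel[OF U \<delta>0, of x] m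
        by (intro Bochner_Integration.integrable_add integrable_norm integrable_indicator) auto
      show "AE z in lborel. norm (indicator C z *\<^sub>R g x z) \<le> norm (norm (U (x + \<delta> *\<^sub>R z)) + indicator C z *\<^sub>R norm (U x))"
      proof (rule AE_I2)
        fix z :: 'a
        show "norm (indicator C z *\<^sub>R g x z) \<le> norm (norm (U (x + \<delta> *\<^sub>R z)) + indicator C z *\<^sub>R norm (U x))"
        proof (cases "z \<in> C")
          case True
          then have "norm z \<le> 1" using sub by (auto simp: C_def)
          then have "g x z \<le> norm (U (x + \<delta> *\<^sub>R z) - U x)"
            using Cauchy_Schwarz_ineq2[of z "U (x + \<delta> *\<^sub>R z) - U x"]
              mult_right_mono[of "norm z" 1 "norm (U (x + \<delta> *\<^sub>R z) - U x)"] by (simp add: g_def)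
          also have "\<dots> \<le> norm (U (x + \<delta> *\<^sub>R z)) + norm (U x)" by (rule norm_triangle_ineq4)
          finally show ?thesis using True by (simp add: g_def)
        qed simp
      qed
    qed simp
    define S where "S = (\<integral>z. indicator C z *\<^sub>R g x z \<partial>lborel)"
    have S0: "0 \<le> S" unfolding S_def by (intro integral_nonneg_AE AE_I2) (simp add: g_def)
    have "bump_moment c \<theta> (U x) - bump_average c \<theta> \<delta> U x
       = (\<integral>z. bump_kernel c \<theta> z (U x) - bump_kernel c \<theta> z (U (x + \<delta> *\<^sub>R z)) \<partial>lborel)"
      unfolding bump_moment_def bump_average_def
      by (intro Bochner_Integration.integral_diff[symmetric] integrable_bump_kernel_const integrable_bump_kernel \<theta> \<theta>0 sub U \<delta>0)
    also have "norm \<dots> \<le> S"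
      unfolding S_def
    proof (rule norm_integral_le)
      fix z
      show "norm (bump_kernel c \<theta> z (U x) - bump_kernel c \<theta> z (U (x + \<delta> *\<^sub>R z))) \<le> indicator C z *\<^sub>R g x z"
        using bump_kernel_norm_le_inner[OF \<theta>0 \<theta>(2) sub, of z "U (x + \<delta> *\<^sub>R z) - U x"]
        by (simp add: bump_kernel_diff norm_minus_commute g_def C_def)
    qed (intro gi Bochner_Integration.integrable_diff integrable_bump_kernel_const integrable_bump_kernel \<theta> \<theta>0 sub U \<delta>0)+
    finally have "norm (bump_moment c \<theta> (U x) - bump_average c \<theta> \<delta> U x) powr p \<le> S powr p"
      using p by (intro powr_mono2) auto
    then have "ennreal (norm (bump_moment c \<theta> (U x) - bump_average c \<theta> \<delta> U x) powr p) \<le> ennreal (S powr p)"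
      by (rule ennreal_leI)
    also have "\<dots> \<le> K * (\<integral>\<^sup>+z. ennreal (g x z powr p) \<partial>restrict_space lborel C)"
      unfolding K_def
    proof (rule powr_nn_integral_le[OF p _ _ _ mpos _ S0])
      show "(\<integral>\<^sup>+z. ennreal (g x z) \<partial>restrict_space lborel C) = ennreal S"
      proof -
        have "(\<integral>\<^sup>+z. ennreal (g x z) \<partial>restrict_space lborel C) = (\<integral>\<^sup>+z. ennreal (indicator C z *\<^sub>R g x z) \<partial>lborel)"
          by (subst nn_integral_restrict_space) (auto intro!: nn_integral_cong split: split_indicator)
        also have "\<dots> = ennreal S"
          unfolding S_def using gi by (intro nn_integral_eq_integral) (auto simp: g_def)
        finally show ?thesis .
      qed
    qed (use m in \<open>auto simp: g_def emeasure_restrict_space intro!: measurable_restrict_space1\<close>)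
    also have "(\<integral>\<^sup>+z. ennreal (g x z powr p) \<partial>restrict_space lborel C) = (\<integral>\<^sup>+z. indicator C z * ennreal (g x z powr p) \<partial>lborel)"
      by (subst nn_integral_restrict_space) (auto intro!: nn_integral_cong split: split_indicator)
    finally show ?thesis .
  qed
  have "(\<integral>\<^sup>+x. indicator A x * ennreal (norm (bump_moment c \<theta> (U x) - bump_average c \<theta> \<delta> U x) powr p) \<partial>lborel)
    \<le> (\<integral>\<^sup>+x. K * (\<integral>\<^sup>+z. indicator A x * indicator C z * ennreal (g x z powr p) \<partial>lborel) \<partial>lborel)"
    using pt by (intro nn_integral_mono) (auto split: split_indicator)
  also have "\<dots> = K * (\<integral>\<^sup>+x. (\<integral>\<^sup>+z. indicator A x * indicator C z * ennreal (g x z powr p) \<partial>lborel) \<partial>lborel)"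
    by (rule nn_integral_cmult) measurable
  also have "(\<integral>\<^sup>+x. (\<integral>\<^sup>+z. indicator A x * indicator C z * ennreal (g x z powr p) \<partial>lborel) \<partial>lborel)
    = (\<integral>\<^sup>+z. (\<integral>\<^sup>+x. indicator A x * indicator C z * ennreal (g x z powr p) \<partial>lborel) \<partial>lborel)"
    by (rule lborel_pair.Fubini'[symmetric]) measurable
  also have "\<dots> = (\<integral>\<^sup>+z. indicator C z * dir_diff p A \<Omega> U z (\<delta> *\<^sub>R z) \<partial>lborel)"
  proof (rule nn_integral_cong)
    fix z
    show "(\<integral>\<^sup>+x. indicator A x * indicator C z * ennreal (g x z powr p) \<partial>lborel)
      = indicator C z * dir_diff p A \<Omega> U z (\<delta> *\<^sub>R z)"
    proof (cases "z \<in> C")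
      case True
      have "indicator A x * indicator C z * ennreal (g x z powr p)
        = indicator A x * indicator \<Omega> (x + \<delta> *\<^sub>R z) * ennreal (\<bar>z \<bullet> (U (x + \<delta> *\<^sub>R z) - U x)\<bar> powr p)" for x
        using True seg[of x z] by (cases "x \<in> A") (simp_all add: g_def C_def)
      then show ?thesis
        using True by (simp add: dir_diff_def C_def)
    qed (simp add: C_def)
  qed
  finally show ?thesis
    by (simp add: K_def m_def C_def)
qed

text \<open>Moves x from the argument of U into the kernel, so that regularity in x comes from the
  kernel while U is merely integrable.\<close>

lemma bump_average_substitution:
  fixes U :: "'a::euclidean_space \<Rightarrow> 'a"
  assumes [measurable]: "U \<in> borel_measurable borel" and \<delta>: "0 < \<delta>"
  shows "bump_average c \<theta> \<delta> U x = (\<integral>y. bump_kernel c \<theta> ((y - x) /\<^sub>R \<delta>) (U y) \<partial>lborel) /\<^sub>R \<delta> ^ DIM('a)"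
proof -
  define f where "f y = bump_kernel c \<theta> ((y - x) /\<^sub>R \<delta>) (U y)" for y
  have [measurable]: "f \<in> borel_measurable borel" unfolding f_def by measurable
  have "(\<integral>y. f y \<partial>lborel) = (\<integral>z. \<delta> ^ DIM('a) *\<^sub>R f (x + \<delta> *\<^sub>R z) \<partial>lborel)"
    using \<delta> by (subst lborel_affine[of \<delta> x]) (simp_all add: integral_density integral_distr)
  also have "\<dots> = \<delta> ^ DIM('a) *\<^sub>R bump_average c \<theta> \<delta> U x"
    using \<delta> by (simp add: f_def bump_average_def)
  finally show ?thesis
    using \<delta> by (simp add: f_def)
qed

lemma integrable_bump_kernel_rescaled:
  fixes U :: "'a::euclidean_space \<Rightarrow> 'a"
  assumes \<theta>: "0 \<le> \<theta>" "\<theta> \<le> 1" and sub: "ball c \<theta> \<subseteq> cball 0 1" and U: "integrable lborel U"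
  shows "integrable lborel (\<lambda>y. bump_kernel c \<theta> ((y - x) /\<^sub>R \<delta>) (U y))"
proof (rule Bochner_Integration.integrable_bound[OF U])
  have [measurable]: "U \<in> borel_measurable borel" using U by auto
  show "(\<lambda>y. bump_kernel c \<theta> ((y - x) /\<^sub>R \<delta>) (U y)) \<in> borel_measurable lborel" by simp
  show "AE y in lborel. norm (bump_kernel c \<theta> ((y - x) /\<^sub>R \<delta>) (U y)) \<le> norm (U y)"
    by (intro AE_I2 bump_kernel_norm_le_norm \<theta> sub)
qed

lemma bump_average_bound:
  fixes U :: "'a::euclidean_space \<Rightarrow> 'a"
  assumes \<theta>: "0 \<le> \<theta>" "\<theta> \<le> 1" and sub: "ball c \<theta> \<subseteq> cball 0 1" and U: "integrable lborel U" and \<delta>: "0 < \<delta>"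
  shows "norm (bump_average c \<theta> \<delta> U x) \<le> (\<integral>y. norm (U y) \<partial>lborel) / \<delta> ^ DIM('a)"
proof -
  have [measurable]: "U \<in> borel_measurable borel" using U by auto
  have "norm (\<integral>y. bump_kernel c \<theta> ((y - x) /\<^sub>R \<delta>) (U y) \<partial>lborel) \<le> (\<integral>y. norm (U y) \<partial>lborel)"
  proof (rule norm_integral_le)
    show "norm (bump_kernel c \<theta> ((y - x) /\<^sub>R \<delta>) (U y)) \<le> norm (U y)" for y
      by (intro bump_kernel_norm_le_norm \<theta> sub)
  qed (auto intro!: integrable_bump_kernel_rescaled \<theta> sub U)
  then show ?thesis
    using \<delta> by (simp add: bump_average_substitution divide_inverse mult.commute[of _ "inverse _"] mult_left_mono)
qed

text \<open>The power of 1/\<delta> beyond the Jacobian comes from rescaling the argument of the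
  kernel. U enters only through its L^1 norm, so at fixed \<delta> the averages of an L^1-bounded
  sequence are equi-Lipschitz.\<close>

lemma bump_average_lipschitz:
  fixes U :: "'a::euclidean_space \<Rightarrow> 'a"
  assumes \<theta>: "0 \<le> \<theta>" "\<theta> \<le> 1" and sub: "ball c \<theta> \<subseteq> cball 0 1" and U: "integrable lborel U" and \<delta>: "0 < \<delta>"
  shows "norm (bump_average c \<theta> \<delta> U x - bump_average c \<theta> \<delta> U x')
    \<le> (3 / \<delta> ^ Suc (DIM('a))) * (\<integral>y. norm (U y) \<partial>lborel) * norm (x - x')"
proof -
  have [measurable]: "U \<in> borel_measurable borel" using U by auto
  let ?k = "\<lambda>x y. bump_kernel c \<theta> ((y - x) /\<^sub>R \<delta>) (U y)"
  have "norm (\<integral>y. ?k x y - ?k x' y \<partial>lborel) \<le> (\<integral>y. (3 / \<delta> * norm (x - x')) * norm (U y) \<partial>lborel)"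
  proof (rule norm_integral_le)
    fix y
    have "norm ((y - x) /\<^sub>R \<delta> - (y - x') /\<^sub>R \<delta>) = norm (x - x') / \<delta>"
      using \<delta> by (simp add: scaleR_diff_right[symmetric] norm_minus_commute divide_inverse)
    then show "norm (?k x y - ?k x' y) \<le> (3 / \<delta> * norm (x - x')) * norm (U y)"
      using bump_kernel_lipschitz[OF \<theta> sub, of "(y - x) /\<^sub>R \<delta>" "U y" "(y - x') /\<^sub>R \<delta>"] by simp
  qed (intro integrable_bump_kernel_rescaled Bochner_Integration.integrable_diff integrable_mult_right integrable_norm \<theta> sub U)+
  moreover have "(\<integral>y. ?k x y - ?k x' y \<partial>lborel) = (\<integral>y. ?k x y \<partial>lborel) - (\<integral>y. ?k x' y \<partial>lborel)"
    by (intro Bochner_Integration.integral_diff integrable_bump_kernel_rescaled \<theta> sub U)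
  ultimately have "norm ((\<integral>y. ?k x y \<partial>lborel) - (\<integral>y. ?k x' y \<partial>lborel)) \<le> 3 / \<delta> * norm (x - x') * (\<integral>y. norm (U y) \<partial>lborel)"
    by simp
  then have "inverse (\<delta> ^ DIM('a)) * norm ((\<integral>y. ?k x y \<partial>lborel) - (\<integral>y. ?k x' y \<partial>lborel))
     \<le> inverse (\<delta> ^ DIM('a)) * (3 / \<delta> * norm (x - x') * (\<integral>y. norm (U y) \<partial>lborel))"
    using \<delta> by (intro mult_left_mono) auto
  then show ?thesis
    using \<delta> by (simp add: bump_average_substitution scaleR_diff_right[symmetric] divide_inverse mult_ac)
qed

section \<open>A finite cover of the domain by pieces with common directions\<close>

text \<open>The closure rather than \<Omega> is covered, for the sake of compactness; a ball about a
  boundary point is then cut down to \<Omega>. A triple (A, c, \<theta>) records a piece and the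
  ball of directions that it admits.\<close>

lemma lipschitz_domain_cover:
  fixes \<Omega> :: "'a::euclidean_space set"
  assumes \<Omega>: "lipschitz_domain \<Omega>"
  obtains I :: "('a set \<times> 'a \<times> real) set" and s where "finite I" "0 < s"
    "\<Omega> \<subseteq> (\<Union>(A, c, \<theta>)\<in>I. A)"
    "\<And>A c \<theta>. (A, c, \<theta>) \<in> I \<Longrightarrow> A \<in> sets borel \<and> A \<subseteq> \<Omega> \<and> 0 < \<theta> \<and> \<theta> \<le> 1"
    "\<And>A c \<theta> z. (A, c, \<theta>) \<in> I \<Longrightarrow> z \<in> ball c \<theta> \<Longrightarrow> 1 / 2 \<le> norm z \<and> norm z < 1"
    "\<And>A c \<theta> x z t. (A, c, \<theta>) \<in> I \<Longrightarrow> x \<in> A \<Longrightarrow> z \<in> ball c \<theta> \<Longrightarrow> 0 \<le> t \<Longrightarrow> t \<le> s \<Longrightarrow> x + t *\<^sub>R z \<in> \<Omega>"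
proof -
  define Q where "Q x0 r s \<theta> e \<longleftrightarrow> 0 < r \<and> 0 < s \<and> 0 < \<theta> \<and> \<theta> \<le> 1 / 8 \<and> norm (e::'a) = 1 \<and>
    (\<forall>x z t. x \<in> \<Omega> \<longrightarrow> x \<in> ball x0 r \<longrightarrow> z \<in> ball ((3 / 4) *\<^sub>R e) \<theta> \<longrightarrow> 0 \<le> t \<longrightarrow> t \<le> s \<longrightarrow> x + t *\<^sub>R z \<in> \<Omega>)"
    for x0 r s \<theta> e
  have "\<exists>r s \<theta> e. Q x0 r s \<theta> e" if "x0 \<in> closure \<Omega>" for x0
    using lipschitz_domain_segments[OF \<Omega> that] unfolding Q_def by metis
  then obtain r s \<theta> e where Q: "\<And>x0. x0 \<in> closure \<Omega> \<Longrightarrow> Q x0 (r x0) (s x0) (\<theta> x0) (e x0)"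
    by metis
  have r: "0 < r x0" and s: "0 < s x0" and \<theta>: "0 < \<theta> x0" "\<theta> x0 \<le> 1 / 8" and e: "norm (e x0) = 1"
    if "x0 \<in> closure \<Omega>" for x0
    using Q[OF that] unfolding Q_def by blast+
  have seg: "x + t *\<^sub>R z \<in> \<Omega>"
    if "x0 \<in> closure \<Omega>" "x \<in> \<Omega>" "x \<in> ball x0 (r x0)" "z \<in> ball ((3 / 4) *\<^sub>R e x0) (\<theta> x0)" "0 \<le> t" "t \<le> s x0"
    for x0 x z t
    using Q[OF that(1)] that unfolding Q_def by blast
  have "compact (closure \<Omega>)"
    using \<Omega> by (simp add: lipschitz_domain_def compact_closure)
  moreover have "closure \<Omega> \<subseteq> (\<Union>x\<in>closure \<Omega>. ball x (r x))"
    using r by auto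
  ultimately obtain D where D: "D \<subseteq> closure \<Omega>" "finite D" "closure \<Omega> \<subseteq> (\<Union>x\<in>D. ball x (r x))"
    using compactE_image[of "closure \<Omega>" "closure \<Omega>" "\<lambda>x. ball x (r x)"] by blast
  have op: "open \<Omega>" using \<Omega> by (simp add: lipschitz_domain_def)
  define I where "I = (\<lambda>x. (\<Omega> \<inter> ball x (r x), (3 / 4) *\<^sub>R e x, \<theta> x)) ` D"
  have I: "\<exists>x\<in>D. A = \<Omega> \<inter> ball x (r x) \<and> c = (3 / 4) *\<^sub>R e x \<and> t = \<theta> x" if "(A, c, t) \<in> I" for A c t
    using that by (auto simp: I_def)
  show ?thesis
  \<comment> \<open>Inserting 1 makes the set nonempty without a separate argument about
    \<open>D\<close>.\<close>
  proof (rule that[of I "Min (insert 1 (s ` D))"])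
    show "0 < Min (insert 1 (s ` D))"
      using D s by (subst Min_gr_iff) auto
    show "\<Omega> \<subseteq> (\<Union>(A, c, \<theta>)\<in>I. A)"
      using D closure_subset[of \<Omega>] by (fastforce simp: I_def)
  next
    fix A c t assume "(A, c, t) \<in> I"
    then obtain x where "x \<in> D" "A = \<Omega> \<inter> ball x (r x)" "t = \<theta> x" using I by blast
    then show "A \<in> sets borel \<and> A \<subseteq> \<Omega> \<and> 0 < t \<and> t \<le> 1"
      using op \<theta>[of x] D by (auto intro!: borel_open)
  next
    fix A c t z assume "(A, c, t) \<in> I" and z: "z \<in> ball c t"
    then obtain x where x: "x \<in> D" "c = (3 / 4) *\<^sub>R e x" "t = \<theta> x" using I by blast
    then have x': "x \<in> closure \<Omega>" using D by blast
    have "norm c = 3 / 4" using e[OF x'] x by simp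
    moreover have "norm (z - c) < 1 / 8"
      using z \<theta>(2)[OF x'] x by (simp add: dist_norm norm_minus_commute)
    moreover have "\<bar>norm z - norm c\<bar> \<le> norm (z - c)" by (rule norm_triangle_ineq3)
    ultimately show "1 / 2 \<le> norm z \<and> norm z < 1" by linarith
  next
    fix A c t x z w assume I': "(A, c, t) \<in> I" and x: "x \<in> A" and z: "z \<in> ball c t" and w: "0 \<le> w" "w \<le> Min (insert 1 (s ` D))"
    obtain y where y: "y \<in> D" "A = \<Omega> \<inter> ball y (r y)" "c = (3 / 4) *\<^sub>R e y" "t = \<theta> y" using I[OF I'] by blast
    have "w \<le> s y"
      using w(2) y(1) D(2) by (meson Min_le finite_imageI finite_insert imageI insertI2 order_trans)
    with y x z w D show "x + w *\<^sub>R z \<in> \<Omega>"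
      by (intro seg[of y]) auto
  qed (use D in \<open>auto simp: I_def\<close>)
qed

section \<open>Integrability and completeness in L^p\<close>

lemma Lp_imp_integrable:
  fixes U :: "'a::euclidean_space \<Rightarrow> 'b::euclidean_space"
  assumes p: "1 \<le> p" and [measurable]: "U \<in> borel_measurable borel" "\<Omega> \<in> sets borel" and fin: "emeasure lborel \<Omega> < \<infinity>"
    and zero: "\<And>x. x \<notin> \<Omega> \<Longrightarrow> U x = 0" and C: "(\<integral>\<^sup>+x. ennreal (norm (U x) powr p) \<partial>lborel) \<le> ennreal C" "0 \<le> C"
  shows "integrable lborel U" "(\<integral>x. norm (U x) \<partial>lborel) \<le> measure lborel \<Omega> + C"
proof -
  have m: "emeasure lborel \<Omega> = ennreal (measure lborel \<Omega>)"
    using fin by (simp add: emeasure_eq_ennreal_measure)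
  have "t \<le> 1 + t powr p" if "0 \<le> t" for t :: real
  proof (cases "t \<le> 1")
    case False
    then have "t powr 1 \<le> t powr p" using p by (intro powr_mono) auto
    then show ?thesis using False by simp
  qed (simp add: add_increasing2)
  then have "ennreal (norm (U x)) \<le> indicator \<Omega> x + ennreal (norm (U x) powr p)" for x
    using zero[of x] by (cases "x \<in> \<Omega>") (auto simp: ennreal_plus[symmetric] ennreal_1[symmetric] simp del: ennreal_plus ennreal_1 intro!: ennreal_leI)
  then have "(\<integral>\<^sup>+x. ennreal (norm (U x)) \<partial>lborel) \<le> (\<integral>\<^sup>+x. indicator \<Omega> x + ennreal (norm (U x) powr p) \<partial>lborel)"
    by (intro nn_integral_mono)
  also have "\<dots> = emeasure lborel \<Omega> + (\<integral>\<^sup>+x. ennreal (norm (U x) powr p) \<partial>lborel)"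
    by (subst nn_integral_add) auto
  also have "\<dots> \<le> ennreal (measure lborel \<Omega> + C)"
    using C by (simp add: m add_left_mono)
  finally have le: "(\<integral>\<^sup>+x. ennreal (norm (U x)) \<partial>lborel) \<le> ennreal (measure lborel \<Omega> + C)" .
  then show int: "integrable lborel U"
    by (simp add: integrable_iff_bounded) (metis ennreal_less_top order_le_less_trans)
  have "ennreal (\<integral>x. norm (U x) \<partial>lborel) \<le> ennreal (measure lborel \<Omega> + C)"
    using le nn_integral_eq_integral[OF integrable_norm[OF int]] by simp
  then show "(\<integral>x. norm (U x) \<partial>lborel) \<le> measure lborel \<Omega> + C"
    using C by (subst (asm) ennreal_le_iff) auto
qed

text \<open>Weighting the increments of a fast subsequence by 2^(jp) still leaves a finite total
  integral, so almost everywhere the j-th increment is at most a constant times 2^(-j) and the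
  series of increments converges; Minkowski's inequality is bypassed. Fatou's lemma then returns to
  the whole sequence.\<close>

lemma Lp_Cauchy_convergent:
  fixes f :: "nat \<Rightarrow> 'b \<Rightarrow> 'c::euclidean_space"
  assumes p: "1 \<le> p" and f [measurable]: "\<And>k. f k \<in> borel_measurable M"
    and cauchy: "\<And>\<epsilon>. 0 < \<epsilon> \<Longrightarrow> \<exists>N. \<forall>k\<ge>N. \<forall>l\<ge>N. (\<integral>\<^sup>+x. ennreal (norm (f k x - f l x) powr p) \<partial>M) \<le> ennreal \<epsilon>"
  obtains v where "v \<in> borel_measurable M" "(\<lambda>k. \<integral>\<^sup>+x. ennreal (norm (f k x - v x) powr p) \<partial>M) \<longlonglongrightarrow> 0"
proof -
  define J where "J k l = (\<integral>\<^sup>+x. ennreal (norm (f k x - f l x) powr p) \<partial>M)" for k l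
  \<comment> \<open>The second factor cancels the weight 2^(jp), leaving the summable
    2^(-j).\<close>
  define b where "b j = (1 / 2) ^ j * ((1 / 2) ^ j) powr p" for j :: nat
  have b: "0 < b j" for j by (simp add: b_def)
  obtain N where N: "\<And>j k l. k \<ge> N j \<Longrightarrow> l \<ge> N j \<Longrightarrow> J k l \<le> ennreal (b j)"
    using cauchy[OF b] unfolding J_def by metis
  define n where "n j = (\<Sum>i\<le>j. N i) + j" for j
  have n_ge: "N j \<le> n j" for j
    unfolding n_def by (rule trans_le_add1, rule member_le_sum) auto
  have n_Suc: "n j < n (Suc j)" for j by (simp add: n_def)
  have n: "strict_mono n" using n_Suc by (simp add: strict_mono_Suc_iff)
  define g where "g j x = norm (f (n (Suc j)) x - f (n j) x)" for j x
  have [measurable]: "g j \<in> borel_measurable M" for j unfolding g_def by measurable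
  have "(\<integral>\<^sup>+x. (\<Sum>j. ennreal ((2 ^ j) powr p) * ennreal (g j x powr p)) \<partial>M)
    = (\<Sum>j. ennreal ((2 ^ j) powr p) * J (n (Suc j)) (n j))"
    unfolding J_def g_def[symmetric] by (subst nn_integral_suminf) (auto simp: nn_integral_cmult)
  also have "\<dots> \<le> (\<Sum>j. ennreal ((1 / 2) ^ j))"
  proof (intro suminf_le allI)
    fix j
    have "J (n (Suc j)) (n j) \<le> ennreal (b j)"
      using n_ge[of j] n_Suc[of j] by (intro N) auto
    then have "ennreal ((2 ^ j) powr p) * J (n (Suc j)) (n j) \<le> ennreal ((2 ^ j) powr p) * ennreal (b j)"
      by (intro mult_left_mono) auto
    also have "\<dots> = ennreal ((1 / 2) ^ j * ((2 ^ j * (1 / 2) ^ j) powr p))"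
      unfolding powr_mult by (simp add: b_def ennreal_mult[symmetric] mult_ac)
    also have "(2 ^ j * (1 / 2) ^ j :: real) = 1"
      by (simp add: power_mult_distrib[symmetric])
    finally show "ennreal ((2 ^ j) powr p) * J (n (Suc j)) (n j) \<le> ennreal ((1 / 2) ^ j)" by simp
  qed auto
  also have "\<dots> < \<infinity>"
    by (subst suminf_ennreal2) (auto simp: summable_geometric)
  finally have "AE x in M. (\<Sum>j. ennreal ((2 ^ j) powr p) * ennreal (g j x powr p)) \<noteq> \<infinity>"
    by (intro nn_integral_noteq_infinite) auto
  then have conv: "AE x in M. convergent (\<lambda>j. f (n j) x)"
  proof eventually_elim
    case (elim x)
    then obtain K where K: "(\<Sum>j. ennreal ((2 ^ j) powr p) * ennreal (g j x powr p)) = ennreal K" "0 \<le> K"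
      by (cases "\<Sum>j. ennreal ((2 ^ j) powr p) * ennreal (g j x powr p)") auto
    have "g j x \<le> K powr (1 / p) * (1 / 2) ^ j" for j
    proof -
      have "a i \<le> (\<Sum>j. a j)" for a :: "nat \<Rightarrow> ennreal" and i
        using sum_le_suminf[of a "{i}"] by simp
      from this[of "\<lambda>j. ennreal ((2 ^ j) powr p) * ennreal (g j x powr p)" j]
      have "ennreal ((2 ^ j) powr p * g j x powr p) \<le> ennreal K"
        unfolding K(1) by (simp add: ennreal_mult)
      then have "(2 ^ j * g j x) powr p \<le> K"
        using K by (simp add: powr_mult)
      then have "((2 ^ j * g j x) powr p) powr (1 / p) \<le> K powr (1 / p)"
        using p by (intro powr_mono2) auto
      then have "2 ^ j * g j x \<le> K powr (1 / p)"
        using p by (simp add: powr_powr g_def)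
      then show ?thesis by (simp add: field_simps power_divide)
    qed
    then have "norm (g j x) \<le> K powr (1 / p) * (1 / 2) ^ j" for j
      by (simp add: g_def)
    moreover have "summable (\<lambda>j. K powr (1 / p) * (1 / 2) ^ j)"
      by (intro summable_mult summable_geometric) simp
    ultimately have "summable (\<lambda>j. g j x)"
      by (rule summable_comparison_test'[rotated])
    then have "summable (\<lambda>j. norm (f (n (Suc j)) x - f (n j) x))"
      by (simp add: g_def)
    then have "summable (\<lambda>j. f (n (Suc j)) x - f (n j) x)"
      by (rule summable_norm_cancel)
    then have "convergent (\<lambda>m. \<Sum>j<m. f (n (Suc j)) x - f (n j) x)"
      by (simp add: summable_iff_convergent)
    then have "convergent (\<lambda>m. f (n m) x - f (n 0) x)"
      by (subst (asm) sum_lessThan_telescope[of "\<lambda>j. f (n j) x"])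
    then have "convergent (\<lambda>m. (f (n m) x - f (n 0) x) + f (n 0) x)"
      by (intro convergent_add convergent_const)
    then show ?case by simp
  qed
  define v where "v x = lim (\<lambda>j. f (n j) x)" for x
  have v [measurable]: "v \<in> borel_measurable M"
    unfolding v_def by (intro borel_measurable_lim_metric) measurable
  have lim: "AE x in M. (\<lambda>j. f (n j) x) \<longlonglongrightarrow> v x"
    using conv by eventually_elim (simp add: v_def convergent_LIMSEQ_iff)
  have "(\<lambda>k. \<integral>\<^sup>+x. ennreal (norm (f k x - v x) powr p) \<partial>M) \<longlonglongrightarrow> 0"
  proof (rule order_tendstoI)
    fix a :: ennreal assume "0 < a"
    then obtain \<epsilon> where \<epsilon>: "0 < \<epsilon>" "ennreal \<epsilon> < a"
      by (metis dense ennreal_less_zero_iff ennreal_cases order.strict_trans top.not_eq_extremum infinity_ennreal_def)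
    obtain N where N: "\<And>k l. k \<ge> N \<Longrightarrow> l \<ge> N \<Longrightarrow> J k l \<le> ennreal \<epsilon>"
      using cauchy[OF \<epsilon>(1)] unfolding J_def by metis
    have "(\<integral>\<^sup>+x. ennreal (norm (f k x - v x) powr p) \<partial>M) \<le> ennreal \<epsilon>" if k: "k \<ge> N" for k
    proof -
      have "(\<integral>\<^sup>+x. ennreal (norm (f k x - v x) powr p) \<partial>M)
        = (\<integral>\<^sup>+x. liminf (\<lambda>j. ennreal (norm (f k x - f (n j) x) powr p)) \<partial>M)"
      proof (rule nn_integral_cong_AE, use lim in eventually_elim)
        case (elim x)
        have "(\<lambda>j. ennreal (norm (f k x - f (n j) x) powr p)) \<longlonglongrightarrow> ennreal (norm (f k x - v x) powr p)"
          using p elim by (intro tendsto_ennrealI tendsto_powr2 tendsto_norm tendsto_diff tendsto_const) auto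
        then show ?case
          by (rule lim_imp_Liminf[OF trivial_limit_sequentially, symmetric])
      qed
      also have "\<dots> \<le> liminf (\<lambda>j. J k (n j))"
        unfolding J_def by (intro nn_integral_liminf) measurable
      also have "\<dots> \<le> ennreal \<epsilon>"
      proof (rule Liminf_le)
        have "\<forall>\<^sub>F j in sequentially. N \<le> n j"
          using filterlim_subseq[OF n] by (simp add: filterlim_at_top)
        then show "\<forall>\<^sub>F j in sequentially. J k (n j) \<le> ennreal \<epsilon>"
          by eventually_elim (use k N in auto)
      qed simp
      finally show ?thesis .
    qed
    then show "\<forall>\<^sub>F k in sequentially. (\<integral>\<^sup>+x. ennreal (norm (f k x - v x) powr p) \<partial>M) < a"
      using \<epsilon>(2) by (auto simp: eventually_sequentially intro!: exI[of _ N] intro: order_le_less_trans)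
  qed simp
  with v show ?thesis by (rule that)
qed

section \<open>Mass of the kernels near the origin\<close>

text \<open>Testing weak convergence on the closed ball with the indicator of the open one shows
  that, for large n, \<rho>_n has at least half the mass of \<rho> there; this loss of a factor 2 is
  why \<eta>/2 is asked of \<rho>. The scale is chosen from \<rho> alone, hence is the same for all
  n \<ge> N.\<close>

lemma kernel_mass_lower_bound:
  fixes \<rho> :: "'a::euclidean_space \<Rightarrow> real"
  assumes rho_pos: "eventually (\<lambda>\<delta>. set_lebesgue_integral lebesgue (ball 0 \<delta>) \<rho> > 0) (at_right 0)"
    and rho_lim: "((\<lambda>\<delta>. \<delta> powr p / set_lebesgue_integral lebesgue (ball 0 \<delta>) \<rho>) \<longlongrightarrow> 0) (at_right 0)"
    and nonneg: "\<And>n x. 0 \<le> \<rho>s n x" and meas [measurable]: "\<And>n. \<rho>s n \<in> borel_measurable borel"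
    and weak: "weak_L1_loc_conv \<rho>s \<rho>" and \<eta>: "0 < \<eta>" and s: "0 < s"
  obtains \<delta> \<mu> N where "0 < \<delta>" "\<delta> \<le> s" "0 < \<mu>" "\<delta> powr p / \<mu> \<le> \<eta>"
    "\<And>n. n \<ge> N \<Longrightarrow> ennreal \<mu> \<le> (\<integral>\<^sup>+h. indicator (ball 0 \<delta>) h * ennreal (\<rho>s n h) \<partial>lborel)"
proof -
  let ?m = "\<lambda>\<delta> f. set_lebesgue_integral lebesgue (ball (0::'a) \<delta>) f"
  have "\<forall>\<^sub>F \<delta> in at_right 0. \<delta> powr p / ?m \<delta> \<rho> < \<eta> / 2"
    using rho_lim \<eta> by (intro order_tendstoD(2)) auto
  moreover have "\<forall>\<^sub>F \<delta> in at_right (0::real). 0 < \<delta> \<and> \<delta> \<le> s"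
    using s eventually_at_right_less[of 0] eventually_at_right[of 0 s] by (auto simp: eventually_at_right[OF s])
  \<comment> \<open>Division by 0 yields 0, so smallness of the quotient alone says nothing about
    the mass; \<open>rho_pos\<close> supplies positivity.\<close>
  ultimately have "\<forall>\<^sub>F \<delta> in at_right 0. \<delta> powr p / ?m \<delta> \<rho> < \<eta> / 2 \<and> 0 < \<delta> \<and> \<delta> \<le> s \<and> 0 < ?m \<delta> \<rho>"
    using rho_pos by eventually_elim auto
  then obtain \<delta> where \<delta>: "\<delta> powr p / ?m \<delta> \<rho> < \<eta> / 2" "0 < \<delta>" "\<delta> \<le> s" "0 < ?m \<delta> \<rho>"
    using eventually_happens[of _ "at_right (0::real)"] by auto
  have sub: "ball (0::'a) \<delta> \<subseteq> cball 0 \<delta>" by auto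
  have restr: "set_lebesgue_integral lebesgue (cball 0 \<delta>) (\<lambda>x. f x * indicator (ball 0 \<delta>) x) = ?m \<delta> f" for f :: "'a \<Rightarrow> real"
    unfolding set_lebesgue_integral_def by (intro Bochner_Integration.integral_cong) (auto split: split_indicator)
  have "(\<lambda>n. set_lebesgue_integral lebesgue (cball 0 \<delta>) (\<lambda>x. \<rho>s n x * indicator (ball 0 \<delta>) x))
     \<longlonglongrightarrow> set_lebesgue_integral lebesgue (cball 0 \<delta>) (\<lambda>x. \<rho> x * indicator (ball 0 \<delta>) x)"
    using weak unfolding weak_L1_loc_conv_def
    by (elim conjE allE impE) (auto intro!: borel_measurable_indicator exI[of _ 1] split: split_indicator)
  then have "(\<lambda>n. ?m \<delta> (\<rho>s n)) \<longlonglongrightarrow> ?m \<delta> \<rho>"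
    by (simp only: restr)
  then have "\<forall>\<^sub>F n in sequentially. ?m \<delta> \<rho> / 2 < ?m \<delta> (\<rho>s n)"
    using \<delta> by (intro order_tendstoD(1)) auto
  then obtain N where N: "\<And>n. n \<ge> N \<Longrightarrow> ?m \<delta> \<rho> / 2 < ?m \<delta> (\<rho>s n)"
    by (auto simp: eventually_sequentially)
  show ?thesis
  proof (rule that[of \<delta> "?m \<delta> \<rho> / 2" N])
    show "\<delta> powr p / (?m \<delta> \<rho> / 2) \<le> \<eta>" using \<delta> by (simp add: field_simps)
    fix n assume n: "n \<ge> N"
    have "set_integrable lebesgue (cball 0 \<delta>) (\<rho>s n)"
      using weak by (simp add: weak_L1_loc_conv_def L1_loc_def)
    then have "set_integrable lebesgue (ball 0 \<delta>) (\<rho>s n)"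
      by (rule set_integrable_subset) auto
    then have int: "integrable lebesgue (\<lambda>x. indicator (ball 0 \<delta>) x *\<^sub>R \<rho>s n x)"
      by (simp add: set_integrable_def)
    have "ennreal (?m \<delta> \<rho> / 2) \<le> ennreal (?m \<delta> (\<rho>s n))"
      using N[OF n] by (intro ennreal_leI) auto
    also have "\<dots> = (\<integral>\<^sup>+x. ennreal (indicator (ball 0 \<delta>) x *\<^sub>R \<rho>s n x) \<partial>lebesgue)"
      unfolding set_lebesgue_integral_def using int nonneg by (intro nn_integral_eq_integral[symmetric]) auto
    also have "\<dots> = (\<integral>\<^sup>+h. indicator (ball 0 \<delta>) h * ennreal (\<rho>s n h) \<partial>lborel)"
      unfolding nn_integral_completion by (intro nn_integral_cong) (auto split: split_indicator)
    finally show "ennreal (?m \<delta> \<rho> / 2) \<le> (\<integral>\<^sup>+h. indicator (ball 0 \<delta>) h * ennreal (\<rho>s n h) \<partial>lborel)" .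
  qed (use \<delta> in auto)
qed

section \<open>Compactness\<close>

lemma bump_moment_diff:
  assumes \<theta>: "0 \<le> \<theta>" "\<theta> \<le> 1" and sub: "ball c \<theta> \<subseteq> cball 0 1"
  shows "bump_moment c \<theta> (v - w) = bump_moment c \<theta> v - bump_moment c \<theta> w"
  unfolding bump_moment_def bump_kernel_diff
  by (intro Bochner_Integration.integral_diff integrable_bump_kernel_const assms)

lemma bump_average_measurable [measurable]:
  assumes [measurable]: "U \<in> borel_measurable borel"
  shows "bump_average c \<theta> \<delta> U \<in> borel_measurable borel"
  unfolding bump_average_def by measurable

lemma bump_moment_measurable [measurable]:
  assumes [measurable]: "U \<in> borel_measurable borel"
  shows "(\<lambda>x. bump_moment c \<theta> (U x)) \<in> borel_measurable borel"
  unfolding bump_moment_def by measurable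

text \<open>The limit given by Arzela-Ascoli is discarded in favour of a uniform Cauchy property,
  the form that combines with the smoothing errors of two members of the sequence.\<close>

lemma bump_average_Cauchy_subsequence:
  fixes V :: "nat \<Rightarrow> 'a::euclidean_space \<Rightarrow> 'a"
  assumes S: "compact S" and \<delta>: "0 < \<delta>"
    and V: "\<And>k. integrable lborel (V k)" and L: "\<And>k. (\<integral>y. norm (V k y) \<partial>lborel) \<le> L"
    and \<theta>: "0 \<le> \<theta>" "\<theta> \<le> 1" "ball c \<theta> \<subseteq> cball 0 1"
  obtains r :: "nat \<Rightarrow> nat" where "strict_mono r"
    "\<And>\<eta>. 0 < \<eta> \<Longrightarrow> \<exists>N. \<forall>k\<ge>N. \<forall>l\<ge>N. \<forall>x\<in>S.
        norm (bump_average c \<theta> \<delta> (V (r k)) x - bump_average c \<theta> \<delta> (V (r l)) x) < \<eta>"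
proof -
  \<comment> \<open>The term \<bar>L\<bar> + 1 keeps the constant positive, since the equicontinuity
    radius is e / Lip.\<close>
  define Lip where "Lip = 3 / \<delta> ^ Suc (DIM('a)) * (\<bar>L\<bar> + 1)"
  have Lip: "0 < Lip" using \<delta> by (simp add: Lip_def)
  have lip: "norm (bump_average c \<theta> \<delta> (V k) x - bump_average c \<theta> \<delta> (V k) y) \<le> Lip * norm (x - y)" for k x y
  proof -
    have "norm (bump_average c \<theta> \<delta> (V k) x - bump_average c \<theta> \<delta> (V k) y)
      \<le> (3 / \<delta> ^ Suc (DIM('a))) * (\<integral>y. norm (V k y) \<partial>lborel) * norm (x - y)"
      by (rule bump_average_lipschitz[OF \<theta> V \<delta>])
    also have "\<dots> \<le> Lip * norm (x - y)"
      unfolding Lip_def using L[of k] \<delta> by (intro mult_right_mono mult_left_mono) auto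
    finally show ?thesis .
  qed
  show ?thesis
  proof (rule Arzela_Ascoli[OF S, of "\<lambda>k. bump_average c \<theta> \<delta> (V k)" "L / \<delta> ^ DIM('a)"])
    fix k x
    have "norm (bump_average c \<theta> \<delta> (V k) x) \<le> (\<integral>y. norm (V k y) \<partial>lborel) / \<delta> ^ DIM('a)"
      by (rule bump_average_bound[OF \<theta> V \<delta>])
    also have "\<dots> \<le> L / \<delta> ^ DIM('a)"
      using L[of k] \<delta> by (intro divide_right_mono) auto
    finally show "norm (bump_average c \<theta> \<delta> (V k) x) \<le> L / \<delta> ^ DIM('a)" .
  next
    fix x e :: "_" assume "0 < (e::real)"
    have "norm (bump_average c \<theta> \<delta> (V k) x - bump_average c \<theta> \<delta> (V k) y) < e" if "norm (x - y) < e / Lip" for k y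
    proof -
      have "Lip * norm (x - y) < e" using that Lip by (simp add: field_simps)
      then show ?thesis using lip[of k x y] by linarith
    qed
    then show "\<exists>d>0. \<forall>n y. y \<in> S \<and> norm (x - y) < d \<longrightarrow> norm (bump_average c \<theta> \<delta> (V n) x - bump_average c \<theta> \<delta> (V n) y) < e"
      using \<open>0 < e\<close> Lip by (intro exI[of _ "e / Lip"]) auto
  next
    fix g and r :: "nat \<Rightarrow> nat"
    assume r: "strict_mono r" and conv: "\<And>e. 0 < e \<Longrightarrow> \<exists>N. \<forall>n x. N \<le> n \<and> x \<in> S \<longrightarrow> norm (bump_average c \<theta> \<delta> (V (r n)) x - g x) < e"
    show thesis
    proof (rule that[OF r])
      fix \<eta> :: real assume "0 < \<eta>"
      then obtain N where N: "\<And>n x. N \<le> n \<Longrightarrow> x \<in> S \<Longrightarrow> norm (bump_average c \<theta> \<delta> (V (r n)) x - g x) < \<eta> / 2"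
        using conv[of "\<eta> / 2"] by auto
      have "norm (bump_average c \<theta> \<delta> (V (r k)) x - bump_average c \<theta> \<delta> (V (r l)) x) < \<eta>"
        if "k \<ge> N" "l \<ge> N" "x \<in> S" for k l x
        using N[OF that(1,3)] N[OF that(2,3)] norm_diff_triangle_less[of _ "g x" "\<eta> / 2" _ "\<eta> / 2"]
        by (simp add: norm_minus_commute)
      then show "\<exists>N. \<forall>k\<ge>N. \<forall>l\<ge>N. \<forall>x\<in>S. norm (bump_average c \<theta> \<delta> (V (r k)) x - bump_average c \<theta> \<delta> (V (r l)) x) < \<eta>"
        by blast
    qed
  qed
qed

text \<open>Every piece has its own average, and the subsequences are extracted one after the other;
  the Cauchy property survives thinning because k \<le> q k.\<close>

lemma bump_average_family_Cauchy_subsequence: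
  fixes V :: "nat \<Rightarrow> 'a::euclidean_space \<Rightarrow> 'a" and I :: "('b \<times> 'a \<times> real) set"
  assumes I: "finite I" and S: "compact S" and \<delta>: "0 < \<delta>"
    and V: "\<And>k. integrable lborel (V k)" and L: "\<And>k. (\<integral>y. norm (V k y) \<partial>lborel) \<le> L"
    and \<theta>: "\<And>A c \<theta>. (A, c, \<theta>) \<in> I \<Longrightarrow> 0 \<le> \<theta> \<and> \<theta> \<le> 1 \<and> ball c \<theta> \<subseteq> cball 0 1"
  shows "\<exists>r :: nat \<Rightarrow> nat. strict_mono r \<and>
    (\<forall>A c \<theta> \<eta>. (A, c, \<theta>) \<in> I \<longrightarrow> 0 < \<eta> \<longrightarrow> (\<exists>N. \<forall>k\<ge>N. \<forall>l\<ge>N. \<forall>x\<in>S.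
        norm (bump_average c \<theta> \<delta> (V (r k)) x - bump_average c \<theta> \<delta> (V (r l)) x) < \<eta>))"
  using I \<theta>
proof (induction I rule: finite_induct)
  case empty
  show ?case by (intro exI[of _ id]) (simp add: strict_mono_def)
next
  case (insert i I)
  then obtain r :: "nat \<Rightarrow> nat" where r: "strict_mono r"
    and rI: "\<And>A c \<theta> \<eta>. (A, c, \<theta>) \<in> I \<Longrightarrow> 0 < \<eta> \<Longrightarrow> \<exists>N. \<forall>k\<ge>N. \<forall>l\<ge>N. \<forall>x\<in>S.
        norm (bump_average c \<theta> \<delta> (V (r k)) x - bump_average c \<theta> \<delta> (V (r l)) x) < \<eta>"
    by (metis insertCI)
  obtain A' c' \<theta>' where i: "i = (A', c', \<theta>')" by (cases i) auto
  have \<theta>': "0 \<le> \<theta>'" "\<theta>' \<le> 1" "ball c' \<theta>' \<subseteq> cball 0 1"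
    using insert.prems[of A' c' \<theta>'] by (auto simp: i)
  obtain q :: "nat \<Rightarrow> nat" where q: "strict_mono q"
    and qi: "\<And>\<eta>. 0 < \<eta> \<Longrightarrow> \<exists>N. \<forall>k\<ge>N. \<forall>l\<ge>N. \<forall>x\<in>S.
        norm (bump_average c' \<theta>' \<delta> (V (r (q k))) x - bump_average c' \<theta>' \<delta> (V (r (q l))) x) < \<eta>"
    by (rule bump_average_Cauchy_subsequence[OF S \<delta>, of "\<lambda>k. V (r k)" L, OF V L \<theta>']) blast
  have le: "k \<le> q k" for k using q by (rule seq_suble)
  show ?case
  proof (intro exI[of _ "r \<circ> q"] conjI allI impI)
    show "strict_mono (r \<circ> q)" using r q by (rule strict_mono_o)
    fix A c \<theta> and \<eta> :: real assume in_I: "(A, c, \<theta>) \<in> insert i I" and \<eta>: "0 < \<eta>"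
    show "\<exists>N. \<forall>k\<ge>N. \<forall>l\<ge>N. \<forall>x\<in>S.
        norm (bump_average c \<theta> \<delta> (V ((r \<circ> q) k)) x - bump_average c \<theta> \<delta> (V ((r \<circ> q) l)) x) < \<eta>"
    proof (cases "(A, c, \<theta>) = i")
      case True
      then show ?thesis using qi[OF \<eta>] by (simp add: i)
    next
      case False
      then obtain N where "\<forall>k\<ge>N. \<forall>l\<ge>N. \<forall>x\<in>S.
        norm (bump_average c \<theta> \<delta> (V (r k)) x - bump_average c \<theta> \<delta> (V (r l)) x) < \<eta>"
        using in_I rI[OF _ \<eta>] by blast
      then show ?thesis
        using le by (intro exI[of _ N]) (auto intro: order_trans)
    qed
  qed
qed

text \<open>The integral T at scale \<delta> satisfies \<mu> T \<le> c0 \<delta>^p E, with \<mu> a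
  lower bound for the mass of \<rho>_n on the ball of radius \<delta>, and \<delta>^p / \<mu> is as
  small as desired. What matters is the order of quantifiers: one \<delta> serves all pieces and all
  n \<ge> N, so compactness of the averages can be used at that scale.\<close>

lemma uniform_smoothing_error:
  fixes U :: "nat \<Rightarrow> 'a::euclidean_space \<Rightarrow> 'a" and I :: "('a set \<times> 'a \<times> real) set"
  assumes p: "1 \<le> p" and I: "finite I" and s: "0 < s" and \<Omega>: "\<Omega> \<in> sets borel"
    and I_set: "\<And>A c \<theta>. (A, c, \<theta>) \<in> I \<Longrightarrow> A \<in> sets borel \<and> A \<subseteq> \<Omega> \<and> 0 < \<theta> \<and> \<theta> \<le> 1"
    and I_norm: "\<And>A c \<theta> z. (A, c, \<theta>) \<in> I \<Longrightarrow> z \<in> ball c \<theta> \<Longrightarrow> 1 / 2 \<le> norm z \<and> norm z < 1"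
    and I_seg: "\<And>A c \<theta> x z t. (A, c, \<theta>) \<in> I \<Longrightarrow> x \<in> A \<Longrightarrow> z \<in> ball c \<theta> \<Longrightarrow> 0 \<le> t \<Longrightarrow> t \<le> s \<Longrightarrow> x + t *\<^sub>R z \<in> \<Omega>"
    and U: "\<And>n. integrable lborel (U n)"
    and rho_pos: "eventually (\<lambda>\<delta>. set_lebesgue_integral lebesgue (ball 0 \<delta>) \<rho> > 0) (at_right 0)"
    and rho_lim: "((\<lambda>\<delta>. \<delta> powr p / set_lebesgue_integral lebesgue (ball 0 \<delta>) \<rho>) \<longlongrightarrow> 0) (at_right 0)"
    and nonneg: "\<And>n x. 0 \<le> \<rho>s n x" and meas: "\<And>n. \<rho>s n \<in> borel_measurable borel"
    and ratio: "\<And>n. ratio_nonincr p (\<rho>s n)" and weak: "weak_L1_loc_conv \<rho>s \<rho>"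
    and energy: "\<And>n. (\<integral>\<^sup>+h. ennreal (\<rho>s n h / norm h powr (2 * p)) * dir_diff p \<Omega> \<Omega> (U n) h h \<partial>lborel) \<le> ennreal E"
    and E: "0 \<le> E" and \<epsilon>: "0 < \<epsilon>"
  obtains \<delta> N where "0 < \<delta>" "\<delta> \<le> s"
    "\<And>n A c \<theta>. n \<ge> N \<Longrightarrow> (A, c, \<theta>) \<in> I \<Longrightarrow>
      (\<integral>\<^sup>+x. indicator A x * ennreal (norm (bump_moment c \<theta> (U n x) - bump_average c \<theta> \<delta> (U n) x) powr p) \<partial>lborel) \<le> ennreal \<epsilon>"
proof -
  define K where "K = (\<lambda>(A::'a set, c::'a, \<theta>). 2 * (2 * measure lborel (ball c \<theta>)) powr (p - 1))"
  define c0 where "c0 = unit_ball_vol (DIM('a)) * 2 ^ DIM('a) * 4 powr p"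
  have c0: "0 \<le> c0" by (simp add: c0_def)
  have K0: "0 \<le> K i" for i by (cases i) (simp add: K_def)
  define Km where "Km = (\<Sum>i\<in>I. K i)"
  have Km: "K i \<le> Km" if "i \<in> I" for i
    unfolding Km_def using I that K0 by (intro member_le_sum) auto
  have Km0: "0 \<le> Km" unfolding Km_def using K0 by (intro sum_nonneg) auto
  \<comment> \<open>Makes Km c0 E \<eta> \<le> \<epsilon>, where c0 is the dyadic comparison
    constant and Km dominates the Jensen constants of all pieces; the 1 is added because the product
    may vanish.\<close>
  define \<eta> where "\<eta> = \<epsilon> / (Km * c0 * E + 1)"
  have pos: "0 < Km * c0 * E + 1" using Km0 c0 E by (simp add: add_nonneg_pos)
  have \<eta>: "0 < \<eta>" using pos \<epsilon> by (simp add: \<eta>_def)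
  obtain \<delta> \<mu> N where \<delta>: "0 < \<delta>" "\<delta> \<le> s" and \<mu>: "0 < \<mu>" "\<delta> powr p / \<mu> \<le> \<eta>"
    and N: "\<And>n. n \<ge> N \<Longrightarrow> ennreal \<mu> \<le> (\<integral>\<^sup>+h. indicator (ball 0 \<delta>) h * ennreal (\<rho>s n h) \<partial>lborel)"
    using kernel_mass_lower_bound[OF rho_pos rho_lim nonneg meas weak \<eta> s] by blast
  have "(\<integral>\<^sup>+x. indicator A x * ennreal (norm (bump_moment c \<theta> (U n x) - bump_average c \<theta> \<delta> (U n) x) powr p) \<partial>lborel) \<le> ennreal \<epsilon>"
    if n: "n \<ge> N" and i: "(A, c, \<theta>) \<in> I" for n A c \<theta>
  proof -
    define T where "T = (\<integral>\<^sup>+z. indicator (ball c \<theta>) z * dir_diff p A \<Omega> (U n) z (\<delta> *\<^sub>R z) \<partial>lborel)"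
    have Un: "U n \<in> borel_measurable borel" using U[of n] by auto
    have sub: "ball c \<theta> \<subseteq> cball 0 1"
      using I_norm[OF i] by fastforce
    have "ennreal \<mu> * T \<le> (\<integral>\<^sup>+h. indicator (ball 0 \<delta>) h * ennreal (\<rho>s n h) \<partial>lborel) * T"
      using N[OF n] by (rule mult_right_mono) simp
    also have "\<dots> \<le> ennreal (unit_ball_vol (DIM('a)) * 2 ^ DIM('a) * 4 powr p * \<delta> powr p) *
      (\<integral>\<^sup>+h. ennreal (\<rho>s n h / norm h powr (2 * p)) * dir_diff p \<Omega> \<Omega> (U n) h h \<partial>lborel)"
      unfolding T_def
    proof (rule kernel_mass_times_dir_diff_le[OF p _ \<Omega> Un _ meas nonneg ratio])
      show "x + t *\<^sub>R z \<in> \<Omega>" if "x \<in> A" "z \<in> ball c \<theta>" "0 \<le> t" "t \<le> \<delta>" for x z t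
        using I_seg[OF i that(1,2,3)] that(4) \<delta> by simp
    qed (use I_set[OF i] I_norm[OF i] \<delta> in auto)
    also have "\<dots> \<le> ennreal (c0 * \<delta> powr p) * ennreal E"
      unfolding c0_def by (intro mult_left_mono energy) simp
    finally have le: "ennreal \<mu> * T \<le> ennreal (c0 * \<delta> powr p * E)"
      using c0 E by (simp add: ennreal_mult)
    have "T \<noteq> \<infinity>"
      using le \<mu> by (auto simp: ennreal_mult_top top_unique)
    then obtain T' where T': "T = ennreal T'" "0 \<le> T'" by (cases T) auto
    have "\<mu> * T' \<le> c0 * \<delta> powr p * E"
      using le \<mu> c0 E T' by (simp add: ennreal_mult[symmetric])
    then have "T' \<le> c0 * E * (\<delta> powr p / \<mu>)"
      using \<mu> by (simp add: field_simps)
    also have "\<dots> \<le> c0 * E * \<eta>"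
      using \<mu> c0 E by (intro mult_left_mono) auto
    finally have "K (A, c, \<theta>) * T' \<le> Km * (c0 * E * \<eta>)"
      using Km[OF i] K0 T' Km0 by (intro mult_mono) auto
    also have "\<dots> \<le> (Km * c0 * E + 1) * \<eta>"
      using \<eta> by (simp add: algebra_simps)
    also have "\<dots> = \<epsilon>" using pos by (simp add: \<eta>_def)
    finally have fin: "ennreal (K (A, c, \<theta>) * T') \<le> ennreal \<epsilon>"
      by (rule ennreal_leI)
    have "(\<integral>\<^sup>+x. indicator A x * ennreal (norm (bump_moment c \<theta> (U n x) - bump_average c \<theta> \<delta> (U n) x) powr p) \<partial>lborel)
      \<le> ennreal (2 * (2 * measure lborel (ball c \<theta>)) powr (p - 1)) * T"
      unfolding T_def
    proof (rule bump_average_approx[OF p _ _ sub _ \<Omega> U \<delta>(1)])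
      show "x + \<delta> *\<^sub>R z \<in> \<Omega>" if "x \<in> A" "z \<in> ball c \<theta>" for x z
        using I_seg[OF i that] \<delta> by simp
    qed (use I_set[OF i] in auto)
    also have "\<dots> = ennreal (K (A, c, \<theta>) * T')"
      using T' by (simp add: K_def ennreal_mult)
    finally show ?thesis using fin by (rule order_trans)
  qed
  then show ?thesis using \<delta> that by blast
qed

text \<open>Inserting both averages into B |V - W| \<le> |M V - M W| leaves two smoothing errors and
  one uniform difference. Two uses of \<open>powr_add_le\<close> give 4^p, and each of the three
  terms integrates to at most q.\<close>

lemma cover_dist_estimate:
  fixes V W :: "'a::euclidean_space \<Rightarrow> 'a"
  assumes p: "1 \<le> p" and \<theta>: "0 \<le> \<theta>" "\<theta> \<le> 1" "ball c \<theta> \<subseteq> cball 0 1"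
    and B: "0 < B" "\<And>v. B * norm v \<le> norm (bump_moment c \<theta> v)"
    and [measurable]: "A \<in> sets borel" "V \<in> borel_measurable borel" "W \<in> borel_measurable borel"
    and V: "(\<integral>\<^sup>+x. indicator A x * ennreal (norm (bump_moment c \<theta> (V x) - bump_average c \<theta> \<delta> V x) powr p) \<partial>lborel) \<le> ennreal q"
    and W: "(\<integral>\<^sup>+x. indicator A x * ennreal (norm (bump_moment c \<theta> (W x) - bump_average c \<theta> \<delta> W x) powr p) \<partial>lborel) \<le> ennreal q"
    and \<eta>: "\<And>x. x \<in> A \<Longrightarrow> norm (bump_average c \<theta> \<delta> V x - bump_average c \<theta> \<delta> W x) \<le> \<eta>"
    and A: "\<eta> powr p * measure lborel A \<le> q" "emeasure lborel A < \<infinity>" and q: "0 \<le> q"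
  shows "(\<integral>\<^sup>+x. indicator A x * ennreal (norm (V x - W x) powr p) \<partial>lborel) \<le> ennreal ((4 / B) powr p * (3 * q))"
proof -
  define a where "a x = norm (bump_moment c \<theta> (V x) - bump_average c \<theta> \<delta> V x)" for x
  define b where "b x = norm (bump_moment c \<theta> (W x) - bump_average c \<theta> \<delta> W x)" for x
  have [measurable]: "a \<in> borel_measurable borel" "b \<in> borel_measurable borel"
    unfolding a_def b_def by measurable
  have pt: "norm (V x - W x) powr p \<le> (4 / B) powr p * (a x powr p + (\<eta> powr p + b x powr p))" if x: "x \<in> A" for x
  proof -
    have \<eta>0: "0 \<le> \<eta>" using \<eta>[OF x] norm_ge_zero order_trans by blast
    have "B * norm (V x - W x) \<le> norm (bump_moment c \<theta> (V x) - bump_moment c \<theta> (W x))"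
      using B(2)[of "V x - W x"] by (simp add: bump_moment_diff[OF \<theta>])
    also have "\<dots> = norm ((bump_moment c \<theta> (V x) - bump_average c \<theta> \<delta> V x)
        + ((bump_average c \<theta> \<delta> V x - bump_average c \<theta> \<delta> W x) - (bump_moment c \<theta> (W x) - bump_average c \<theta> \<delta> W x)))"
      by simp
    also have "\<dots> \<le> a x + (\<eta> + b x)"
      unfolding a_def b_def
      using \<eta>[OF x]
        norm_triangle_ineq[of "bump_moment c \<theta> (V x) - bump_average c \<theta> \<delta> V x"
          "(bump_average c \<theta> \<delta> V x - bump_average c \<theta> \<delta> W x) - (bump_moment c \<theta> (W x) - bump_average c \<theta> \<delta> W x)"]
        norm_triangle_ineq4[of "bump_average c \<theta> \<delta> V x - bump_average c \<theta> \<delta> W x"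
          "bump_moment c \<theta> (W x) - bump_average c \<theta> \<delta> W x"]
      by linarith
    finally have "norm (V x - W x) \<le> (a x + (\<eta> + b x)) / B"
      using B by (simp add: field_simps)
    then have "norm (V x - W x) powr p \<le> ((a x + (\<eta> + b x)) / B) powr p"
      using p by (intro powr_mono2) auto
    also have "\<dots> = (a x + (\<eta> + b x)) powr p / B powr p"
      by (simp add: powr_divide)
    finally have le: "norm (V x - W x) powr p \<le> (a x + (\<eta> + b x)) powr p / B powr p" .
    have one: "1 \<le> (2::real) powr p"
      using p by (intro ge_one_powr_ge_zero) auto
    have "(a x + (\<eta> + b x)) powr p \<le> 2 powr p * (a x powr p + (\<eta> + b x) powr p)"
      using \<eta>0 p by (intro powr_add_le) (auto simp: a_def b_def)
    also have "\<dots> \<le> 2 powr p * (2 powr p * a x powr p + 2 powr p * (\<eta> powr p + b x powr p))"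
    proof (intro mult_left_mono add_mono)
      show "(\<eta> + b x) powr p \<le> 2 powr p * (\<eta> powr p + b x powr p)"
        using \<eta>0 p by (intro powr_add_le) (auto simp: b_def)
      show "a x powr p \<le> 2 powr p * a x powr p"
        using mult_right_mono[OF one, of "a x powr p"] by simp
    qed simp
    also have "\<dots> = (2 powr p * 2 powr p) * (a x powr p + (\<eta> powr p + b x powr p))"
      by (simp add: algebra_simps)
    also have "2 powr p * 2 powr p = (4::real) powr p"
      using powr_mult[of 2 2 p] by simp
    finally have "(a x + (\<eta> + b x)) powr p / B powr p \<le> 4 powr p * (a x powr p + (\<eta> powr p + b x powr p)) / B powr p"
      by (rule divide_right_mono) simp
    with le show ?thesis
      by (simp add: powr_divide)
  qed
  have "(\<integral>\<^sup>+x. indicator A x * ennreal (norm (V x - W x) powr p) \<partial>lborel)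
    \<le> (\<integral>\<^sup>+x. ennreal ((4 / B) powr p) * (indicator A x * ennreal (a x powr p) + (ennreal (\<eta> powr p) * indicator A x + indicator A x * ennreal (b x powr p))) \<partial>lborel)"
  proof (intro nn_integral_mono)
    fix x
    show "indicator A x * ennreal (norm (V x - W x) powr p)
      \<le> ennreal ((4 / B) powr p) * (indicator A x * ennreal (a x powr p) + (ennreal (\<eta> powr p) * indicator A x + indicator A x * ennreal (b x powr p)))"
      using ennreal_leI[OF pt[of x]] by (cases "x \<in> A") (simp_all add: ennreal_mult)
  qed
  also have "\<dots> = ennreal ((4 / B) powr p) * ((\<integral>\<^sup>+x. indicator A x * ennreal (a x powr p) \<partial>lborel)
      + (ennreal (\<eta> powr p) * emeasure lborel A + (\<integral>\<^sup>+x. indicator A x * ennreal (b x powr p) \<partial>lborel)))"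
    by (simp add: nn_integral_cmult nn_integral_add)
  also have "\<dots> \<le> ennreal ((4 / B) powr p) * (ennreal q + (ennreal q + ennreal q))"
  proof (intro mult_left_mono add_mono)
    show "ennreal (\<eta> powr p) * emeasure lborel A \<le> ennreal q"
      using A by (simp add: emeasure_eq_ennreal_measure ennreal_mult[symmetric] ennreal_leI)
  qed (use V W in \<open>simp_all add: a_def b_def\<close>)
  also have "\<dots> = ennreal ((4 / B) powr p * (3 * q))"
    using q by (simp add: ennreal_mult[symmetric] ennreal_plus[symmetric] del: ennreal_plus)
  finally show ?thesis .
qed

text \<open>The tolerance \<epsilon> determines q and q determines \<delta>; the averages are
  compared at this one scale, so the subsequence works for this \<epsilon> only. Overlaps between
  pieces are harmless because only an upper bound is sought.\<close>

lemma Lp_Cauchy_eps_subsequence: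
  fixes V :: "nat \<Rightarrow> 'a::euclidean_space \<Rightarrow> 'a" and I :: "('a set \<times> 'a \<times> real) set"
  assumes p: "1 \<le> p" and I: "finite I" and bdd: "bounded \<Omega>" and \<Omega> [measurable]: "\<Omega> \<in> sets borel"
    and cover: "\<Omega> \<subseteq> (\<Union>(A, c, \<theta>)\<in>I. A)"
    and I_set: "\<And>A c \<theta>. (A, c, \<theta>) \<in> I \<Longrightarrow> A \<in> sets borel \<and> A \<subseteq> \<Omega> \<and> 0 < \<theta> \<and> \<theta> \<le> 1"
    and I_ball: "\<And>A c \<theta>. (A, c, \<theta>) \<in> I \<Longrightarrow> ball c \<theta> \<subseteq> cball 0 1"
    and V: "\<And>k. integrable lborel (V k)" and L: "\<And>k. (\<integral>y. norm (V k y) \<partial>lborel) \<le> L"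
    and zero: "\<And>k x. x \<notin> \<Omega> \<Longrightarrow> V k x = 0"
    and smooth: "\<And>q. 0 < q \<Longrightarrow> \<exists>\<delta>>0. \<exists>N. \<forall>k\<ge>N. \<forall>(A, c, \<theta>)\<in>I.
      (\<integral>\<^sup>+x. indicator A x * ennreal (norm (bump_moment c \<theta> (V k x) - bump_average c \<theta> \<delta> (V k) x) powr p) \<partial>lborel) \<le> ennreal q"
    and \<epsilon>: "0 < \<epsilon>"
  obtains r :: "nat \<Rightarrow> nat" where "strict_mono r"
    "\<And>k l. (\<integral>\<^sup>+x. ennreal (norm (V (r k) x - V (r l) x) powr p) \<partial>lborel) \<le> ennreal \<epsilon>"
proof -
  have [measurable]: "V k \<in> borel_measurable borel" for k using V[of k] by auto
  have fin: "emeasure lborel \<Omega> < \<infinity>" using bdd by (rule emeasure_bounded_finite)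
  have "\<exists>B. \<forall>A c \<theta>. (A, c, \<theta>) \<in> I \<longrightarrow> 0 < B (A, c, \<theta>) \<and> (\<forall>v. B (A, c, \<theta>) * norm v \<le> norm (bump_moment c \<theta> v))"
  proof -
    have "\<exists>b. 0 < b \<and> (\<forall>v. b * norm v \<le> norm (bump_moment c \<theta> v))" if "(A, c, \<theta>) \<in> I" for A c \<theta>
      using bump_moment_bounded_below[of \<theta> c] I_set[OF that] I_ball[OF that] by metis
    then have "\<forall>i\<in>I. \<exists>b. 0 < b \<and> (\<forall>v. b * norm v \<le> norm (bump_moment (fst (snd i)) (snd (snd i)) v))"
      by force
    then obtain B where "\<forall>i\<in>I. 0 < B i \<and> (\<forall>v. B i * norm v \<le> norm (bump_moment (fst (snd i)) (snd (snd i)) v))"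
      by (auto simp: bchoice_iff)
    then show ?thesis by (intro exI[of _ B]) auto
  qed
  then obtain B where B: "\<And>A c \<theta>. (A, c, \<theta>) \<in> I \<Longrightarrow> 0 < B (A, c, \<theta>)"
    "\<And>A c \<theta> v. (A, c, \<theta>) \<in> I \<Longrightarrow> B (A, c, \<theta>) * norm v \<le> norm (bump_moment c \<theta> v)"
    by blast
  define G where "G = (\<Sum>i\<in>I. (4 / B i) powr p)"
  have G: "0 \<le> G" unfolding G_def by (intro sum_nonneg) auto
  \<comment> \<open>Each piece contributes (4/B)^p 3q, and the sum over I is 3qG = \<epsilon> G / (G
    + 1).\<close>
  define q where "q = \<epsilon> / (G + 1) / 3"
  have q: "0 < q" using \<epsilon> G by (simp add: q_def)
  \<comment> \<open>The uniform distance whose p-th power, integrated over any piece, stays below q;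
    adding 1 guards against a null domain.\<close>
  define \<eta> where "\<eta> = (q / (measure lborel \<Omega> + 1)) powr (1 / p)"
  have \<eta>: "0 < \<eta>" using q by (simp add: \<eta>_def add_nonneg_eq_0_iff)
  have \<eta>p: "\<eta> powr p * measure lborel A \<le> q" if "A \<in> sets borel" "A \<subseteq> \<Omega>" for A
  proof -
    have "\<eta> powr p = q / (measure lborel \<Omega> + 1)"
      using p q by (simp add: \<eta>_def powr_powr)
    moreover have "measure lborel A \<le> measure lborel \<Omega> + 1"
    proof -
      have "measure lborel A \<le> measure lborel \<Omega>"
        using that fin by (intro measure_mono_fmeasurable) (auto simp: fmeasurable_def)
      then show ?thesis by simp
    qed
    ultimately have "\<eta> powr p * measure lborel A \<le> q / (measure lborel \<Omega> + 1) * (measure lborel \<Omega> + 1)"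
      using q by (intro mult_mono) auto
    also have "\<dots> = q"
      using measure_nonneg[of lborel \<Omega>] by (simp add: add_nonneg_eq_0_iff)
    finally show ?thesis .
  qed
  obtain \<delta> N where \<delta>: "0 < \<delta>" and N: "\<forall>k\<ge>N. \<forall>(A, c, \<theta>)\<in>I.
      (\<integral>\<^sup>+x. indicator A x * ennreal (norm (bump_moment c \<theta> (V k x) - bump_average c \<theta> \<delta> (V k) x) powr p) \<partial>lborel) \<le> ennreal q"
    using smooth[OF q] by blast
  have N': "(\<integral>\<^sup>+x. indicator A x * ennreal (norm (bump_moment c \<theta> (V k x) - bump_average c \<theta> \<delta> (V k) x) powr p) \<partial>lborel) \<le> ennreal q"
    if "k \<ge> N" "(A, c, \<theta>) \<in> I" for k A c \<theta>
    using N[rule_format, OF that] by simp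
  have S: "compact (closure \<Omega>)" using bdd by simp
  obtain r :: "nat \<Rightarrow> nat" where r: "strict_mono r"
    and rI: "\<forall>A c \<theta> \<eta>. (A, c, \<theta>) \<in> I \<longrightarrow> 0 < \<eta> \<longrightarrow> (\<exists>N. \<forall>k\<ge>N. \<forall>l\<ge>N. \<forall>x\<in>closure \<Omega>.
        norm (bump_average c \<theta> \<delta> (V (r k)) x - bump_average c \<theta> \<delta> (V (r l)) x) < \<eta>)"
    using bump_average_family_Cauchy_subsequence[of I "closure \<Omega>" \<delta> V L, OF I S \<delta> V L] I_set I_ball
    by (smt (verit))
  have "\<forall>i\<in>I. \<exists>M. \<forall>k\<ge>M. \<forall>l\<ge>M. \<forall>x\<in>closure \<Omega>.
        norm (bump_average (fst (snd i)) (snd (snd i)) \<delta> (V (r k)) x - bump_average (fst (snd i)) (snd (snd i)) \<delta> (V (r l)) x) < \<eta>"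
    using rI \<eta> by auto
  then obtain M where M: "\<forall>i\<in>I. \<forall>k\<ge>M i. \<forall>l\<ge>M i. \<forall>x\<in>closure \<Omega>.
        norm (bump_average (fst (snd i)) (snd (snd i)) \<delta> (V (r k)) x - bump_average (fst (snd i)) (snd (snd i)) \<delta> (V (r l)) x) < \<eta>"
    by (auto simp: bchoice_iff)
  define m where "m = N + (\<Sum>i\<in>I. M i)"
  have mM: "M i \<le> m" if "i \<in> I" for i
    unfolding m_def using I that by (intro trans_le_add2 member_le_sum) auto
  have r_ge: "k \<le> r k" for k using r by (rule seq_suble)
  show ?thesis
  \<comment> \<open>Dropping the first m terms makes the estimate valid for all pairs of indices,
    not only for large ones.\<close>
  proof (rule that[of "\<lambda>k. r (k + m)"])
    show "strict_mono (\<lambda>k. r (k + m))"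
      using r by (simp add: strict_mono_def)
    fix k l
    define X where "X = V (r (k + m))"
    define Y where "Y = V (r (l + m))"
    have [measurable]: "X \<in> borel_measurable borel" "Y \<in> borel_measurable borel" by (simp_all add: X_def Y_def)
    have [measurable]: "fst i \<in> sets borel" if "i \<in> I" for i
      using I_set[of "fst i" "fst (snd i)" "snd (snd i)"] that by simp
    have pt: "ennreal (norm (X x - Y x) powr p) \<le> (\<Sum>i\<in>I. indicator (fst i) x * ennreal (norm (X x - Y x) powr p))" for x
    proof (cases "x \<in> \<Omega>")
      case True
      then obtain i where i: "i \<in> I" "x \<in> fst i" using cover by fastforce
      have "indicator (fst i) x * ennreal (norm (X x - Y x) powr p) \<le> (\<Sum>i\<in>I. indicator (fst i) x * ennreal (norm (X x - Y x) powr p))"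
        using I i(1) by (intro member_le_sum) auto
      then show ?thesis using i by simp
    next
      case False
      then show ?thesis by (simp add: X_def Y_def zero)
    qed
    have "(\<integral>\<^sup>+x. ennreal (norm (X x - Y x) powr p) \<partial>lborel)
      \<le> (\<integral>\<^sup>+x. (\<Sum>i\<in>I. indicator (fst i) x * ennreal (norm (X x - Y x) powr p)) \<partial>lborel)"
      by (intro nn_integral_mono pt)
    also have "\<dots> = (\<Sum>i\<in>I. \<integral>\<^sup>+x. indicator (fst i) x * ennreal (norm (X x - Y x) powr p) \<partial>lborel)"
      by (rule nn_integral_sum) measurable
    also have "\<dots> \<le> (\<Sum>i\<in>I. ennreal ((4 / B i) powr p * (3 * q)))"
    proof (rule sum_mono)
      fix i assume i: "i \<in> I"
      obtain A c \<theta> where i_eq: "i = (A, c, \<theta>)" by (cases i) auto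
      have i': "(A, c, \<theta>) \<in> I" using i i_eq by simp
      have A: "A \<in> sets borel" "A \<subseteq> \<Omega>" and \<theta>: "0 \<le> \<theta>" "\<theta> \<le> 1"
        using I_set[OF i'] by auto
      have "(\<integral>\<^sup>+x. indicator A x * ennreal (norm (X x - Y x) powr p) \<partial>lborel) \<le> ennreal ((4 / B (A, c, \<theta>)) powr p * (3 * q))"
      proof (rule cover_dist_estimate[OF p \<theta> I_ball[OF i'] B(1)[OF i'] B(2)[OF i'] A(1)])
        show "(\<integral>\<^sup>+x. indicator A x * ennreal (norm (bump_moment c \<theta> (X x) - bump_average c \<theta> \<delta> X x) powr p) \<partial>lborel) \<le> ennreal q"
          unfolding X_def using r_ge[of "k + m"] by (intro N'[OF _ i']) (simp add: m_def)
        show "(\<integral>\<^sup>+x. indicator A x * ennreal (norm (bump_moment c \<theta> (Y x) - bump_average c \<theta> \<delta> Y x) powr p) \<partial>lborel) \<le> ennreal q"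
          unfolding Y_def using r_ge[of "l + m"] by (intro N'[OF _ i']) (simp add: m_def)
        show "norm (bump_average c \<theta> \<delta> X x - bump_average c \<theta> \<delta> Y x) \<le> \<eta>" if "x \<in> A" for x
        proof -
          have "x \<in> closure \<Omega>" using that A closure_subset by blast
          then show ?thesis
            using M[rule_format, OF i', of "k + m" "l + m" x] mM[OF i'] by (simp add: X_def Y_def less_imp_le)
        qed
        show "emeasure lborel A < \<infinity>"
          using emeasure_mono[OF A(2), of lborel] fin \<Omega> by (simp add: order_le_less_trans)
      qed (use A q \<eta>p in auto)
      then show "(\<integral>\<^sup>+x. indicator (fst i) x * ennreal (norm (X x - Y x) powr p) \<partial>lborel) \<le> ennreal ((4 / B i) powr p * (3 * q))"
        by (simp add: i_eq)
    qed
    also have "\<dots> = ennreal (G * (3 * q))"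
      using q by (simp add: G_def sum_distrib_right sum_ennreal)
    also have "\<dots> \<le> ennreal \<epsilon>"
    proof (rule ennreal_leI)
      have "3 * (x / 3) = x" for x :: real by simp
      from this[of "\<epsilon> / (G + 1)"] have "3 * q = \<epsilon> / (G + 1)" by (simp only: q_def)
      then have "G * (3 * q) = (G / (G + 1)) * \<epsilon>" by simp
      also have "\<dots> \<le> 1 * \<epsilon>" using G \<epsilon> by (intro mult_right_mono) auto
      finally show "G * (3 * q) \<le> \<epsilon>" by simp
    qed
    finally show "(\<integral>\<^sup>+x. ennreal (norm (V (r (k + m)) x - V (r (l + m)) x) powr p) \<partial>lborel) \<le> ennreal \<epsilon>"
      by (simp add: X_def Y_def)
  qed
qed

text \<open>\<open>P n\<close> speaks of all pairs of indices and therefore passes to every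
  subsequence; this is what lets the diagonal sequence satisfy it on its tail from
  \<open>Suc n\<close>, for each n, and so be Cauchy.\<close>

lemma Lp_convergent_subsequence:
  fixes V :: "nat \<Rightarrow> 'a::euclidean_space \<Rightarrow> 'a" and I :: "('a set \<times> 'a \<times> real) set"
  assumes p: "1 \<le> p" and I: "finite I" and bdd: "bounded \<Omega>" and \<Omega> [measurable]: "\<Omega> \<in> sets borel"
    and cover: "\<Omega> \<subseteq> (\<Union>(A, c, \<theta>)\<in>I. A)"
    and I_set: "\<And>A c \<theta>. (A, c, \<theta>) \<in> I \<Longrightarrow> A \<in> sets borel \<and> A \<subseteq> \<Omega> \<and> 0 < \<theta> \<and> \<theta> \<le> 1"
    and I_ball: "\<And>A c \<theta>. (A, c, \<theta>) \<in> I \<Longrightarrow> ball c \<theta> \<subseteq> cball 0 1"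
    and V: "\<And>k. integrable lborel (V k)" and L: "\<And>k. (\<integral>y. norm (V k y) \<partial>lborel) \<le> L"
    and zero: "\<And>k x. x \<notin> \<Omega> \<Longrightarrow> V k x = 0"
    and smooth: "\<And>q. 0 < q \<Longrightarrow> \<exists>\<delta>>0. \<exists>N. \<forall>k\<ge>N. \<forall>(A, c, \<theta>)\<in>I.
      (\<integral>\<^sup>+x. indicator A x * ennreal (norm (bump_moment c \<theta> (V k x) - bump_average c \<theta> \<delta> (V k) x) powr p) \<partial>lborel) \<le> ennreal q"
  obtains r :: "nat \<Rightarrow> nat" and v where "strict_mono r" "v \<in> borel_measurable borel"
    "(\<lambda>k. \<integral>\<^sup>+x. ennreal (norm (V (r k) x - v x) powr p) \<partial>lborel) \<longlonglongrightarrow> 0"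
proof -
  have [measurable]: "V k \<in> borel_measurable borel" for k using V[of k] by auto
  define P where "P n s \<longleftrightarrow> (\<forall>k l. (\<integral>\<^sup>+x. ennreal (norm (V (s k) x - V (s l) x) powr p) \<partial>lborel) \<le> ennreal (1 / Suc n))"
    for n :: nat and s :: "nat \<Rightarrow> nat"
  have "\<exists>d. strict_mono d \<and> (\<forall>n. P n (d \<circ> (+) (Suc n)))"
  proof -
    interpret subseqs P
    proof
      fix n and s :: "nat \<Rightarrow> nat" assume s: "strict_mono s"
      have smooth': "\<exists>\<delta>>0. \<exists>N. \<forall>k\<ge>N. \<forall>(A, c, \<theta>)\<in>I.
        (\<integral>\<^sup>+x. indicator A x * ennreal (norm (bump_moment c \<theta> (V (s k) x) - bump_average c \<theta> \<delta> (V (s k)) x) powr p) \<partial>lborel) \<le> ennreal q"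
        if "0 < q" for q
        using smooth[OF that] seq_suble[OF s] by (meson order_trans)
      show "\<exists>r'. strict_mono r' \<and> P n (s \<circ> r')"
        by (rule Lp_Cauchy_eps_subsequence[of p I \<Omega> "\<lambda>k. V (s k)" L "1 / Suc n", OF p I bdd \<Omega> cover I_set I_ball V L zero smooth'])
           (auto simp: P_def)
    qed
    have "P n (diagseq \<circ> (+) (Suc n))" for n
      by (rule diagseq_holds) (auto simp: P_def)
    with subseq_diagseq show ?thesis by blast
  qed
  then obtain d where d: "strict_mono d" and P: "\<And>n. P n (d \<circ> (+) (Suc n))"
    by blast
  have cauchy: "\<exists>N. \<forall>k\<ge>N. \<forall>l\<ge>N. (\<integral>\<^sup>+x. ennreal (norm (V (d k) x - V (d l) x) powr p) \<partial>lborel) \<le> ennreal \<epsilon>"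
    if eps: "0 < \<epsilon>" for \<epsilon>
  proof -
    obtain n where n: "1 / real (Suc n) < \<epsilon>"
      by (rule nat_approx_posE[OF eps])
    have "(\<integral>\<^sup>+x. ennreal (norm (V (d k) x - V (d l) x) powr p) \<partial>lborel) \<le> ennreal \<epsilon>"
      if k: "k \<ge> Suc n" and l: "l \<ge> Suc n" for k l
    proof -
      obtain k' where k': "k = Suc n + k'" using le_Suc_ex[OF k] ..
      obtain l' where l': "l = Suc n + l'" using le_Suc_ex[OF l] ..
      have "(\<integral>\<^sup>+x. ennreal (norm (V (d k) x - V (d l) x) powr p) \<partial>lborel) \<le> ennreal (1 / Suc n)"
        unfolding k' l' using P[of n, unfolded P_def o_def] by blast
      also have "\<dots> \<le> ennreal \<epsilon>" using n by (intro ennreal_leI) auto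
      finally show ?thesis .
    qed
    then show ?thesis by blast
  qed
  obtain v where v: "v \<in> borel_measurable lborel"
    "(\<lambda>k. \<integral>\<^sup>+x. ennreal (norm (V (d k) x - v x) powr p) \<partial>lborel) \<longlonglongrightarrow> 0"
    by (rule Lp_Cauchy_convergent[of p "\<lambda>k. V (d k)" lborel, OF p _ cauchy]) auto
  then show ?thesis
    using that[OF d, of v] by simp
qed

section \<open>Stability of directional differences under L^p perturbation\<close>

text \<open>A crude bound without any decay as h tends to 0, sufficient once h is kept away from the
  origin. It makes the test function built from the limit bounded and, applied to U_k - V, makes the
  error vanish.\<close>

lemma dir_diff_le_norm:
  fixes W :: "'a::euclidean_space \<Rightarrow> 'a"
  assumes p: "0 \<le> p" and [measurable]: "W \<in> borel_measurable borel" "A \<in> sets borel" "\<Omega> \<in> sets borel"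
  shows "dir_diff p A \<Omega> W z h \<le> ennreal (norm z powr p * 2 powr p * 2) * (\<integral>\<^sup>+x. ennreal (norm (W x) powr p) \<partial>lborel)"
proof -
  define c where "c = norm z powr p * 2 powr p"
  have pt: "\<bar>z \<bullet> (W (x + h) - W x)\<bar> powr p \<le> c * (norm (W (x + h)) powr p + norm (W x) powr p)" for x
  proof -
    have "\<bar>z \<bullet> (W (x + h) - W x)\<bar> \<le> norm z * (norm (W (x + h)) + norm (W x))"
      by (rule order_trans[OF Cauchy_Schwarz_ineq2]) (intro mult_left_mono norm_triangle_ineq4 norm_ge_zero)
    then have "\<bar>z \<bullet> (W (x + h) - W x)\<bar> powr p \<le> (norm z * (norm (W (x + h)) + norm (W x))) powr p"
      using p by (intro powr_mono2) auto
    also have "\<dots> = norm z powr p * (norm (W (x + h)) + norm (W x)) powr p"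
      by (simp add: powr_mult)
    also have "\<dots> \<le> norm z powr p * (2 powr p * (norm (W (x + h)) powr p + norm (W x) powr p))"
      using p by (intro mult_left_mono powr_add_le) auto
    finally show ?thesis by (simp add: c_def)
  qed
  have "dir_diff p A \<Omega> W z h \<le> (\<integral>\<^sup>+x. ennreal c * (ennreal (norm (W (x + h)) powr p) + ennreal (norm (W x) powr p)) \<partial>lborel)"
    unfolding dir_diff_def
  proof (intro nn_integral_mono)
    fix x
    have "ennreal (\<bar>z \<bullet> (W (x + h) - W x)\<bar> powr p) \<le> ennreal c * (ennreal (norm (W (x + h)) powr p) + ennreal (norm (W x) powr p))"
      using ennreal_leI[OF pt[of x]] by (simp add: ennreal_mult c_def)
    then show "indicator A x * indicator \<Omega> (x + h) * ennreal (\<bar>z \<bullet> (W (x + h) - W x)\<bar> powr p)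
      \<le> ennreal c * (ennreal (norm (W (x + h)) powr p) + ennreal (norm (W x) powr p))"
      by (auto split: split_indicator)
  qed
  also have "\<dots> = ennreal c * ((\<integral>\<^sup>+x. ennreal (norm (W (x + h)) powr p) \<partial>lborel) + (\<integral>\<^sup>+x. ennreal (norm (W x) powr p) \<partial>lborel))"
    by (simp add: nn_integral_cmult nn_integral_add)
  also have "(\<integral>\<^sup>+x. ennreal (norm (W (x + h)) powr p) \<partial>lborel) = (\<integral>\<^sup>+x. ennreal (norm (W x) powr p) \<partial>lborel)"
    using nn_integral_lborel_affine[of "\<lambda>x. ennreal (norm (W x) powr p)" 1 h] by (simp add: add.commute)
  also have "ennreal c * ((\<integral>\<^sup>+x. ennreal (norm (W x) powr p) \<partial>lborel) + (\<integral>\<^sup>+x. ennreal (norm (W x) powr p) \<partial>lborel))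
    = ennreal (c * 2) * (\<integral>\<^sup>+x. ennreal (norm (W x) powr p) \<partial>lborel)"
    by (simp add: ennreal_mult c_def mult_2[symmetric] mult.assoc)
  finally show ?thesis by (simp add: c_def)
qed

text \<open>The factor 2^p is harmless where only finiteness of the limit energy is at
  stake.\<close>

lemma dir_diff_triangle:
  fixes V W :: "'a::euclidean_space \<Rightarrow> 'a"
  assumes p: "0 \<le> p" and [measurable]: "V \<in> borel_measurable borel" "W \<in> borel_measurable borel" "A \<in> sets borel" "\<Omega> \<in> sets borel"
  shows "dir_diff p A \<Omega> V z h \<le> ennreal (2 powr p) * (dir_diff p A \<Omega> W z h + dir_diff p A \<Omega> (\<lambda>x. W x - V x) z h)"
proof -
  let ?D = "\<lambda>V x. \<bar>z \<bullet> (V (x + h) - V x)\<bar>"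
  have pt: "?D V x powr p \<le> 2 powr p * (?D W x powr p + ?D (\<lambda>x. W x - V x) x powr p)" for x
  proof -
    have "?D V x \<le> ?D W x + ?D (\<lambda>x. W x - V x) x"
      by (simp add: inner_diff_right)
    then have "?D V x powr p \<le> (?D W x + ?D (\<lambda>x. W x - V x) x) powr p"
      using p by (intro powr_mono2) auto
    also have "\<dots> \<le> 2 powr p * (?D W x powr p + ?D (\<lambda>x. W x - V x) x powr p)"
      using p by (intro powr_add_le) auto
    finally show ?thesis .
  qed
  let ?i = "\<lambda>x. indicator A x * indicator \<Omega> (x + h) :: ennreal"
  have "dir_diff p A \<Omega> V z h \<le> (\<integral>\<^sup>+x. ennreal (2 powr p) * (?i x * ennreal (?D W x powr p) + ?i x * ennreal (?D (\<lambda>x. W x - V x) x powr p)) \<partial>lborel)"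
    unfolding dir_diff_def
  proof (intro nn_integral_mono)
    fix x
    show "?i x * ennreal (?D V x powr p)
      \<le> ennreal (2 powr p) * (?i x * ennreal (?D W x powr p) + ?i x * ennreal (?D (\<lambda>x. W x - V x) x powr p))"
      using ennreal_leI[OF pt[of x]] by (cases "x \<in> A"; cases "x + h \<in> \<Omega>") (simp_all add: ennreal_mult)
  qed
  also have "\<dots> = ennreal (2 powr p) * (dir_diff p A \<Omega> W z h + dir_diff p A \<Omega> (\<lambda>x. W x - V x) z h)"
    unfolding dir_diff_def by (simp add: nn_integral_cmult nn_integral_add)
  finally show ?thesis .
qed

section \<open>Energy of limit points\<close>

text \<open>Kernel and function vary together, so V is compared with U_k first, while the kernel is
  still \<rho>_k: on the truncated region this costs, up to the factor 2^p, at most b L times the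
  p-th power of the L^p distance, where L bounds the masses of the kernels on K. With V fixed, weak
  convergence replaces \<rho>_k by \<rho>. The summand 1 absorbs the vanishing error, the bound is
  free of the truncation radius, and Fatou's lemma removes the truncation.\<close>

lemma energy_limit_bound:
  fixes U :: "nat \<Rightarrow> 'a::euclidean_space \<Rightarrow> 'a" and V :: "'a \<Rightarrow> 'a"
  assumes p: "1 \<le> p" and bdd: "bounded \<Omega>" and \<Omega> [measurable]: "\<Omega> \<in> sets borel"
    and U [measurable]: "\<And>n. U n \<in> borel_measurable borel" and V [measurable]: "V \<in> borel_measurable borel"
    and V_fin: "(\<integral>\<^sup>+x. ennreal (norm (V x) powr p) \<partial>lborel) < \<infinity>"
    and conv: "(\<lambda>k. \<integral>\<^sup>+x. ennreal (norm (U k x - V x) powr p) \<partial>lborel) \<longlonglongrightarrow> 0"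
    and nonneg: "\<And>n x. 0 \<le> \<rho>s n x" and meas [measurable]: "\<And>n. \<rho>s n \<in> borel_measurable borel"
    and nonneg': "\<And>x. 0 \<le> \<rho> x" and meas' [measurable]: "\<rho> \<in> borel_measurable borel"
    and weak: "weak_L1_loc_conv \<rho>s \<rho>"
    and energy: "\<And>n. (\<integral>\<^sup>+h. ennreal (\<rho>s n h / norm h powr (2 * p)) * dir_diff p \<Omega> \<Omega> (U n) h h \<partial>lborel) \<le> ennreal E"
    and E: "0 \<le> E"
  shows "(\<integral>\<^sup>+h. ennreal (\<rho> h / norm h powr (2 * p)) * dir_diff p \<Omega> \<Omega> V h h \<partial>lborel) \<le> ennreal (2 powr p * (E + 1))"
proof -
  have p0: "0 \<le> p" using p by simp
  obtain R where R: "0 < R" "\<And>x. x \<in> \<Omega> \<Longrightarrow> norm x \<le> R"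
    using bdd by (auto simp: bounded_pos)
  \<comment> \<open>Bounds the distance between two points of \<Omega>; longer displacements
    contribute nothing, so the test function may be cut off to a compact ball at no cost.\<close>
  define R2 where "R2 = 2 * R"
  have far: "dir_diff p \<Omega> \<Omega> W h h = 0" if "R2 < norm h" for W :: "'a \<Rightarrow> 'a" and h
  proof -
    have z: "indicator \<Omega> x * indicator \<Omega> (x + h) = (0::ennreal)" for x
    proof (rule ccontr)
      assume "indicator \<Omega> x * indicator \<Omega> (x + h) \<noteq> (0::ennreal)"
      then have "x \<in> \<Omega>" "x + h \<in> \<Omega>" by (auto split: split_indicator_asm)
      then have "norm h \<le> R + R"
        using norm_triangle_ineq4[of "x + h" x] R(2)[of x] R(2)[of "x + h"] by simp
      then show False using that by (simp add: R2_def)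
    qed
    show ?thesis unfolding dir_diff_def z by simp
  qed
  define NV where "NV = (\<integral>\<^sup>+x. ennreal (norm (V x) powr p) \<partial>lborel)"
  obtain nv where nv: "NV = ennreal nv" "0 \<le> nv"
    using V_fin by (cases NV) (auto simp: NV_def)
  have trunc: "(\<integral>\<^sup>+h. indicator (- ball 0 \<epsilon>) h * (ennreal (\<rho> h / norm h powr (2 * p)) * dir_diff p \<Omega> \<Omega> V h h) \<partial>lborel)
     \<le> ennreal (2 powr p * (E + 1))" if \<epsilon>: "0 < \<epsilon>" for \<epsilon>
  proof -
    define K where "K = cball (0::'a) R2"
    define J where "J = (\<lambda>h::'a. indicator (K - ball 0 \<epsilon>) h :: real)"
    define g where "g h = J h / norm h powr (2 * p) * enn2real (dir_diff p \<Omega> \<Omega> V h h)" for h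
    \<comment> \<open>The numerator of \<open>dir_diff_le_norm\<close> at |h| = R2 over the
      denominator at |h| = \<epsilon>, the two extremes of the truncated region.\<close>
    define b where "b = R2 powr p * 2 powr p * 2 / \<epsilon> powr (2 * p)"
    have b: "0 \<le> b" by (simp add: b_def)
    have [measurable]: "K \<in> sets borel" by (simp add: K_def)
    have [measurable]: "J \<in> borel_measurable borel"
      unfolding J_def by (intro borel_measurable_indicator) (auto simp: K_def)
    \<comment> \<open>Finite because V is in L^p, so passing to reals through
      \<open>enn2real\<close>, which sends infinity to 0, loses nothing; weak convergence is tested
      with real functions.\<close>
    have dV: "dir_diff p \<Omega> \<Omega> V h h = ennreal (enn2real (dir_diff p \<Omega> \<Omega> V h h))" for h
    proof -
      have "dir_diff p \<Omega> \<Omega> V h h \<le> ennreal (norm h powr p * 2 powr p * 2) * NV"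
        unfolding NV_def by (rule dir_diff_le_norm[OF p0]) auto
      also have "\<dots> < \<infinity>" by (simp add: nv ennreal_mult[symmetric])
      finally show ?thesis by simp
    qed
    have J_bound: "ennreal (J h / norm h powr (2 * p)) * dir_diff p \<Omega> \<Omega> W h h
        \<le> ennreal b * (\<integral>\<^sup>+x. ennreal (norm (W x) powr p) \<partial>lborel)"
      if [measurable]: "W \<in> borel_measurable borel" for W :: "'a \<Rightarrow> 'a" and h
    proof (cases "h \<in> K - ball 0 \<epsilon>")
      case True
      then have h: "\<epsilon> \<le> norm h" "norm h \<le> R2" by (auto simp: K_def)
      have "ennreal (J h / norm h powr (2 * p)) * dir_diff p \<Omega> \<Omega> W h h
        \<le> ennreal (1 / \<epsilon> powr (2 * p)) * (ennreal (R2 powr p * 2 powr p * 2) * (\<integral>\<^sup>+x. ennreal (norm (W x) powr p) \<partial>lborel))"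
      proof (rule mult_mono)
        show "ennreal (J h / norm h powr (2 * p)) \<le> ennreal (1 / \<epsilon> powr (2 * p))"
          using h \<epsilon> p by (intro ennreal_leI frac_le powr_mono2) (auto simp: J_def)
        have "dir_diff p \<Omega> \<Omega> W h h \<le> ennreal (norm h powr p * 2 powr p * 2) * (\<integral>\<^sup>+x. ennreal (norm (W x) powr p) \<partial>lborel)"
          by (rule dir_diff_le_norm[OF p0]) auto
        also have "\<dots> \<le> ennreal (R2 powr p * 2 powr p * 2) * (\<integral>\<^sup>+x. ennreal (norm (W x) powr p) \<partial>lborel)"
          using h p0 by (intro mult_right_mono ennreal_leI powr_mono2) auto
        finally show "dir_diff p \<Omega> \<Omega> W h h \<le> ennreal (R2 powr p * 2 powr p * 2) * (\<integral>\<^sup>+x. ennreal (norm (W x) powr p) \<partial>lborel)" .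
      qed auto
      also have "\<dots> = ennreal b * (\<integral>\<^sup>+x. ennreal (norm (W x) powr p) \<partial>lborel)"
        by (simp add: b_def mult.assoc[symmetric] ennreal_mult[symmetric])
      finally show ?thesis .
    qed (simp add: J_def)
    have g0: "0 \<le> g h" for h by (simp add: g_def J_def)
    have g_eq: "ennreal (g h) = ennreal (J h / norm h powr (2 * p)) * dir_diff p \<Omega> \<Omega> V h h" for h
      unfolding g_def by (subst ennreal_mult) (simp_all add: J_def dV[symmetric])
    have g_bound: "g h \<le> b * nv" for h
    proof -
      have "ennreal (g h) \<le> ennreal (b * nv)"
        using J_bound[OF V, of h] b nv by (simp add: g_eq NV_def[symmetric] ennreal_mult)
      then show ?thesis
        using b nv by (simp add: ennreal_le_iff)
    qed
    have [measurable]: "g \<in> borel_measurable borel"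
      unfolding g_def by measurable
    have compK: "compact K" by (simp add: K_def)
    have gK: "indicator K h *\<^sub>R (f h * g h) = f h * g h" for f :: "'a \<Rightarrow> real" and h
      by (auto simp: g_def J_def split: split_indicator)
    have lim1: "(\<lambda>n. set_lebesgue_integral lebesgue K (\<lambda>x. \<rho>s n x * g x)) \<longlonglongrightarrow> set_lebesgue_integral lebesgue K (\<lambda>x. \<rho> x * g x)"
    proof -
      have "g \<in> borel_measurable lebesgue" by (simp add: measurable_completion)
      moreover have "\<exists>B. \<forall>x. \<bar>g x\<bar> \<le> B" using g0 g_bound by (intro exI[of _ "b * nv"]) simp
      ultimately show ?thesis using weak compK unfolding weak_L1_loc_conv_def by blast
    qed
    \<comment> \<open>Testing with the constant 1 yields a bound for the masses of all kernels on
      K.\<close>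
    have "(\<lambda>n. set_lebesgue_integral lebesgue K (\<lambda>x. \<rho>s n x * 1)) \<longlonglongrightarrow> set_lebesgue_integral lebesgue K (\<lambda>x. \<rho> x * 1)"
      using weak compK unfolding weak_L1_loc_conv_def by (blast intro: borel_measurable_const)
    then have "Bseq (\<lambda>n. set_lebesgue_integral lebesgue K (\<lambda>x. \<rho>s n x * 1))"
      by (intro convergent_imp_Bseq convergentI)
    then obtain L where L: "0 < L" "\<And>n. \<bar>set_lebesgue_integral lebesgue K (\<rho>s n)\<bar> \<le> L"
      by (auto simp: Bseq_def)
    have intK: "set_integrable lebesgue K f" if "L1_loc f" for f :: "'a \<Rightarrow> real"
      using that compK by (simp add: L1_loc_def)
    have int_g: "ennreal (set_lebesgue_integral lebesgue K (\<lambda>x. f x * g x)) = (\<integral>\<^sup>+h. ennreal (f h * g h) \<partial>lborel)"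
      if f: "L1_loc f" "\<And>x. 0 \<le> f x" and [measurable]: "f \<in> borel_measurable borel" for f :: "'a \<Rightarrow> real"
    proof -
      have "integrable lebesgue (\<lambda>x. f x * g x)"
      proof (rule Bochner_Integration.integrable_bound)
        show "integrable lebesgue (\<lambda>x. (b * nv) * (indicator K x *\<^sub>R f x))"
          using intK[OF f(1)] by (intro integrable_mult_right) (simp add: set_integrable_def)
        show "AE x in lebesgue. norm (f x * g x) \<le> norm ((b * nv) * (indicator K x *\<^sub>R f x))"
        proof (rule AE_I2)
          fix x
          show "norm (f x * g x) \<le> norm ((b * nv) * (indicator K x *\<^sub>R f x))"
          proof (cases "x \<in> K")
            case True
            then show ?thesis
              using mult_right_mono[OF g_bound[of x] f(2)[of x]] f(2)[of x] g0[of x] b nv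
              by (simp add: abs_mult mult.commute)
          next
            case False
            then show ?thesis using gK[of x f] by simp
          qed
        qed
      qed (simp add: measurable_completion)
      then have "(\<integral>\<^sup>+h. ennreal (f h * g h) \<partial>lebesgue) = ennreal (\<integral>x. f x * g x \<partial>lebesgue)"
        using f(2) g0 by (intro nn_integral_eq_integral) auto
      then show ?thesis
        unfolding set_lebesgue_integral_def gK nn_integral_completion by (rule sym)
    qed
    have intK_le: "(\<integral>\<^sup>+h. indicator K h * ennreal (\<rho>s n h) \<partial>lborel) \<le> ennreal L" for n
    proof -
      have int: "integrable lebesgue (\<lambda>x. indicator K x *\<^sub>R \<rho>s n x)"
        using intK[of "\<rho>s n"] weak by (simp add: weak_L1_loc_conv_def set_integrable_def)
      have "(\<integral>\<^sup>+h. indicator K h * ennreal (\<rho>s n h) \<partial>lborel) = (\<integral>\<^sup>+h. ennreal (indicator K h *\<^sub>R \<rho>s n h) \<partial>lebesgue)"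
        unfolding nn_integral_completion by (intro nn_integral_cong) (auto split: split_indicator)
      also have "\<dots> = ennreal (set_lebesgue_integral lebesgue K (\<rho>s n))"
        unfolding set_lebesgue_integral_def using int nonneg by (intro nn_integral_eq_integral) auto
      also have "\<dots> \<le> ennreal L" using L(2)[of n] by (intro ennreal_leI) auto
      finally show ?thesis .
    qed
    define D where "D k = (\<integral>\<^sup>+x. ennreal (norm (U k x - V x) powr p) \<partial>lborel)" for k
    have upper: "(\<integral>\<^sup>+h. ennreal (\<rho>s k h * g h) \<partial>lborel) \<le> ennreal (2 powr p) * (ennreal E + ennreal (b * L) * D k)" for k
    proof -
      define F where "F W h = ennreal (\<rho>s k h) * (ennreal (J h / norm h powr (2 * p)) * dir_diff p \<Omega> \<Omega> W h h)" for W h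
      have [measurable]: "(\<lambda>h. F W h) \<in> borel_measurable borel" if [measurable]: "W \<in> borel_measurable borel" for W
        unfolding F_def by measurable
      have "ennreal (\<rho>s k h * g h) = F V h" for h
        unfolding F_def g_eq[symmetric] by (rule ennreal_mult[OF nonneg g0])
      then have "(\<integral>\<^sup>+h. ennreal (\<rho>s k h * g h) \<partial>lborel) = (\<integral>\<^sup>+h. F V h \<partial>lborel)" by simp
      also have "\<dots> \<le> (\<integral>\<^sup>+h. ennreal (2 powr p) * (F (U k) h + F (\<lambda>x. U k x - V x) h) \<partial>lborel)"
      proof (intro nn_integral_mono)
        fix h
        have "F V h \<le> ennreal (\<rho>s k h) * (ennreal (J h / norm h powr (2 * p)) *
            (ennreal (2 powr p) * (dir_diff p \<Omega> \<Omega> (U k) h h + dir_diff p \<Omega> \<Omega> (\<lambda>x. U k x - V x) h h)))"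
          unfolding F_def by (intro mult_left_mono dir_diff_triangle[OF p0]) auto
        then show "F V h \<le> ennreal (2 powr p) * (F (U k) h + F (\<lambda>x. U k x - V x) h)"
          unfolding F_def by (simp add: distrib_left mult_ac)
      qed
      also have "\<dots> = ennreal (2 powr p) * ((\<integral>\<^sup>+h. F (U k) h \<partial>lborel) + (\<integral>\<^sup>+h. F (\<lambda>x. U k x - V x) h \<partial>lborel))"
        by (simp add: nn_integral_cmult nn_integral_add)
      also have "\<dots> \<le> ennreal (2 powr p) * (ennreal E + ennreal (b * L) * D k)"
      proof (intro mult_left_mono add_mono)
        have "F (U k) h \<le> ennreal (\<rho>s k h / norm h powr (2 * p)) * dir_diff p \<Omega> \<Omega> (U k) h h" for h
        proof -
          have "ennreal (\<rho>s k h) * ennreal (J h / norm h powr (2 * p)) \<le> ennreal (\<rho>s k h / norm h powr (2 * p))"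
            using nonneg[of k h] by (simp add: J_def ennreal_mult[symmetric] split: split_indicator)
          then show ?thesis
            unfolding F_def mult.assoc[symmetric] by (rule mult_right_mono) simp
        qed
        then have "(\<integral>\<^sup>+h. F (U k) h \<partial>lborel) \<le> (\<integral>\<^sup>+h. ennreal (\<rho>s k h / norm h powr (2 * p)) * dir_diff p \<Omega> \<Omega> (U k) h h \<partial>lborel)"
          by (rule nn_integral_mono)
        with energy[of k] show "(\<integral>\<^sup>+h. F (U k) h \<partial>lborel) \<le> ennreal E" by simp
        have "F (\<lambda>x. U k x - V x) h \<le> (indicator K h * ennreal (\<rho>s k h)) * (ennreal b * D k)" for h
        proof (cases "h \<in> K")
          case True
          have "F (\<lambda>x. U k x - V x) h \<le> ennreal (\<rho>s k h) * (ennreal b * D k)"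
            unfolding F_def D_def by (intro mult_left_mono J_bound) auto
          then show ?thesis using True by simp
        qed (simp add: F_def J_def)
        then have "(\<integral>\<^sup>+h. F (\<lambda>x. U k x - V x) h \<partial>lborel) \<le> (\<integral>\<^sup>+h. (indicator K h * ennreal (\<rho>s k h)) * (ennreal b * D k) \<partial>lborel)"
          by (rule nn_integral_mono)
        also have "\<dots> = (\<integral>\<^sup>+h. indicator K h * ennreal (\<rho>s k h) \<partial>lborel) * (ennreal b * D k)"
          by (rule nn_integral_multc) measurable
        also have "\<dots> \<le> ennreal L * (ennreal b * D k)"
          by (intro mult_right_mono intK_le) auto
        also have "\<dots> = ennreal (b * L) * D k"
          using b L by (simp add: ennreal_mult mult_ac)
        finally show "(\<integral>\<^sup>+h. F (\<lambda>x. U k x - V x) h \<partial>lborel) \<le> ennreal (b * L) * D k" .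
      qed simp
      finally show ?thesis .
    qed
    have "(\<lambda>k. ennreal (b * L) * D k) \<longlonglongrightarrow> ennreal (b * L) * 0"
      using conv unfolding D_def by (intro ennreal_tendsto_cmult) auto
    then have "\<forall>\<^sub>F k in sequentially. ennreal (b * L) * D k < 1"
      by (intro order_tendstoD(2)) auto
    then have "\<forall>\<^sub>F k in sequentially. set_lebesgue_integral lebesgue K (\<lambda>x. \<rho>s k x * g x) \<le> 2 powr p * (E + 1)"
    proof eventually_elim
      case (elim k)
      have "ennreal (set_lebesgue_integral lebesgue K (\<lambda>x. \<rho>s k x * g x)) = (\<integral>\<^sup>+h. ennreal (\<rho>s k h * g h) \<partial>lborel)"
        using weak by (intro int_g nonneg meas) (simp add: weak_L1_loc_conv_def)
      also have "\<dots> \<le> ennreal (2 powr p) * (ennreal E + ennreal (b * L) * D k)" by (rule upper)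
      also have "\<dots> \<le> ennreal (2 powr p) * (ennreal E + 1)"
        using elim by (intro mult_left_mono add_left_mono) auto
      also have "\<dots> = ennreal (2 powr p * (E + 1))"
        using E by (simp add: ennreal_mult)
      finally show ?case using E by (subst (asm) ennreal_le_iff) auto
    qed
    then have "set_lebesgue_integral lebesgue K (\<lambda>x. \<rho> x * g x) \<le> 2 powr p * (E + 1)"
      by (intro tendsto_upperbound[OF lim1]) auto
    then have "ennreal (set_lebesgue_integral lebesgue K (\<lambda>x. \<rho> x * g x)) \<le> ennreal (2 powr p * (E + 1))"
      by (rule ennreal_leI)
    also have "ennreal (set_lebesgue_integral lebesgue K (\<lambda>x. \<rho> x * g x)) = (\<integral>\<^sup>+h. ennreal (\<rho> h * g h) \<partial>lborel)"
      using weak by (intro int_g nonneg' meas') (simp add: weak_L1_loc_conv_def)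
    also have "\<dots> = (\<integral>\<^sup>+h. indicator (- ball 0 \<epsilon>) h * (ennreal (\<rho> h / norm h powr (2 * p)) * dir_diff p \<Omega> \<Omega> V h h) \<partial>lborel)"
    proof (intro nn_integral_cong)
      fix h
      show "ennreal (\<rho> h * g h) = indicator (- ball 0 \<epsilon>) h * (ennreal (\<rho> h / norm h powr (2 * p)) * dir_diff p \<Omega> \<Omega> V h h)"
      proof (cases "h \<in> K")
        case True
        show ?thesis
        proof (cases "h \<in> ball 0 \<epsilon>")
          case False
          then have "\<rho> h * g h = (\<rho> h / norm h powr (2 * p)) * enn2real (dir_diff p \<Omega> \<Omega> V h h)"
            using True by (simp add: g_def J_def)
          then have "ennreal (\<rho> h * g h) = ennreal (\<rho> h / norm h powr (2 * p)) * ennreal (enn2real (dir_diff p \<Omega> \<Omega> V h h))"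
            using nonneg' by (simp only:) (rule ennreal_mult, auto)
          then show ?thesis using False dV[of h] by simp
        qed (simp add: g_def J_def)
      next
        case False
        then show ?thesis using far[of h] by (simp add: g_def J_def K_def)
      qed
    qed
    finally show ?thesis .
  qed
  define G where "G h = ennreal (\<rho> h / norm h powr (2 * p)) * dir_diff p \<Omega> \<Omega> V h h" for h
  have [measurable]: "G \<in> borel_measurable borel" unfolding G_def by measurable
  \<comment> \<open>For h \<noteq> 0 the truncations agree with G h as soon as 1/(m+1) \<le> |h|; at
    the origin G itself is 0.\<close>
  have "G h = liminf (\<lambda>m. indicator (- ball 0 (1 / Suc m)) h * G h)" for h
  proof (cases "h = 0")
    case True
    then show ?thesis by (simp add: G_def Liminf_const)
  next
    case False
    then obtain m0 where m0: "1 / real (Suc m0) < norm h"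
      using nat_approx_posE[of "norm h"] by auto
    have "1 / real (Suc m) \<le> norm h" if "m \<ge> m0" for m
    proof -
      have "1 / real (Suc m) \<le> 1 / real (Suc m0)" using that by (intro divide_left_mono) auto
      then show ?thesis using m0 by simp
    qed
    then have "indicator (- ball 0 (1 / Suc m)) h * G h = G h" if "m \<ge> m0" for m
      using that by (simp add: not_less del: of_nat_Suc)
    then have "\<forall>\<^sub>F m in sequentially. indicator (- ball 0 (1 / Suc m)) h * G h = G h"
      unfolding eventually_sequentially by blast
    then have "(\<lambda>m. indicator (- ball 0 (1 / Suc m)) h * G h) \<longlonglongrightarrow> G h"
      by (rule tendsto_eventually)
    then show ?thesis
      by (rule lim_imp_Liminf[OF trivial_limit_sequentially, symmetric])
  qed
  then have "(\<integral>\<^sup>+h. G h \<partial>lborel) = (\<integral>\<^sup>+h. liminf (\<lambda>m. indicator (- ball 0 (1 / Suc m)) h * G h) \<partial>lborel)"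
    by simp
  also have "\<dots> \<le> liminf (\<lambda>m. \<integral>\<^sup>+h. indicator (- ball 0 (1 / Suc m)) h * G h \<partial>lborel)"
    by (intro nn_integral_liminf) (auto intro!: borel_measurable_times_ennreal borel_measurable_indicator)
  also have "\<dots> \<le> ennreal (2 powr p * (E + 1))"
    using trunc unfolding G_def by (intro Liminf_le always_eventually) auto
  finally show ?thesis by (simp add: G_def)
qed

section \<open>Borel representatives extended by zero\<close>

lemma Lp_dist_pow_eq_lborel:
  fixes u v U V :: "'a::euclidean_space \<Rightarrow> 'b::euclidean_space"
  assumes \<Omega>: "\<Omega> \<in> sets borel"
    and U: "AE x in lborel. x \<in> \<Omega> \<longrightarrow> U x = u x" "\<And>x. x \<notin> \<Omega> \<Longrightarrow> U x = 0"
    and V: "AE x in lborel. x \<in> \<Omega> \<longrightarrow> V x = v x" "\<And>x. x \<notin> \<Omega> \<Longrightarrow> V x = 0"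
  shows "Lp_dist_pow p \<Omega> u v = (\<integral>\<^sup>+x. ennreal (norm (U x - V x) powr p) \<partial>lborel)"
proof -
  have "Lp_dist_pow p \<Omega> u v = (\<integral>\<^sup>+x. ennreal (norm (u x - v x) powr p) * indicator \<Omega> x \<partial>lborel)"
    unfolding Lp_dist_pow_def using \<Omega> by (simp add: nn_integral_restrict_space nn_integral_completion)
  also have "\<dots> = (\<integral>\<^sup>+x. ennreal (norm (U x - V x) powr p) \<partial>lborel)"
    by (rule nn_integral_cong_AE, use U(1) V(1) in eventually_elim)
       (use U(2) V(2) in \<open>auto split: split_indicator\<close>)
  finally show ?thesis .
qed

text \<open>Extension by zero makes the averages available on the whole space. The jump at the
  boundary does no harm, because the directional differences compare only points of
  \<Omega>.\<close>

lemma Lp_space_borel_representative: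
  fixes u :: "'a::euclidean_space \<Rightarrow> 'b::euclidean_space"
  assumes \<Omega> [measurable]: "\<Omega> \<in> sets borel" and u: "u \<in> Lp_space p \<Omega>"
  obtains U where "U \<in> borel_measurable borel" "AE x in lborel. x \<in> \<Omega> \<longrightarrow> U x = u x" "\<And>x. x \<notin> \<Omega> \<Longrightarrow> U x = 0"
    "(\<integral>\<^sup>+x. ennreal (norm (U x) powr p) \<partial>lborel) = (\<integral>\<^sup>+x. ennreal (norm (u x) powr p) \<partial>lebesgue_on \<Omega>)"
proof -
  obtain U where U [measurable]: "U \<in> borel_measurable borel" and ae: "AE x in lborel. x \<in> \<Omega> \<longrightarrow> U x = u x"
    using u \<Omega> lebesgue_on_borel_representative unfolding Lp_space_def by blast
  define U' where "U' x = indicator \<Omega> x *\<^sub>R U x" for x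
  have "AE x in lborel. x \<in> \<Omega> \<longrightarrow> U' x = u x"
    using ae by eventually_elim (simp add: U'_def)
  moreover have "U' x = 0" if "x \<notin> \<Omega>" for x using that by (simp add: U'_def)
  ultimately have "(\<integral>\<^sup>+x. ennreal (norm (U' x) powr p) \<partial>lborel) = (\<integral>\<^sup>+x. ennreal (norm (u x) powr p) \<partial>lebesgue_on \<Omega>)"
    using Lp_dist_pow_eq_lborel[of \<Omega> U' u "\<lambda>_. 0" "\<lambda>_. 0" p] \<Omega> by (simp add: Lp_dist_pow_def)
  moreover have "U' \<in> borel_measurable borel" unfolding U'_def by measurable
  ultimately show ?thesis
    using that \<open>AE x in lborel. x \<in> \<Omega> \<longrightarrow> U' x = u x\<close> \<open>\<And>x. x \<notin> \<Omega> \<Longrightarrow> U' x = 0\<close> by blast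
qed

section \<open>The compactness theorem\<close>

text \<open>A sequence in the range of u has the form u o \<sigma>, where \<sigma> may repeat
  indices and need not increase, while the smoothing estimate concerns large indices only. If
  \<sigma> does not tend to infinity, it lies below some bound infinitely often, and the pigeonhole
  principle fixes a value.\<close>

lemma nat_sequence_subsequence:
  fixes \<sigma> :: "nat \<Rightarrow> nat"
  obtains (const) s a where "strict_mono (s :: nat \<Rightarrow> nat)" "\<And>k. \<sigma> (s k) = a"
  | (at_top) "filterlim \<sigma> at_top sequentially"
proof (cases "filterlim \<sigma> at_top sequentially")
  case False
  then obtain Z where Z: "\<not> (\<forall>\<^sub>F k in sequentially. Z \<le> \<sigma> k)"
    by (auto simp: filterlim_at_top)
  then have inf: "infinite {k. \<sigma> k < Z}"
    by (auto simp: eventually_sequentially infinite_nat_iff_unbounded_le not_le)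
  have "finite (\<sigma> ` {k. \<sigma> k < Z})"
    by (rule finite_subset[of _ "{..<Z}"]) auto
  from pigeonhole_infinite[OF inf this] obtain k0 where "infinite {k \<in> {k. \<sigma> k < Z}. \<sigma> k = \<sigma> k0}"
    by blast
  then obtain s :: "nat \<Rightarrow> nat" where "strict_mono s" "\<And>k. s k \<in> {k \<in> {k. \<sigma> k < Z}. \<sigma> k = \<sigma> k0}"
    using infinite_enumerate by blast
  then show ?thesis by (intro const[of s "\<sigma> k0"]) auto
qed (rule at_top)

theorem theorem1p3:
  fixes p :: real and \<Omega> :: "'a::euclidean_space set"
    and \<rho> :: "'a \<Rightarrow> real" and \<rho>s :: "nat \<Rightarrow> 'a \<Rightarrow> real" and u :: "nat \<Rightarrow> 'a \<Rightarrow> 'a"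
  assumes p: "1 \<le> p"
    and dom: "lipschitz_domain \<Omega>"
    and rho_L1: "L1_loc \<rho>" and rho_nonneg: "\<forall>x. 0 \<le> \<rho> x" and rho_rad: "radial \<rho>"
    and rho_ratio: "ratio_nonincr p \<rho>"
    and rho_pos: "eventually (\<lambda>\<delta>. set_lebesgue_integral lebesgue (ball 0 \<delta>) \<rho> > 0) (at_right 0)"
    and rho_lim: "((\<lambda>\<delta>. \<delta> powr p / set_lebesgue_integral lebesgue (ball 0 \<delta>) \<rho>) \<longlongrightarrow> 0) (at_right 0)"
    and rhos_nonneg: "\<forall>n x. 0 \<le> \<rho>s n x" and rhos_rad: "\<forall>n. radial (\<rho>s n)"
    and rhos_ratio: "\<forall>n. ratio_nonincr p (\<rho>s n)"
    and weak: "weak_L1_loc_conv \<rho>s \<rho>"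
    and u_Lp: "\<forall>n. u n \<in> Lp_space p \<Omega>"
    and u_bdd: "\<exists>C::real. \<forall>n. (\<integral>\<^sup>+ x. ennreal (norm (u n x) powr p) \<partial>lebesgue_on \<Omega>) \<le> ennreal C"
    and energy_bdd: "\<exists>C::real. \<forall>n. nl_energy (\<rho>s n) p \<Omega> (u n) \<le> ennreal C"
  shows "Lp_precompact p \<Omega> (range u) \<and>
         (\<forall>(r::nat \<Rightarrow> nat) v. strict_mono r \<longrightarrow> v \<in> Lp_space p \<Omega> \<longrightarrow>
                (\<lambda>k. Lp_dist_pow p \<Omega> (u (r k)) v) \<longlonglongrightarrow> 0 \<longrightarrow> v \<in> S_space \<rho> p \<Omega>)"
proof -
  have op: "open \<Omega>" and bdd: "bounded \<Omega>"
    using dom by (auto simp: lipschitz_domain_def)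
  have \<Omega> [measurable]: "\<Omega> \<in> sets borel" using op by (rule borel_open)
  have fin: "emeasure lborel \<Omega> < \<infinity>" using bdd by (rule emeasure_bounded_finite)
  have nonneg: "0 \<le> \<rho>s n x" and ratio: "ratio_nonincr p (\<rho>s n)" for n x
    using rhos_nonneg rhos_ratio by auto
  have meas: "\<rho>s n \<in> borel_measurable borel" for n
    using radial_ratio_nonincr_measurable rhos_rad rhos_ratio by blast
  have meas': "\<rho> \<in> borel_measurable borel"
    by (rule radial_ratio_nonincr_measurable[OF rho_rad rho_ratio])
  define Q where "Q n U \<longleftrightarrow> U \<in> borel_measurable borel \<and> (AE x in lborel. x \<in> \<Omega> \<longrightarrow> U x = u n x) \<and> (\<forall>x. x \<notin> \<Omega> \<longrightarrow> U x = 0) \<and>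
    (\<integral>\<^sup>+x. ennreal (norm (U x) powr p) \<partial>lborel) = (\<integral>\<^sup>+x. ennreal (norm (u n x) powr p) \<partial>lebesgue_on \<Omega>)" for n U
  have "\<exists>U. Q n U" for n
    unfolding Q_def by (rule Lp_space_borel_representative[OF \<Omega> u_Lp[rule_format, of n]]) blast
  then obtain U where "\<And>n. Q n (U n)"
    by metis
  then have U [measurable]: "\<And>n. U n \<in> borel_measurable borel"
    and ae: "\<And>n. AE x in lborel. x \<in> \<Omega> \<longrightarrow> U n x = u n x" and zero: "\<And>n x. x \<notin> \<Omega> \<Longrightarrow> U n x = 0"
    and norm_eq: "\<And>n. (\<integral>\<^sup>+x. ennreal (norm (U n x) powr p) \<partial>lborel) = (\<integral>\<^sup>+x. ennreal (norm (u n x) powr p) \<partial>lebesgue_on \<Omega>)"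
    unfolding Q_def by blast+
  obtain C0 where C0: "\<And>n. (\<integral>\<^sup>+ x. ennreal (norm (u n x) powr p) \<partial>lebesgue_on \<Omega>) \<le> ennreal C0"
    using u_bdd by blast
  define C where "C = max 0 C0"
  have C: "0 \<le> C" "(\<integral>\<^sup>+x. ennreal (norm (U n x) powr p) \<partial>lborel) \<le> ennreal C" for n
    unfolding norm_eq C_def using C0[of n] by (auto intro: order_trans ennreal_leI)
  obtain E0 where E0: "\<And>n. nl_energy (\<rho>s n) p \<Omega> (u n) \<le> ennreal E0"
    using energy_bdd by blast
  define E where "E = max 0 E0"
  have E: "0 \<le> E" by (simp add: E_def)
  have energy: "(\<integral>\<^sup>+h. ennreal (\<rho>s n h / norm h powr (2 * p)) * dir_diff p \<Omega> \<Omega> (U n) h h \<partial>lborel) \<le> ennreal E" for n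
  proof -
    have "nl_energy (\<rho>s n) p \<Omega> (u n) \<le> ennreal E"
      using E0[of n] by (auto simp: E_def intro: order_trans ennreal_leI)
    then show ?thesis
      using nl_energy_eq_dir_diff[of \<Omega> "\<rho>s n" "U n" "u n" p] \<Omega> meas ae rhos_nonneg by simp
  qed
  have int: "integrable lborel (U n)" and L1: "(\<integral>x. norm (U n x) \<partial>lborel) \<le> measure lborel \<Omega> + C" for n
    using Lp_imp_integrable[of p "U n" \<Omega> C] p \<Omega> fin zero C by auto
  obtain I :: "('a set \<times> 'a \<times> real) set" and s where I: "finite I" "0 < s" "\<Omega> \<subseteq> (\<Union>(A, c, \<theta>)\<in>I. A)"
    and I_set: "\<And>A c \<theta>. (A, c, \<theta>) \<in> I \<Longrightarrow> A \<in> sets borel \<and> A \<subseteq> \<Omega> \<and> 0 < \<theta> \<and> \<theta> \<le> 1"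
    and I_norm: "\<And>A c \<theta> z. (A, c, \<theta>) \<in> I \<Longrightarrow> z \<in> ball c \<theta> \<Longrightarrow> 1 / 2 \<le> norm z \<and> norm z < 1"
    and I_seg: "\<And>A c \<theta> x z t. (A, c, \<theta>) \<in> I \<Longrightarrow> x \<in> A \<Longrightarrow> z \<in> ball c \<theta> \<Longrightarrow> 0 \<le> t \<Longrightarrow> t \<le> s \<Longrightarrow> x + t *\<^sub>R z \<in> \<Omega>"
    by (rule lipschitz_domain_cover[OF dom]) (rule that, assumption+)
  have I_ball: "ball c \<theta> \<subseteq> cball 0 1" if "(A, c, \<theta>) \<in> I" for A c \<theta>
    using I_norm[OF that] by fastforce
  have "\<exists>s v. strict_mono s \<and> v \<in> Lp_space p \<Omega> \<and> (\<lambda>k. Lp_dist_pow p \<Omega> (w (s k)) v) \<longlonglongrightarrow> 0"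
    if w: "\<forall>k. w k \<in> range u" for w :: "nat \<Rightarrow> 'a \<Rightarrow> 'a"
  proof -
    have "\<forall>k. \<exists>m. w k = u m" using w by blast
    then obtain \<sigma> where \<sigma>: "\<And>k. w k = u (\<sigma> k)"
      by (auto simp: choice_iff)
    show ?thesis
    proof (cases rule: nat_sequence_subsequence[of \<sigma>])
      case (const s a)
      have "Lp_dist_pow p \<Omega> (w (s k)) (u a) = 0" for k
        using p by (simp add: \<sigma> const(2) Lp_dist_pow_def)
      then show ?thesis
        using const(1) u_Lp by (intro exI[of _ s] exI[of _ "u a"]) simp
    next
      case at_top
      \<comment> \<open>U o \<sigma> need not be a subsequence of U; the estimate holds for every n
        \<ge> N, so it is enough that \<sigma> tends to infinity.\<close>
      have smooth: "\<exists>\<delta>>0. \<exists>N. \<forall>k\<ge>N. \<forall>(A, c, \<theta>)\<in>I.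
        (\<integral>\<^sup>+x. indicator A x * ennreal (norm (bump_moment c \<theta> (U (\<sigma> k) x) - bump_average c \<theta> \<delta> (U (\<sigma> k)) x) powr p) \<partial>lborel) \<le> ennreal q"
        if q: "0 < q" for q
      proof (rule uniform_smoothing_error[where p = p and I = I and s = s and \<Omega> = \<Omega> and U = U and \<rho> = \<rho> and \<rho>s = \<rho>s and E = E and \<epsilon> = q])
        fix \<delta> N
        assume \<delta>: "0 < \<delta>" and N: "\<And>n A c \<theta>. n \<ge> N \<Longrightarrow> (A, c, \<theta>) \<in> I \<Longrightarrow>
          (\<integral>\<^sup>+x. indicator A x * ennreal (norm (bump_moment c \<theta> (U n x) - bump_average c \<theta> \<delta> (U n) x) powr p) \<partial>lborel) \<le> ennreal q"
        obtain M where "\<And>k. k \<ge> M \<Longrightarrow> \<sigma> k \<ge> N"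
          using at_top by (auto simp: filterlim_at_top eventually_sequentially)
        then have "\<forall>k\<ge>M. \<forall>(A, c, \<theta>)\<in>I.
          (\<integral>\<^sup>+x. indicator A x * ennreal (norm (bump_moment c \<theta> (U (\<sigma> k) x) - bump_average c \<theta> \<delta> (U (\<sigma> k)) x) powr p) \<partial>lborel) \<le> ennreal q"
          using N by auto
        then show ?thesis using \<delta> by blast
      qed (fact p I(1,2) \<Omega> I_set I_norm I_seg int rho_pos rho_lim nonneg meas ratio weak energy E q)+
      have "\<exists>s v. strict_mono (s :: nat \<Rightarrow> nat) \<and> v \<in> borel_measurable borel \<and>
        (\<lambda>k. \<integral>\<^sup>+x. ennreal (norm (U (\<sigma> (s k)) x - v x) powr p) \<partial>lborel) \<longlonglongrightarrow> 0"
      proof (rule Lp_convergent_subsequence[where p = p and I = I and \<Omega> = \<Omega> and V = "\<lambda>k. U (\<sigma> k)" and L = "measure lborel \<Omega> + C"])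
      qed (fact p I(1,3) bdd \<Omega> I_set I_ball int L1 zero smooth | blast)+
      then obtain s v where s: "strict_mono (s :: nat \<Rightarrow> nat)" and v [measurable]: "v \<in> borel_measurable borel"
        and lim: "(\<lambda>k. \<integral>\<^sup>+x. ennreal (norm (U (\<sigma> (s k)) x - v x) powr p) \<partial>lborel) \<longlonglongrightarrow> 0"
        by blast
      \<comment> \<open>Setting the limit to zero off \<Omega> lets v' be its own Borel
        representative, and does not increase the distance, as every U n vanishes there.\<close>
      define v' where "v' x = indicator \<Omega> x *\<^sub>R v x" for x
      have [measurable]: "v' \<in> borel_measurable borel" unfolding v'_def by measurable
      have le: "Lp_dist_pow p \<Omega> (w (s k)) v' \<le> (\<integral>\<^sup>+x. ennreal (norm (U (\<sigma> (s k)) x - v x) powr p) \<partial>lborel)" for k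
      proof -
        have "Lp_dist_pow p \<Omega> (w (s k)) v' = (\<integral>\<^sup>+x. ennreal (norm (U (\<sigma> (s k)) x - v' x) powr p) \<partial>lborel)"
          unfolding \<sigma> by (intro Lp_dist_pow_eq_lborel \<Omega> ae zero) (auto simp: v'_def)
        also have "\<dots> \<le> (\<integral>\<^sup>+x. ennreal (norm (U (\<sigma> (s k)) x - v x) powr p) \<partial>lborel)"
          using zero by (intro nn_integral_mono) (auto simp: v'_def split: split_indicator)
        finally show ?thesis .
      qed
      have lim': "(\<lambda>k. Lp_dist_pow p \<Omega> (w (s k)) v') \<longlonglongrightarrow> 0"
        by (rule tendsto_sandwich[OF _ _ tendsto_const lim]) (use le in auto)
      have "v' \<in> Lp_space p \<Omega>"
      proof -
        have "\<forall>\<^sub>F k in sequentially. (\<integral>\<^sup>+x. ennreal (norm (U (\<sigma> (s k)) x - v x) powr p) \<partial>lborel) < 1"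
          using lim by (intro order_tendstoD(2)) auto
        then obtain k where k: "(\<integral>\<^sup>+x. ennreal (norm (U (\<sigma> (s k)) x - v x) powr p) \<partial>lborel) < 1"
          by (auto simp: eventually_sequentially)
        define W where "W = U (\<sigma> (s k))"
        have [measurable]: "W \<in> borel_measurable borel" by (simp add: W_def)
        have pt: "norm (v x) powr p \<le> 2 powr p * (norm (W x - v x) powr p + norm (W x) powr p)" for x
        proof -
          have "norm (v x) \<le> norm (W x - v x) + norm (W x)"
            using norm_triangle_ineq4[of "W x" "W x - v x"] by simp
          then have "norm (v x) powr p \<le> (norm (W x - v x) + norm (W x)) powr p"
            using p by (intro powr_mono2) auto
          also have "\<dots> \<le> 2 powr p * (norm (W x - v x) powr p + norm (W x) powr p)"
            using p by (intro powr_add_le) auto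
          finally show ?thesis .
        qed
        have "(\<integral>\<^sup>+x. ennreal (norm (v' x) powr p) \<partial>lebesgue_on \<Omega>) = (\<integral>\<^sup>+x. ennreal (norm (v' x) powr p) * indicator \<Omega> x \<partial>lborel)"
          using \<Omega> by (simp add: nn_integral_restrict_space nn_integral_completion)
        also have "\<dots> \<le> (\<integral>\<^sup>+x. ennreal (2 powr p) * (ennreal (norm (W x - v x) powr p) + ennreal (norm (W x) powr p)) \<partial>lborel)"
        proof (intro nn_integral_mono)
          fix x
          show "ennreal (norm (v' x) powr p) * indicator \<Omega> x \<le> ennreal (2 powr p) * (ennreal (norm (W x - v x) powr p) + ennreal (norm (W x) powr p))"
            using ennreal_leI[OF pt[of x]] by (cases "x \<in> \<Omega>") (simp_all add: v'_def ennreal_mult)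
        qed
        also have "\<dots> = ennreal (2 powr p) * ((\<integral>\<^sup>+x. ennreal (norm (W x - v x) powr p) \<partial>lborel) + (\<integral>\<^sup>+x. ennreal (norm (W x) powr p) \<partial>lborel))"
          by (simp add: nn_integral_cmult nn_integral_add)
        also have "\<dots> \<le> ennreal (2 powr p) * (1 + ennreal C)"
          using k C(2) unfolding W_def by (intro mult_left_mono add_mono) auto
        also have "\<dots> < \<infinity>" by (simp add: ennreal_mult_less_top)
        finally have "(\<integral>\<^sup>+x. ennreal (norm (v' x) powr p) \<partial>lebesgue_on \<Omega>) < \<infinity>" .
        moreover have "v' \<in> borel_measurable (lebesgue_on \<Omega>)"
          by (intro measurable_restrict_space1) (simp add: measurable_completion)
        ultimately show ?thesis by (simp add: Lp_space_def)
      qed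
      with s lim' show ?thesis by blast
    qed
  qed
  then have "Lp_precompact p \<Omega> (range u)"
    unfolding Lp_precompact_def by blast
  moreover have "v \<in> S_space \<rho> p \<Omega>"
    if r: "strict_mono r" and v: "v \<in> Lp_space p \<Omega>" and lim: "(\<lambda>k. Lp_dist_pow p \<Omega> (u (r k)) v) \<longlonglongrightarrow> 0"
    for r :: "nat \<Rightarrow> nat" and v
  proof -
    obtain V where V: "V \<in> borel_measurable borel" and aeV: "AE x in lborel. x \<in> \<Omega> \<longrightarrow> V x = v x"
      and zeroV: "\<And>x. x \<notin> \<Omega> \<Longrightarrow> V x = 0"
      and normV: "(\<integral>\<^sup>+x. ennreal (norm (V x) powr p) \<partial>lborel) = (\<integral>\<^sup>+x. ennreal (norm (v x) powr p) \<partial>lebesgue_on \<Omega>)"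
      by (rule Lp_space_borel_representative[OF \<Omega> v]) blast
    have lim': "(\<lambda>k. \<integral>\<^sup>+x. ennreal (norm (U (r k) x - V x) powr p) \<partial>lborel) \<longlonglongrightarrow> 0"
      using lim by (simp add: Lp_dist_pow_eq_lborel[OF \<Omega> ae zero aeV zeroV])
    \<comment> \<open>The energy of U (r k) is bounded for the kernel with the same index r k, so
      the kernels are thinned along with the functions.\<close>
    have weak': "weak_L1_loc_conv (\<lambda>k. \<rho>s (r k)) \<rho>"
      using weak LIMSEQ_subseq_LIMSEQ[OF _ r] unfolding weak_L1_loc_conv_def o_def by blast
    have fin_V: "(\<integral>\<^sup>+x. ennreal (norm (V x) powr p) \<partial>lborel) < \<infinity>"
      using v by (simp add: normV Lp_space_def)
    have "(\<integral>\<^sup>+h. ennreal (\<rho> h / norm h powr (2 * p)) * dir_diff p \<Omega> \<Omega> V h h \<partial>lborel) \<le> ennreal (2 powr p * (E + 1))"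
      by (rule energy_limit_bound[of p \<Omega> "\<lambda>k. U (r k)" V "\<lambda>k. \<rho>s (r k)" \<rho> E, OF p bdd \<Omega> U V fin_V lim' _ meas _ meas' weak' energy E])
         (use rhos_nonneg rho_nonneg in auto)
    then have "nl_energy \<rho> p \<Omega> v < \<infinity>"
      using nl_energy_eq_dir_diff[OF \<Omega> meas' V _ aeV, of p] rho_nonneg by (auto simp: less_top[symmetric] top_unique)
    then show ?thesis using v by (simp add: S_space_def)
  qed
  ultimately show ?thesis by blast
qed

end
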